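(* Let $K:\mathbb{R}^2\to[0,\infty)$ satisfy: $K\in L^1(\mathbb{R}^2)\cap L^2(\mathbb{R}^2)$, $\int K\,d\lambda^2=1$, $\operatorname{supp}(\mathcal{F}K)\subseteq[-1,1]^2$, and $\mathcal{F}K$ is Lipschitz continuous. Let $X=(X_t)_{t\ge0}$ be a two-dimensional Lévy process with Lévy triplet $(\Sigma,\nu,\alpha)$. For $x,y\in[0,\infty)$ put $U(x,y)=\nu([x,\infty)\times[y,\infty))$, $U_1(x)=\nu([x,\infty)\times[0,\infty))$, $U_2(y)=\nu([0,\infty)\times[y,\infty))$, and assume (i) $\nu(\mathbb{R}^2\setminus[0,\infty)^2)=0$; (ii) there is $\gamma>0$ with $\int|x|^{8+\gamma}\,\nu(dx)<\infty$; (iii) there is $c>0$ with $|\mathcal{F}((x_1^4+x_2^4)\nu)(u)|\le c\,(1+|u_1|)^{-1}(1+|u_2|)^{-1}$ for all $u\in\mathbb{R}^2$; (iv) for $k=1,2$, $U_k:(0,\infty)\to(0,\infty)$ is a $\mathcal{C}^1$-bijection with $U_k'<0$, $\inf_{0<x\le1}|U_k'(x)|>0$ and $\sup_{x>0}(1\wedge x^3)|U_k'(x)|<\infty$. Let $\mathfrak{C}(u,v)=U(U_1^{-1}(u),U_2^{-1}(v))$, $u,v>0$, be the Lévy copula of $\nu$. Let $\widehat N_n$ be the estimator defined in the context, based on $X_1,\dots,X_n$, with bandwidth $h=h_n=\frac{\log\log n}{\sqrt{\log n}}$, put $\delta_n=(\log\log n)^{-1}$, $$\widehat U_{1,n}^{-1}=\mathcal{I}(\Re_+\widehat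 N_n(\cdot,0),\delta_n),\qquad \widehat U_{2,n}^{-1}=\mathcal{I}(\Re_+\widehat N_n(0,\cdot),\delta_n),$$ $$\widehat{\mathfrak{C}}_n(u,v)=\widehat N_n\big(\widehat U_{1,n}^{-1}(u),\widehat U_{2,n}^{-1}(v)\big),\quad u,v>0 .$$ Then for any two fixed numbers $0<a<b<\infty$, $$\sup_{a\le u,v\le b}|\mathfrak{C}(u,v)-\widehat{\mathfrak{C}}_n(u,v)|=O_{P_{\Sigma,\nu,\alpha}}\Big(\frac{(\log\log n)^9}{\sqrt{\log n}}\Big),\qquad n\to\infty .$$
   Context: Notation: $\mathfrak{R}=[0,\infty)^2\setminus\{(0,0)\}$; $\lambda^2$ is Lebesgue measure on $\mathbb{R}^2$; $(\mathcal{F}f)(u)=\int e^{i\langle u,x\rangle}f(x)\,\lambda^2(dx)$ and $(\mathcal{F}\mu)(u)=\int e^{i\langle u,x\rangle}\mu(dx)$; $(\mathcal{F}^{-1}f)(x)=(2\pi)^{-2}\int e^{-i\langle u,x\rangle}f(u)\,\lambda^2(du)$. $(x_1^4+x_2^4)\nu$ is the measure with $\nu$-density $x_1^4+x_2^4$. $K_h(x)=h^{-2}K(h^{-1}x)$. $\Re_+(z)=\max(\Re z,0)$ for $z\in\mathbb{C}$. $Y_n=O_P(r_n)$ means: for every $\delta>0$ there is $M>0$ with $P(|Y_n/r_n|\ge M)\le\delta$ for all $n$ (for which the quantities are defined, here $n\ge3$). Inversion operation: for a continuous $g:(0,\infty)\to[0,\infty)$ with $\lim_{x\to\infty}g(x)=0$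 and $\delta>0$, $\mathcal{I}(g,\delta)$ is the function on $(0,\infty)$ $$\mathcal{I}(g,\delta)(z)=\inf\Big\{x\ge\delta:\ \inf_{\delta\le y\le x}g(y)\le z\Big\},\quad z>0 .$$ Under $P_{\Sigma,\nu,\alpha}$ the variable $X_1$ has characteristic function $$\varphi(u)=\exp\Big(-\tfrac12\langle u,\Sigma u\rangle+i\langle u,\alpha\rangle+\int_{\mathbb{R}^2}(e^{i\langle u,x\rangle}-1-i\langle u,x\rangle)\,\nu(dx)\Big).$$ Estimator $\widehat N_n$. With $X_0=0$, put $\widehat\varphi_n(u)=\frac1n\sum_{t=1}^n e^{i\langle u,X_t-X_{t-1}\rangle}$, $u\in\mathbb{R}^2$. For $k=1,2$, writing $\partial_k=\partial/\partial u_k$, define (wherever $\widehat\varphi_n\ne0$) the function denoted $\frac{\partial^4\widehat\Psi_n}{\partial u_k^4}$ by $$\frac{\partial^4\widehat\Psi_n}{\partial u_k^4}=\frac{\partial_k^4\widehat\varphi_n}{\widehat\varphi_n}-4\frac{\partial_k\widehat\varphi_n\,\partial_k^3\widehat\varphi_n}{\widehat\varphi_n^2}-3\Big(\frac{\partial_k^2\widehat\varphi_n}{\widehat\varphi_n}\Big)^2+12\frac{(\partial_k\widehat\varphi_n)^2\,\partial_k^2\widehat\varphi_n}{\widehat\varphi_n^3}-6\Big(\frac{\partial_k\widehat\varphi_n}{\widehat\varphi_n}\Big)^4 .$$ Let $A_{h,n}=\{|\widehat\varphi_n(u)|>\frac12|\varphi(u)|\text{ for all }u\in[-\frac1h,\frac1h]^2\}$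 and $g_{a,b}(x)=\frac{1}{x_1^4+x_2^4}\mathbf{1}_{[a,\infty)\times[b,\infty)}(x_1,x_2)$. For $(a,b)\in\mathfrak{R}$, $$\widehat N_n(a,b)=\int_{\mathbb{R}^2}g_{a,b}(x)\,\mathcal{F}^{-1}\Big(\Big(\frac{\partial^4\widehat\Psi_n}{\partial u_1^4}+\frac{\partial^4\widehat\Psi_n}{\partial u_2^4}\Big)\mathcal{F}K_h\Big)(x)\,\lambda^2(dx)\ \text{ on }A_{h,n},\qquad \widehat N_n(a,b)=0\ \text{ on }A_{h,n}^c ,$$ where the product with $\mathcal{F}K_h$ is understood as $0$ outside $[-\frac1h,\frac1h]^2$. *)

theory Defs
  imports "HOL-Probability.Probability"
begin

text \<open>
  Cadlag paths are not required: only the finite-dimensional distributions matter in what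
  follows, and every process as below has a cadlag modification.
\<close>

definition levy_process :: "'w measure \<Rightarrow> (real \<Rightarrow> 'w \<Rightarrow> 'a::euclidean_space) \<Rightarrow> bool" where
  "levy_process M X \<longleftrightarrow>
     prob_space M \<and>
     (\<forall>t\<ge>0. X t \<in> borel_measurable M) \<and>
     (AE \<omega> in M. X 0 \<omega> = 0) \<and>
     (\<forall>(n::nat) (t::nat \<Rightarrow> real). 0 \<le> t 0 \<and> (\<forall>i<n. t i < t (Suc i)) \<longrightarrow>
        prob_space.indep_vars M (\<lambda>_. borel) (\<lambda>i \<omega>. X (t (Suc i)) \<omega> - X (t i) \<omega>) {..<n}) \<and>
     (\<forall>s\<ge>0. \<forall>t\<ge>0. distr M borel (\<lambda>\<omega>. X (s + t) \<omega> - X s \<omega>) = distr M borel (X t)) \<and>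
     (\<forall>t\<ge>0. \<forall>\<epsilon>>0.
        ((\<lambda>s. measure M {\<omega> \<in> space M. dist (X s \<omega>) (X t \<omega>) > \<epsilon>}) \<longlongrightarrow> 0) (at t within {0..}))"

definition levy_measure :: "'a::euclidean_space measure \<Rightarrow> bool" where
  "levy_measure \<nu> \<longleftrightarrow>
     sets \<nu> = sets borel \<and> emeasure \<nu> {0} = 0 \<and>
     (\<integral>\<^sup>+x. ennreal (min 1 ((norm x)\<^sup>2)) \<partial>\<nu>) < \<infinity>"

text \<open>Covariance matrices are represented by the linear maps they induce.\<close>

definition covariance_operator :: "('a::euclidean_space \<Rightarrow> 'a) \<Rightarrow> bool" where
  "covariance_operator \<Sigma> \<longleftrightarrow>
     linear \<Sigma> \<and> (\<forall>u v. \<Sigma> u \<bullet> v = u \<bullet> \<Sigma> v) \<and> (\<forall>u. 0 \<le> u \<bullet> \<Sigma> u)"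

text \<open>
  There is no truncation function in the exponent, so \<open>\<alpha>\<close> is the mean of the process at time 1.
  This presupposes that \<open>\<nu>\<close> integrates \<open>norm x\<close> away from the origin.
\<close>

definition levy_khintchine ::
    "('a::euclidean_space \<Rightarrow> 'a) \<Rightarrow> 'a measure \<Rightarrow> 'a \<Rightarrow> 'a \<Rightarrow> complex" where
  "levy_khintchine \<Sigma> \<nu> \<alpha> u =
     exp (- complex_of_real (u \<bullet> \<Sigma> u) / 2 + \<i> * complex_of_real (u \<bullet> \<alpha>)
          + (\<integral>x. (iexp (u \<bullet> x) - 1 - \<i> * complex_of_real (u \<bullet> x)) \<partial>\<nu>))"

definition fourier_measure :: "'a::euclidean_space measure \<Rightarrow> 'a \<Rightarrow> complex" where
  "fourier_measure \<mu> u = (\<integral>x. iexp (u \<bullet> x) \<partial>\<mu>)"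

definition levy_process_with_triplet ::
    "'w measure \<Rightarrow> (real \<Rightarrow> 'w \<Rightarrow> 'a::euclidean_space) \<Rightarrow>
     ('a \<Rightarrow> 'a) \<Rightarrow> 'a measure \<Rightarrow> 'a \<Rightarrow> bool" where
  "levy_process_with_triplet M X \<Sigma> \<nu> \<alpha> \<longleftrightarrow>
     levy_process M X \<and> covariance_operator \<Sigma> \<and> levy_measure \<nu> \<and>
     (\<forall>u. fourier_measure (distr M borel (X 1)) u = levy_khintchine \<Sigma> \<nu> \<alpha> u)"

text \<open>
  The tail integrals are only evaluated away from the origin, where a Levy measure is finite.
\<close>

definition tail_integral :: "(real \<times> real) measure \<Rightarrow> real \<Rightarrow> real \<Rightarrow> real" where
  "tail_integral \<nu> x y = measure \<nu> ({x..} \<times> {y..})"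

definition tail_integral1 :: "(real \<times> real) measure \<Rightarrow> real \<Rightarrow> real" where
  "tail_integral1 \<nu> x = measure \<nu> ({x..} \<times> {0..})"

definition tail_integral2 :: "(real \<times> real) measure \<Rightarrow> real \<Rightarrow> real" where
  "tail_integral2 \<nu> y = measure \<nu> ({0..} \<times> {y..})"

definition levy_copula :: "(real \<times> real) measure \<Rightarrow> real \<Rightarrow> real \<Rightarrow> real" where
  "levy_copula \<nu> u v =
     tail_integral \<nu> (inv_into {0<..} (tail_integral1 \<nu>) u) (inv_into {0<..} (tail_integral2 \<nu>) v)"

definition fourier :: "('a::euclidean_space \<Rightarrow> complex) \<Rightarrow> 'a \<Rightarrow> complex" where
  "fourier f u = (\<integral>x. iexp (u \<bullet> x) * f x \<partial>lborel)"

definition inv_fourier :: "(real \<times> real \<Rightarrow> complex) \<Rightarrow> real \<times> real \<Rightarrow> complex" where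
  "inv_fourier f x =
     complex_of_real (1 / (2 * pi)\<^sup>2) * (\<integral>u. iexp (- (u \<bullet> x)) * f u \<partial>lborel)"

definition scaled_kernel ::
    "(real \<times> real \<Rightarrow> real) \<Rightarrow> real \<Rightarrow> real \<times> real \<Rightarrow> real" where
  "scaled_kernel K h x = K ((1 / h) *\<^sub>R x) / h\<^sup>2"

text \<open>The observations are \<open>x 1, \<dots>, x n\<close>; by convention the process starts in \<open>0\<close>.\<close>

definition increment :: "(nat \<Rightarrow> 'a::euclidean_space) \<Rightarrow> nat \<Rightarrow> 'a" where
  "increment x t = x t - (if t = 1 then 0 else x (t - 1))"

definition ecf :: "nat \<Rightarrow> (nat \<Rightarrow> 'a::euclidean_space) \<Rightarrow> 'a \<Rightarrow> complex" where
  "ecf n x u = (\<Sum>t=1..n. iexp (u \<bullet> increment x t)) / of_nat n"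

definition partial_deriv ::
    "'a::euclidean_space \<Rightarrow> ('a \<Rightarrow> complex) \<Rightarrow> 'a \<Rightarrow> complex" where
  "partial_deriv e f u = vector_derivative (\<lambda>s. f (u + s *\<^sub>R e)) (at 0)"

text \<open>The fourth partial derivative of the logarithm of \<open>f\<close>, where \<open>f\<close> does not vanish.\<close>

definition log_deriv4 ::
    "'a::euclidean_space \<Rightarrow> ('a \<Rightarrow> complex) \<Rightarrow> 'a \<Rightarrow> complex" where
  "log_deriv4 e f u =
     (let d = (\<lambda>j. (partial_deriv e ^^ j) f u) in
        d 4 / f u
        - 4 * (d 1 * d 3 / (f u)\<^sup>2)
        - 3 * (d 2 / f u)\<^sup>2
        + 12 * ((d 1)\<^sup>2 * d 2 / (f u) ^ 3)
        - 6 * (d 1 / f u) ^ 4)"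

definition freq_square :: "real \<Rightarrow> (real \<times> real) set" where
  "freq_square h = {- (1 / h) .. 1 / h} \<times> {- (1 / h) .. 1 / h}"

definition quartic_weight :: "real \<times> real \<Rightarrow> real" where
  "quartic_weight x = fst x ^ 4 + snd x ^ 4"

text \<open>Here \<open>\<phi>\<close> is the true characteristic function.\<close>

definition N_hat ::
    "(real \<times> real \<Rightarrow> real) \<Rightarrow> (real \<times> real \<Rightarrow> complex) \<Rightarrow> real \<Rightarrow> nat \<Rightarrow>
     (nat \<Rightarrow> real \<times> real) \<Rightarrow> real \<Rightarrow> real \<Rightarrow> complex" where
  "N_hat K \<phi> h n x a b =
     (if \<forall>u\<in>freq_square h. cmod (ecf n x u) > cmod (\<phi> u) / 2
      then \<integral>y. complex_of_real (indicator ({a..} \<times> {b..}) y / quartic_weight y) *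
             inv_fourier
               (\<lambda>u. indicator (freq_square h) u *
                    ((log_deriv4 (1, 0) (ecf n x) u + log_deriv4 (0, 1) (ecf n x) u) *
                     fourier (\<lambda>z. complex_of_real (scaled_kernel K h z)) u)) y \<partial>lborel
      else 0)"

text \<open>
  The intended \<open>g\<close> are nonnegative, continuous and vanish at infinity; then both infima are
  taken over nonempty sets that are bounded below.
\<close>

definition inversion :: "(real \<Rightarrow> real) \<Rightarrow> real \<Rightarrow> real \<Rightarrow> real" where
  "inversion g \<delta> z = Inf {x. x \<ge> \<delta> \<and> (INF y\<in>{\<delta>..x}. g y) \<le> z}"

definition bandwidth :: "nat \<Rightarrow> real" where
  "bandwidth n = ln (ln (real n)) / sqrt (ln (real n))"

definition cutoff :: "nat \<Rightarrow> real" where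
  "cutoff n = 1 / ln (ln (real n))"

definition copula_estimator ::
    "(real \<times> real \<Rightarrow> real) \<Rightarrow> (real \<times> real \<Rightarrow> complex) \<Rightarrow> nat \<Rightarrow>
     (nat \<Rightarrow> real \<times> real) \<Rightarrow> real \<Rightarrow> real \<Rightarrow> complex" where
  "copula_estimator K \<phi> n x u v =
     (let N = N_hat K \<phi> (bandwidth n) n x in
        N (inversion (\<lambda>s. max (Re (N s 0)) 0) (cutoff n) u)
          (inversion (\<lambda>s. max (Re (N 0 s)) 0) (cutoff n) v))"

text \<open>
  \<open>Y n = O\<^sub>P (r n)\<close> for a sequence indexed by \<open>n \<ge> n\<^sub>0\<close>. Values in \<open>ereal\<close> accommodate suprema.
  Measurability of the event is demanded because \<open>measure\<close> is 0 on nonmeasurable sets.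
\<close>

definition big_O_prob ::
    "nat \<Rightarrow> 'w measure \<Rightarrow> (nat \<Rightarrow> 'w \<Rightarrow> ereal) \<Rightarrow> (nat \<Rightarrow> real) \<Rightarrow> bool" where
  "big_O_prob n\<^sub>0 M Y r \<longleftrightarrow>
     (\<forall>\<delta>>0. \<exists>C>0. \<forall>n\<ge>n\<^sub>0.
        {\<omega> \<in> space M. \<bar>Y n \<omega> / ereal (r n)\<bar> \<ge> ereal C} \<in> sets M \<and>
        measure M {\<omega> \<in> space M. \<bar>Y n \<omega> / ereal (r n)\<bar> \<ge> ereal C} \<le> \<delta>)"

end

theory Submission
  imports Defs "HOL-Computational_Algebra.Polynomial" "HOL-Real_Asymp.Real_Asymp"
begin

text \<open>
  Write \<open>\<mu> = (x\<^sub>1\<^sup>4 + x\<^sub>2\<^sup>4) \<nu>\<close> and \<open>g = 1\<^sub>Q / (x\<^sub>1\<^sup>4 + x\<^sub>2\<^sup>4)\<close> for an orthant \<open>Q\<close> at distance at least \<open>\<delta>\<close>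
  from the origin, so that \<open>\<nu>(Q) = \<integral> g d\<mu>\<close>. The estimator of \<open>\<nu>(Q)\<close> has a bias and a
  stochastic error.

  The bias is \<open>\<integral> g d(\<mu> * K\<^sub>h) - \<integral> g d\<mu>\<close>. Apart from a Lipschitz part of \<open>g\<close> it is governed by
  the \<open>\<mu>\<close>-mass of strips along the two edges of \<open>Q\<close>; the decay of the Fourier transform of \<open>\<mu>\<close>
  on the coordinate axes makes a strip of width \<open>t\<close> have mass \<open>O(t log (1/t))\<close>. Lipschitz
  continuity of the Fourier transform of \<open>K\<close> gives tails of order \<open>1/R\<close> for \<open>K\<close>, and together
  these bound the bias by \<open>\<delta>\<^sup>-\<^sup>5 h (log (1/h))\<^sup>2\<close>.

  For the stochastic error crude estimates suffice: the true characteristic function is at least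
  \<open>exp (- c / h\<^sup>2) = n\<^sup>-\<^sup>o\<^sup>(\<^sup>1\<^sup>)\<close> on the frequency square, so any polynomial rate for the uniform
  deviation of the empirical characteristic function and its first four derivatives is enough;
  a grid argument with second moments gives one.

  Finally, if the tail integrals are uniformly within \<open>\<epsilon>\<close> of their estimators, then the estimated
  generalised inverses satisfy \<open>|U\<^sub>k(x) - u| \<le> \<epsilon>\<close>, and the copula error is at most \<open>3 \<epsilon>\<close> because
  \<open>U\<close> is 1-Lipschitz in its margins.
\<close>

section \<open>Integration preliminaries\<close>

text \<open>The moment and decay hypotheses concern \<open>\<nu>\<close>, while the observations
  only reveal the law of \<open>X 1\<close>. Controlling fourth derivatives of the empirical
  characteristic function by second moments takes eight moments of that law; they are recovered from
  the characteristic function near 0, which inherits an expansion of order eight from the Levy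
  exponent. The orders fit together as follows. The factor \<open>ln (ln n)\<close> in the bandwidth
  makes \<open>exp (c / h^2)\<close> smaller than any power of \<open>n\<close>, so a deviation of
  order \<open>n powr (- 1 / 16)\<close> survives division by five factors of the characteristic
  function. The bias collects one factor \<open>ln (ln n)\<close> from \<open>h\<close>, five from
  \<open>\<delta>^-5\<close> and two from the logarithms; the ninth factor in the rate makes it
  negligible. \<open>big_O_prob\<close> also demands measurability of a supremum over a continuum.
  It becomes a countable supremum because the estimated inverses are right-continuous and the tail
  estimator is continuous in its corner away from the origin.\<close>

lemma prod_integral_mult:
  fixes f :: "'a \<Rightarrow> 'c::{real_normed_field,banach,second_countable_topology}" and g :: "'b \<Rightarrow> 'c"
  assumes "sigma_finite_measure A" "sigma_finite_measure B"
    and f[measurable]: "integrable A f" and g[measurable]: "integrable B g"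
  shows "integrable (A \<Otimes>\<^sub>M B) (\<lambda>p. f (fst p) * g (snd p))"
    and "(\<integral>p. f (fst p) * g (snd p) \<partial>(A \<Otimes>\<^sub>M B)) = integral\<^sup>L A f * integral\<^sup>L B g"
proof -
  interpret A: sigma_finite_measure A by fact
  interpret B: sigma_finite_measure B by fact
  interpret pair_sigma_finite A B ..
  show I: "integrable (A \<Otimes>\<^sub>M B) (\<lambda>p. f (fst p) * g (snd p))"
  proof (rule Fubini_integrable)
    show "(\<lambda>p. f (fst p) * g (snd p)) \<in> borel_measurable (A \<Otimes>\<^sub>M B)" by measurable
    show "integrable A (\<lambda>x. \<integral>y. norm (f (fst (x, y)) * g (snd (x, y))) \<partial>B)"
      using f g by (simp add: norm_mult)
    show "AE x in A. integrable B (\<lambda>y. f (fst (x, y)) * g (snd (x, y)))"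
      using g by simp
  qed
  show "(\<integral>p. f (fst p) * g (snd p) \<partial>(A \<Otimes>\<^sub>M B)) = integral\<^sup>L A f * integral\<^sup>L B g"
    using integral_fst'[OF I] by (simp add: mult.commute)
qed

lemma lborel_pair_integral_mult:
  fixes f g :: "real \<Rightarrow> 'c::{real_normed_field,banach,second_countable_topology}"
  assumes "integrable lborel f" "integrable lborel g"
  shows "integrable lborel (\<lambda>p::real\<times>real. f (fst p) * g (snd p))"
    and "(\<integral>p. f (fst p) * g (snd p) \<partial>(lborel::(real\<times>real) measure)) = integral\<^sup>L lborel f * integral\<^sup>L lborel g"
  using prod_integral_mult[OF _ _ assms] lborel.sigma_finite_measure_axioms
  by (auto simp: lborel_prod)

text \<open>Integrability is asked of the majorant only: the integral of a non-integrable function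
  is 0 by convention, and the majorant is nonnegative almost everywhere.\<close>

lemma norm_integral_le:
  fixes f :: "'a \<Rightarrow> 'b::{banach,second_countable_topology}"
  assumes g: "integrable M g" and le: "AE x in M. norm (f x) \<le> g x"
  shows "norm (integral\<^sup>L M f) \<le> integral\<^sup>L M g"
proof (cases "integrable M f")
  case True
  have "norm (integral\<^sup>L M f) \<le> (\<integral>x. norm (f x) \<partial>M)" by (rule integral_norm_bound)
  also have "\<dots> \<le> integral\<^sup>L M g" using True g le by (intro integral_mono_AE) auto
  finally show ?thesis .
next
  case False
  have "AE x in M. 0 \<le> g x" using le by eventually_elim (metis norm_ge_zero order_trans)
  then have "0 \<le> integral\<^sup>L M g" by (rule integral_nonneg_AE)
  then show ?thesis using False by (simp add: not_integrable_integral_eq)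
qed

lemma lborel_integral_affine:
  fixes f :: "'a::euclidean_space \<Rightarrow> 'b::{banach,second_countable_topology}"
  assumes c: "c \<noteq> 0" and [measurable]: "f \<in> borel_measurable borel"
  shows "(\<integral>x. f x \<partial>lborel) = \<bar>c\<bar> ^ DIM('a) *\<^sub>R (\<integral>x. f (t + c *\<^sub>R x) \<partial>lborel)"
    and "integrable lborel f \<longleftrightarrow> integrable lborel (\<lambda>x. f (t + c *\<^sub>R x))"
proof -
  have e: "(lborel::'a measure) = density (distr lborel borel (\<lambda>x. t + c *\<^sub>R x)) (\<lambda>_. ennreal (\<bar>c\<bar> ^ DIM('a)))"
    using lborel_affine[OF c, of t] by simp
  show "(\<integral>x. f x \<partial>lborel) = \<bar>c\<bar> ^ DIM('a) *\<^sub>R (\<integral>x. f (t + c *\<^sub>R x) \<partial>lborel)"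
    by (subst e) (simp add: integral_density integral_distr)
  show "integrable lborel f \<longleftrightarrow> integrable lborel (\<lambda>x. f (t + c *\<^sub>R x))"
  proof -
    have "integrable lborel f \<longleftrightarrow> integrable lborel (\<lambda>x. \<bar>c\<bar> ^ DIM('a) *\<^sub>R f (t + c *\<^sub>R x))"
      by (subst e) (simp add: integrable_density integrable_distr_eq)
    also have "\<dots> \<longleftrightarrow> integrable lborel (\<lambda>x. f (t + c *\<^sub>R x))" (is "?L \<longleftrightarrow> ?R")
    proof
      assume ?L
      then have "integrable lborel (\<lambda>x. inverse (\<bar>c\<bar> ^ DIM('a)) *\<^sub>R \<bar>c\<bar> ^ DIM('a) *\<^sub>R f (t + c *\<^sub>R x))"
        by (rule integrable_scaleR_right)
      then show ?R using c by simp
    qed simp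
    finally show ?thesis .
  qed
qed

abbreviation (input) orthant :: "real \<Rightarrow> real \<Rightarrow> (real \<times> real) set" where
  "orthant a b \<equiv> {a..} \<times> {b..}"

definition orthant_weight :: "real \<Rightarrow> real \<Rightarrow> real \<times> real \<Rightarrow> real" where
  "orthant_weight a b y = indicator (orthant a b) y / quartic_weight y"

lemma fst_borel_measurable [measurable]:
    "(fst :: 'a::second_countable_topology \<times> 'b::second_countable_topology \<Rightarrow> 'a) \<in> borel_measurable borel"
  and snd_borel_measurable [measurable]:
    "(snd :: 'a \<times> 'b \<Rightarrow> 'b) \<in> borel_measurable borel"
  by (auto intro!: borel_measurable_continuous_onI continuous_intros)

lemma orthant_measurable [measurable]: "orthant a b \<in> sets borel"
  by (intro borel_closed closed_Times) auto

lemma quartic_weight_measurable [measurable]: "quartic_weight \<in> borel_measurable borel"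
  unfolding quartic_weight_def by measurable

lemma orthant_weight_measurable [measurable]: "orthant_weight a b \<in> borel_measurable borel"
  unfolding orthant_weight_def by measurable

lemma quartic_weight_nonneg: "0 \<le> quartic_weight x"
  by (simp add: quartic_weight_def)

lemma orthant_weight_nonneg: "0 \<le> orthant_weight a b y"
  by (simp add: orthant_weight_def quartic_weight_nonneg)

text \<open>The distance condition is put on \<open>max a b\<close>, so that orthants with a corner
  on an axis are covered; the marginal tail integrals are of this kind.\<close>

lemma quartic_weight_ge:
  assumes "y \<in> orthant a b" "0 \<le> a" "0 \<le> b" "0 < \<delta>" "\<delta> \<le> max a b"
  shows "\<delta> ^ 4 \<le> quartic_weight y"
proof -
  have "\<delta> \<le> fst y \<or> \<delta> \<le> snd y" using assms by (cases y) auto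
  then have "\<delta> ^ 4 \<le> fst y ^ 4 \<or> \<delta> ^ 4 \<le> snd y ^ 4"
    using assms(4) by (auto intro: power_mono)
  then show ?thesis by (auto simp: quartic_weight_def intro: add_increasing add_increasing2)
qed

lemma orthant_weight_le:
  assumes "0 \<le> a" "0 \<le> b" "0 < \<delta>" "\<delta> \<le> max a b"
  shows "orthant_weight a b y \<le> 1 / \<delta> ^ 4"
proof (cases "y \<in> orthant a b")
  case True
  then show ?thesis
    using quartic_weight_ge[OF True assms] assms by (simp add: orthant_weight_def frac_le)
qed (use assms in \<open>simp add: orthant_weight_def\<close>)

text \<open>Integrable majorant for the reciprocal quartic weight. The product form reduces its
  integral to two arctangent integrals, with total \<open>pi^2\<close>.\<close>

definition cauchy_weight :: "real \<times> real \<Rightarrow> real" where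
  "cauchy_weight y = inverse (1 + fst y ^ 2) * inverse (1 + snd y ^ 2)"

lemma cauchy_weight_nonneg [simp]: "0 \<le> cauchy_weight y"
  by (simp add: cauchy_weight_def)

text \<open>With \<open>r\<close> the squared Euclidean norm, \<open>r^2\<close> is at most twice
  the quartic weight, and \<open>r \<ge> \<delta>^2\<close> with \<open>\<delta> \<le> 1\<close>
  gives \<open>\<delta>^2 * (1 + r) \<le> 2 * r\<close>. Squaring this and using
  \<open>(1 + x^2) * (1 + y^2) \<le> (1 + r)^2\<close> produces the constant 8.\<close>

lemma orthant_weight_le_cauchy:
  assumes "0 \<le> a" "0 \<le> b" "0 < \<delta>" "\<delta> \<le> 1" "\<delta> \<le> max a b"
  shows "orthant_weight a b y \<le> 8 / \<delta> ^ 4 * cauchy_weight y"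
proof (cases "y \<in> orthant a b")
  case True
  define r where "r = fst y ^ 2 + snd y ^ 2"
  have d1: "\<delta>\<^sup>2 \<le> 1" using assms by (simp add: power_le_one)
  have "\<delta> \<le> fst y \<or> \<delta> \<le> snd y" using assms True by (cases y) auto
  then have "\<delta>\<^sup>2 \<le> (fst y)\<^sup>2 \<or> \<delta>\<^sup>2 \<le> (snd y)\<^sup>2" using assms(3) by (auto intro: power_mono)
  then have dr: "\<delta>\<^sup>2 \<le> r" by (auto simp: r_def intro: add_increasing add_increasing2)
  have w: "r\<^sup>2 \<le> 2 * quartic_weight y"
  proof -
    have "0 \<le> ((fst y)\<^sup>2 - (snd y)\<^sup>2)\<^sup>2" by simp
    then show ?thesis
      by (simp add: r_def quartic_weight_def power2_eq_square algebra_simps eval_nat_numeral)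
  qed
  have r0: "0 \<le> r" by (simp add: r_def)
  have "\<delta>\<^sup>2 * (1 + r) \<le> 2 * r"
  proof -
    have "\<delta>\<^sup>2 * r \<le> 1 * r" using d1 r0 by (intro mult_right_mono) auto
    then show ?thesis using dr by (simp add: algebra_simps)
  qed
  then have "(\<delta>\<^sup>2 * (1 + r))\<^sup>2 \<le> (2 * r)\<^sup>2" using r0 by (intro power_mono) auto
  also have "\<dots> \<le> 8 * quartic_weight y" using w by (simp add: power_mult_distrib)
  finally have A: "\<delta> ^ 4 * (1 + r)\<^sup>2 \<le> 8 * quartic_weight y"
    by (simp add: power_mult_distrib flip: power_mult)
  have "(1 + fst y ^ 2) * (1 + snd y ^ 2) \<le> (1 + r) * (1 + r)"
    by (intro mult_mono) (auto simp: r_def)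
  then have B: "\<delta> ^ 4 * ((1 + fst y ^ 2) * (1 + snd y ^ 2)) \<le> 8 * quartic_weight y"
    using A assms by (smt (verit) mult_left_mono power2_eq_square zero_le_power)
  have P: "0 < (1 + fst y ^ 2) * (1 + snd y ^ 2)" by (intro mult_pos_pos) (auto simp: add_pos_nonneg)
  have Q: "0 < quartic_weight y"
    using quartic_weight_ge[OF True assms(1,2,3,5)] assms(3) by (smt (verit) zero_less_power)
  have "1 / quartic_weight y \<le> 8 / (\<delta> ^ 4 * ((1 + fst y ^ 2) * (1 + snd y ^ 2)))"
    using frac_le[of 8 8 _ "8 * quartic_weight y", OF _ _ _ B] mult_pos_pos[OF _ P, of "\<delta> ^ 4"] assms(3)
    by simp
  then show ?thesis using True by (simp add: orthant_weight_def cauchy_weight_def field_simps)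
next
  case False
  then show ?thesis using False assms by (simp add: orthant_weight_def)
qed

lemma cauchy_weight_integrable: "integrable lborel cauchy_weight"
  and cauchy_weight_integral: "integral\<^sup>L lborel cauchy_weight = pi\<^sup>2"
proof -
  have i: "integrable lborel (\<lambda>x::real. inverse (1 + x\<^sup>2))"
    using integrable_inverse_1_plus_square by (simp add: set_integrable_def)
  have v: "integral\<^sup>L lborel (\<lambda>x::real. inverse (1 + x\<^sup>2)) = pi"
    using LBINT_inverse_1_plus_square
    by (simp add: interval_lebesgue_integral_def set_lebesgue_integral_def)
  show "integrable lborel cauchy_weight"
    using lborel_pair_integral_mult(1)[OF i i] by (simp add: cauchy_weight_def[abs_def])
  show "integral\<^sup>L lborel cauchy_weight = pi\<^sup>2"
    using lborel_pair_integral_mult(2)[OF i i] v by (simp add: cauchy_weight_def[abs_def] power2_eq_square)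
qed

lemma orthant_weight_integrable:
  assumes "0 \<le> a" "0 \<le> b" "0 < \<delta>" "\<delta> \<le> 1" "\<delta> \<le> max a b"
  shows "integrable lborel (orthant_weight a b)"
    and "integral\<^sup>L lborel (orthant_weight a b) \<le> 8 * pi\<^sup>2 / \<delta> ^ 4"
proof -
  have i: "integrable lborel (\<lambda>y. 8 / \<delta> ^ 4 * cauchy_weight y)"
    using cauchy_weight_integrable by simp
  show I: "integrable lborel (orthant_weight a b)"
  proof (rule Bochner_Integration.integrable_bound[OF i _ AE_I2])
    show "norm (orthant_weight a b x) \<le> norm (8 / \<delta> ^ 4 * cauchy_weight x)" for x
      using orthant_weight_le_cauchy[OF assms, of x] orthant_weight_nonneg[of a b x] by auto
  qed simp
  have "integral\<^sup>L lborel (orthant_weight a b) \<le> integral\<^sup>L lborel (\<lambda>y. 8 / \<delta> ^ 4 * cauchy_weight y)"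
    by (rule integral_mono[OF I i orthant_weight_le_cauchy[OF assms]])
  also have "\<dots> = 8 * pi\<^sup>2 / \<delta> ^ 4" by (simp add: cauchy_weight_integral)
  finally show "integral\<^sup>L lborel (orthant_weight a b) \<le> 8 * pi\<^sup>2 / \<delta> ^ 4" .
qed

section \<open>The inversion operation\<close>

text \<open>The estimated inverse is squeezed between the points where \<open>V\<close> equals
  \<open>u + \<epsilon>\<close> and \<open>u - \<epsilon>\<close>. These exist by surjectivity and
  \<open>\<epsilon> < u\<close>, and the condition on \<open>V \<delta>\<close> places both to the
  right of the cutoff. No regularity of \<open>g\<close> enters.\<close>

lemma inversion_close:
  fixes V g :: "real \<Rightarrow> real"
  assumes V_anti: "\<And>x y. 0 < x \<Longrightarrow> x \<le> y \<Longrightarrow> V y \<le> V x"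
    and V_bij: "bij_betw V {0<..} {0<..}"
    and g_nonneg: "\<And>x. 0 \<le> g x"
    and close: "\<And>x. \<delta> \<le> x \<Longrightarrow> \<bar>g x - V x\<bar> \<le> \<epsilon>"
    and "0 < \<delta>" "\<epsilon> < u" "u + \<epsilon> < V \<delta>"
  shows "\<delta> \<le> inversion g \<delta> u" and "\<bar>V (inversion g \<delta> u) - u\<bar> \<le> \<epsilon>"
proof -
  define S where "S = {x. x \<ge> \<delta> \<and> (INF y\<in>{\<delta>..x}. g y) \<le> u}"
  have e0: "0 \<le> \<epsilon>" using close[of \<delta>] by simp
  have img: "V ` {0<..} = {0<..}" and inj: "inj_on V {0<..}"
    using V_bij by (auto simp: bij_betw_def)
  have "u - \<epsilon> \<in> V ` {0<..}" "u + \<epsilon> \<in> V ` {0<..}" using img assms(6) e0 by auto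
  then obtain xm xp where xm: "0 < xm" "V xm = u - \<epsilon>" and xp: "0 < xp" "V xp = u + \<epsilon>"
    by (metis greaterThan_iff imageE)
  have dxp: "\<delta> \<le> xp"
    using V_anti[of xp \<delta>] xp assms(7) by (cases "\<delta> \<le> xp") auto
  have dxm: "\<delta> \<le> xm"
    using V_anti[of xm \<delta>] xm assms(7) e0 by (cases "\<delta> \<le> xm") auto
  have bdd: "bdd_below (g ` A)" for A by (intro bdd_belowI[of _ 0]) (auto simp: g_nonneg)
  have xmS: "xm \<in> S"
  proof -
    have "(INF y\<in>{\<delta>..xm}. g y) \<le> g xm" using dxm by (intro cINF_lower bdd) auto
    also have "\<dots> \<le> u" using close[OF dxm] xm by (auto simp: abs_le_iff)
    finally show ?thesis using dxm by (simp add: S_def)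
  qed
  \<comment> \<open>As \<open>V\<close> decreases, the running infimum up to \<open>x\<close> is at
    least \<open>V x - \<epsilon>\<close>, so membership in \<open>S\<close> forces
    \<open>V x \<le> u + \<epsilon> = V xp\<close>. Injectivity supplies the strictness that the
    weak monotonicity of \<open>V\<close> does not give.\<close>
  have low: "xp \<le> x" if x: "x \<in> S" for x
  proof (rule ccontr)
    assume "\<not> xp \<le> x"
    then have "x < xp" by simp
    have x1: "\<delta> \<le> x" "(INF y\<in>{\<delta>..x}. g y) \<le> u" using x by (auto simp: S_def)
    have "V x - \<epsilon> \<le> (INF y\<in>{\<delta>..x}. g y)"
    proof (rule cINF_greatest)
      show "{\<delta>..x} \<noteq> {}" using x1 by auto
      fix y assume y: "y \<in> {\<delta>..x}"
      then have "V x \<le> V y" using V_anti[of y x] \<open>0 < \<delta>\<close> by auto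
      then show "V x - \<epsilon> \<le> g y" using close[of y] y by (auto simp: abs_le_iff)
    qed
    then have "V x \<le> V xp" using x1 xp by simp
    moreover have "V xp \<le> V x" using V_anti[of x xp] x1 \<open>x < xp\<close> \<open>0 < \<delta>\<close> by auto
    ultimately have "V x = V xp" by simp
    then have "x = xp" using inj xp x1 \<open>0 < \<delta>\<close> by (auto simp: inj_on_def)
    with \<open>x < xp\<close> show False by simp
  qed
  have I: "inversion g \<delta> u = Inf S" by (simp add: inversion_def S_def)
  have "xp \<le> Inf S" using xmS low by (intro cInf_greatest) auto
  moreover have "Inf S \<le> xm" using xmS by (intro cInf_lower bdd_belowI[of _ xp]) (auto intro: low)
  ultimately have b: "xp \<le> inversion g \<delta> u" "inversion g \<delta> u \<le> xm" by (auto simp: I)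
  show "\<delta> \<le> inversion g \<delta> u" using b dxp by simp
  show "\<bar>V (inversion g \<delta> u) - u\<bar> \<le> \<epsilon>"
    using V_anti[OF xp(1) b(1)] V_anti[OF _ b(2)] b xp xm by (auto simp: abs_le_iff)
qed

text \<open>Decay at infinity makes the set in \<open>inversion\<close> nonempty and nonnegativity
  bounds the inner infima from below; continuity is added only for measurability. No assumption
  mentions \<open>\<delta>\<close>, so the locale predicate has \<open>g\<close> as its only
  argument.\<close>

locale vanishing =
  fixes g :: "real \<Rightarrow> real" and \<delta> :: real
  assumes g_nonneg: "\<And>x. 0 \<le> g x" and g_vanish: "(g \<longlongrightarrow> 0) at_top"
begin

lemma bdd_below_g: "bdd_below (g ` A)"
  by (intro bdd_belowI[of _ 0]) (auto simp: g_nonneg)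

lemma inversion_set_nonempty:
  assumes "0 < z"
  shows "\<exists>x\<ge>\<delta>. (INF y\<in>{\<delta>..x}. g y) \<le> z"
proof -
  have "\<forall>\<^sub>F x in at_top. g x < z" using g_vanish assms by (rule order_tendstoD)
  moreover have "\<forall>\<^sub>F x in at_top. \<delta> \<le> x" by (rule eventually_ge_at_top)
  ultimately have "\<forall>\<^sub>F x in at_top. g x < z \<and> \<delta> \<le> x" by eventually_elim simp
  then obtain x where "g x < z" "\<delta> \<le> x" unfolding eventually_at_top_linorder by blast
  then show ?thesis
    by (intro exI[of _ x]) (auto intro!: cINF_lower2[where x=x] bdd_below_g)
qed

lemma inversion_ge: "0 < z \<Longrightarrow> \<delta> \<le> inversion g \<delta> z"
  unfolding inversion_def using inversion_set_nonempty[of z] by (intro cInf_greatest) auto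

lemma inversion_less_iff:
  assumes "0 < z"
  shows "inversion g \<delta> z < c \<longleftrightarrow> (\<exists>x. \<delta> \<le> x \<and> x < c \<and> (INF y\<in>{\<delta>..x}. g y) \<le> z)"
  unfolding inversion_def using inversion_set_nonempty[OF assms]
  by (subst cInf_less_iff) (auto intro!: bdd_belowI[of _ \<delta>])

lemma running_inf_antimono:
  "\<delta> \<le> x \<Longrightarrow> x \<le> y \<Longrightarrow> (INF t\<in>{\<delta>..y}. g t) \<le> (INF t\<in>{\<delta>..x}. g t)"
  by (intro cINF_superset_mono bdd_below_g) auto

lemma inversion_antimono:
  assumes "0 < z" "z \<le> z'"
  shows "inversion g \<delta> z' \<le> inversion g \<delta> z"
  unfolding inversion_def using inversion_set_nonempty[OF assms(1)] assms
  by (intro cInf_superset_mono) (auto intro!: bdd_belowI[of _ \<delta>])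

text \<open>Monotonicity handles upper bounds. For a lower bound, the running infimum at some point
  strictly left of the inverse exceeds \<open>z\<close>, hence still exceeds \<open>s m\<close> for
  all large \<open>m\<close>.\<close>

lemma inversion_right_continuous:
  assumes z: "0 < z" and zm: "\<And>m. z \<le> s m" "s \<longlonglongrightarrow> z"
  shows "(\<lambda>m. inversion g \<delta> (s m)) \<longlonglongrightarrow> inversion g \<delta> z"
proof (rule order_tendstoI)
  fix c assume "inversion g \<delta> z < c"
  then show "\<forall>\<^sub>F m in sequentially. inversion g \<delta> (s m) < c"
    using inversion_antimono[OF z zm(1)] by (intro always_eventually) (auto intro: le_less_trans)
next
  fix c assume c: "c < inversion g \<delta> z"
  show "\<forall>\<^sub>F m in sequentially. c < inversion g \<delta> (s m)"
  proof (cases "c < \<delta>")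
    case True
    then show ?thesis
      using inversion_ge[of "s m" for m] less_le_trans[OF z zm(1)]
      by (intro always_eventually) (auto intro: less_le_trans)
  next
    case False
    define y where "y = (c + inversion g \<delta> z) / 2"
    have y: "c < y" "y < inversion g \<delta> z" "\<delta> \<le> y" using c False by (auto simp: y_def)
    have "z < (INF t\<in>{\<delta>..y}. g t)"
      using inversion_less_iff[OF z, of "inversion g \<delta> z"] y by (meson less_irrefl not_le)
    then have "\<forall>\<^sub>F m in sequentially. s m < (INF t\<in>{\<delta>..y}. g t)"
      by (rule order_tendstoD(2)[OF zm(2)])
    then show ?thesis
    proof eventually_elim
      case (elim m)
      have sm: "0 < s m" using zm(1)[of m] z by simp
      have "\<not> inversion g \<delta> (s m) < y"
      proof
        assume "inversion g \<delta> (s m) < y"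
        then obtain x where "\<delta> \<le> x" "x < y" "(INF t\<in>{\<delta>..x}. g t) \<le> s m"
          using inversion_less_iff[OF sm] by blast
        then show False using running_inf_antimono[of x y] elim by simp
      qed
      then show ?case using y by simp
    qed
  qed
qed

end

text \<open>A countable dense subset suffices for weak inequalities by continuity. For the strict
  one the minimum is attained on the compact set, which leaves a gap of some
  \<open>1 / (m + 1)\<close>; hence the countable union over \<open>m\<close>.\<close>

lemma measurable_Ball_compact_gr:
  fixes f :: "'w \<Rightarrow> 'a::euclidean_space \<Rightarrow> real"
  assumes K: "compact K"
    and cont: "\<And>\<omega>. \<omega> \<in> space M \<Longrightarrow> continuous_on K (f \<omega>)"
    and meas: "\<And>x. x \<in> K \<Longrightarrow> (\<lambda>\<omega>. f \<omega> x) \<in> borel_measurable M"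
  shows "{\<omega> \<in> space M. \<forall>x\<in>K. f \<omega> x > c} \<in> sets M"
proof -
  obtain D where D: "countable D" "D \<subseteq> K" "K \<subseteq> closure D"
    using separable[of K] by blast
  have eq: "{\<omega> \<in> space M. \<forall>x\<in>K. f \<omega> x > c} =
      (\<Union>m::nat. {\<omega> \<in> space M. \<forall>x\<in>D. f \<omega> x \<ge> c + 1 / real (Suc m)})"
  proof (intro set_eqI iffI)
    fix \<omega> assume w: "\<omega> \<in> {\<omega> \<in> space M. \<forall>x\<in>K. f \<omega> x > c}"
    show "\<omega> \<in> (\<Union>m::nat. {\<omega> \<in> space M. \<forall>x\<in>D. f \<omega> x \<ge> c + 1 / real (Suc m)})"
    proof (cases "K = {}")
      case True then show ?thesis using w D by auto
    next
      case False
      obtain x0 where x0: "x0 \<in> K" "\<And>x. x \<in> K \<Longrightarrow> f \<omega> x0 \<le> f \<omega> x"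
        using continuous_attains_inf[OF K False cont[of \<omega>]] w by auto
      obtain m where "inverse (real (Suc m)) < f \<omega> x0 - c"
        using reals_Archimedean[of "f \<omega> x0 - c"] w x0 by auto
      then have "c + 1 / real (Suc m) \<le> f \<omega> x" if "x \<in> D" for x
        using x0(2)[of x] that D by (auto simp: inverse_eq_divide)
      then show ?thesis using w by auto
    qed
  next
    fix \<omega> assume "\<omega> \<in> (\<Union>m::nat. {\<omega> \<in> space M. \<forall>x\<in>D. f \<omega> x \<ge> c + 1 / real (Suc m)})"
    then obtain m where w: "\<omega> \<in> space M" "\<And>x. x \<in> D \<Longrightarrow> f \<omega> x \<ge> c + 1 / real (Suc m)" by auto
    have "f \<omega> x > c" if x: "x \<in> K" for x
    proof -
      obtain s where s: "\<And>n. s n \<in> D" "s \<longlonglongrightarrow> x" using x D closure_sequential by blast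
      have "(\<lambda>n. f \<omega> (s n)) \<longlonglongrightarrow> f \<omega> x"
        using continuous_on_tendsto_compose[OF cont[OF w(1)] s(2) x] s D by (auto simp: subset_iff)
      then have "c + 1 / real (Suc m) \<le> f \<omega> x"
        by (rule LIMSEQ_le_const) (use w s in auto)
      moreover have "0 < 1 / real (Suc m)" by simp
      ultimately show ?thesis by linarith
    qed
    then show "\<omega> \<in> {\<omega> \<in> space M. \<forall>x\<in>K. f \<omega> x > c}" using w by simp
  qed
  have "{\<omega> \<in> space M. \<forall>x\<in>D. f \<omega> x \<ge> c + 1 / real (Suc m)} \<in> sets M" for m
  proof (rule sets.sets_Collect_countable_All')
    show "countable D" by fact
    fix x assume "x \<in> D"
    then have [measurable]: "(\<lambda>\<omega>. f \<omega> x) \<in> borel_measurable M" using meas D by auto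
    show "{\<omega> \<in> space M. c + 1 / real (Suc m) \<le> f \<omega> x} \<in> sets M" by measurable
  qed
  then show ?thesis unfolding eq by auto
qed

text \<open>By monotonicity of the running infimum, the inverse lies below \<open>c\<close> iff the
  infimum up to some countably indexed point below \<open>c\<close> is at most \<open>z\<close>.
  Each such event is the complement of a uniform strict bound on a compact interval.\<close>

lemma measurable_inversion:
  fixes g :: "'w \<Rightarrow> real \<Rightarrow> real"
  assumes van: "\<And>\<omega>. \<omega> \<in> space M \<Longrightarrow> vanishing (g \<omega>)"
    and cont: "\<And>\<omega>. \<omega> \<in> space M \<Longrightarrow> continuous_on {\<delta>..} (g \<omega>)"
    and meas: "\<And>x. \<delta> \<le> x \<Longrightarrow> (\<lambda>\<omega>. g \<omega> x) \<in> borel_measurable M"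
    and z: "0 < z"
  shows "(\<lambda>\<omega>. inversion (g \<omega>) \<delta> z) \<in> borel_measurable M"
proof (subst borel_measurable_iff_less, intro allI)
  fix c
  \<comment> \<open>The infimum of a continuous function on a compact interval is a minimum, so a
    weak bound on it negates a strict pointwise bound.\<close>
  have eq1: "(INF y\<in>{\<delta>..x}. g \<omega> y) \<le> z \<longleftrightarrow> \<not> (\<forall>y\<in>{\<delta>..x}. g \<omega> y > z)"
    if w: "\<omega> \<in> space M" and x: "\<delta> \<le> x" for \<omega> x
  proof -
    interpret vanishing "g \<omega>" \<delta> by (rule van[OF w])
    have c: "continuous_on {\<delta>..x} (g \<omega>)" using cont[OF w] by (rule continuous_on_subset) auto
    obtain y0 where y0: "y0 \<in> {\<delta>..x}" "\<And>y. y \<in> {\<delta>..x} \<Longrightarrow> g \<omega> y0 \<le> g \<omega> y"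
      using continuous_attains_inf[OF _ _ c] x by auto
    have "(INF y\<in>{\<delta>..x}. g \<omega> y) = g \<omega> y0"
      using y0 by (intro cInf_eq_minimum) auto
    moreover have "g \<omega> y0 \<le> z \<longleftrightarrow> \<not> (\<forall>y\<in>{\<delta>..x}. g \<omega> y > z)"
      using y0(1) y0(2) by (meson not_le order_trans)
    ultimately show ?thesis by simp
  qed
  have "{\<omega> \<in> space M. inversion (g \<omega>) \<delta> z < c} =
     (\<Union>q\<in>{q \<in> \<rat> \<union> {\<delta>}. \<delta> \<le> q \<and> q < c}. {\<omega> \<in> space M. \<not> (\<forall>y\<in>{\<delta>..q}. g \<omega> y > z)})"
  proof (intro set_eqI iffI)
    fix \<omega> assume "\<omega> \<in> {\<omega> \<in> space M. inversion (g \<omega>) \<delta> z < c}"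
    then have w: "\<omega> \<in> space M" "inversion (g \<omega>) \<delta> z < c" by auto
    interpret vanishing "g \<omega>" \<delta> by (rule van[OF w(1)])
    obtain x where x: "\<delta> \<le> x" "x < c" "(INF y\<in>{\<delta>..x}. g \<omega> y) \<le> z"
      using inversion_less_iff[OF z] w by blast
    obtain q where q: "q \<in> \<rat>" "x < q" "q < c" using Rats_dense_in_real[OF x(2)] by blast
    have "(INF y\<in>{\<delta>..q}. g \<omega> y) \<le> z" using running_inf_antimono[of x q] x q by linarith
    then have "\<not> (\<forall>y\<in>{\<delta>..q}. g \<omega> y > z)" using eq1[of \<omega> q] w x q by simp
    then show "\<omega> \<in> (\<Union>q\<in>{q \<in> \<rat> \<union> {\<delta>}. \<delta> \<le> q \<and> q < c}. {\<omega> \<in> space M. \<not> (\<forall>y\<in>{\<delta>..q}. g \<omega> y > z)})"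
      using w x q by (intro UN_I[of q]) auto
  next
    fix \<omega> assume "\<omega> \<in> (\<Union>q\<in>{q \<in> \<rat> \<union> {\<delta>}. \<delta> \<le> q \<and> q < c}. {\<omega> \<in> space M. \<not> (\<forall>y\<in>{\<delta>..q}. g \<omega> y > z)})"
    then obtain q where q: "\<delta> \<le> q" "q < c" "\<omega> \<in> space M" "\<not> (\<forall>y\<in>{\<delta>..q}. g \<omega> y > z)" by blast
    interpret vanishing "g \<omega>" \<delta> by (rule van[OF q(3)])
    show "\<omega> \<in> {\<omega> \<in> space M. inversion (g \<omega>) \<delta> z < c}"
      using inversion_less_iff[OF z] eq1[of \<omega> q] q by blast
  qed
  also have "\<dots> \<in> sets M"
  proof (rule sets.countable_UN'')
    show "countable {q \<in> \<rat> \<union> {\<delta>}. \<delta> \<le> q \<and> q < c}"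
      by (rule countable_subset[of _ "\<rat> \<union> {\<delta>}"]) (auto simp: countable_rat)
    fix q assume "q \<in> {q \<in> \<rat> \<union> {\<delta>}. \<delta> \<le> q \<and> q < c}"
    then have q: "\<delta> \<le> q" by simp
    have "{\<omega> \<in> space M. \<forall>y\<in>{\<delta>..q}. g \<omega> y > z} \<in> sets M"
      by (rule measurable_Ball_compact_gr) (auto intro!: meas continuous_on_subset[OF cont])
    then show "{\<omega> \<in> space M. \<not> (\<forall>y\<in>{\<delta>..q}. g \<omega> y > z)} \<in> sets M"
      by (rule sets.sets_Collect_neg)
  qed
  finally show "{\<omega> \<in> space M. inversion (g \<omega>) \<delta> z < c} \<in> sets M" .
qed

section \<open>Integrals of the reciprocal quartic weight over orthants\<close>

definition orthant_integral :: "(real \<times> real \<Rightarrow> complex) \<Rightarrow> real \<Rightarrow> real \<Rightarrow> complex" where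
  "orthant_integral f a b = (\<integral>y. complex_of_real (orthant_weight a b y) * f y \<partial>lborel)"

lemma orthant_integral_norm_le:
  assumes "0 \<le> a" "0 \<le> b" "0 < \<delta>" "\<delta> \<le> 1" "\<delta> \<le> max a b" and B: "\<And>y. cmod (f y) \<le> B"
  shows "cmod (orthant_integral f a b) \<le> 8 * pi\<^sup>2 / \<delta> ^ 4 * B"
proof -
  have B0: "0 \<le> B" using order_trans[OF norm_ge_zero B] .
  have "cmod (orthant_integral f a b) \<le> (\<integral>y. orthant_weight a b y * B \<partial>lborel)"
    unfolding orthant_integral_def using orthant_weight_integrable(1)[OF assms(1-5)] B
    by (intro norm_integral_le) (auto simp: norm_mult orthant_weight_nonneg mult_left_mono)
  also have "\<dots> = integral\<^sup>L lborel (orthant_weight a b) * B" by simp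
  also have "\<dots> \<le> 8 * pi\<^sup>2 / \<delta> ^ 4 * B"
    using orthant_weight_integrable(2)[OF assms(1-5)] B0 by (intro mult_right_mono) auto
  finally show ?thesis .
qed

lemma AE_lborel_off_axes: "AE y in (lborel :: (real \<times> real) measure). fst y \<noteq> a \<and> snd y \<noteq> b"
proof -
  have "{a} \<times> (UNIV :: real set) \<in> null_sets lborel"
    unfolding lborel_prod[symmetric] by (intro null_setsI) (auto simp: lborel.emeasure_pair_measure_Times)
  then have 1: "AE y in (lborel :: (real \<times> real) measure). y \<notin> {a} \<times> UNIV" by (rule AE_not_in)
  have "(UNIV :: real set) \<times> {b} \<in> null_sets lborel"
    unfolding lborel_prod[symmetric] by (intro null_setsI) (auto simp: lborel.emeasure_pair_measure_Times)
  then have 2: "AE y in (lborel :: (real \<times> real) measure). y \<notin> UNIV \<times> {b}" by (rule AE_not_in)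
  from 1 2 show ?thesis by eventually_elim auto
qed

text \<open>Off the two edge lines, membership in the orthant is locally constant as a function of
  the corner, so the sequence is eventually constant.\<close>

lemma orthant_weight_tendsto:
  assumes "as \<longlonglongrightarrow> a" "bs \<longlonglongrightarrow> b" "fst y \<noteq> a" "snd y \<noteq> b"
  shows "(\<lambda>m. orthant_weight (as m) (bs m) y) \<longlonglongrightarrow> orthant_weight a b y"
proof (rule tendsto_eventually)
  have "\<forall>\<^sub>F m in sequentially. as m \<le> fst y \<longleftrightarrow> a \<le> fst y"
  proof (cases "a < fst y")
    case True
    show ?thesis using order_tendstoD(2)[OF assms(1) True] by eventually_elim (use True in auto)
  next
    case False
    then have "fst y < a" using assms(3) by simp
    from order_tendstoD(1)[OF assms(1) this] show ?thesis by eventually_elim (use False assms(3) in auto)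
  qed
  moreover have "\<forall>\<^sub>F m in sequentially. bs m \<le> snd y \<longleftrightarrow> b \<le> snd y"
  proof (cases "b < snd y")
    case True
    show ?thesis using order_tendstoD(2)[OF assms(2) True] by eventually_elim (use True in auto)
  next
    case False
    then have "snd y < b" using assms(4) by simp
    from order_tendstoD(1)[OF assms(2) this] show ?thesis by eventually_elim (use False assms(4) in auto)
  qed
  ultimately show "\<forall>\<^sub>F m in sequentially. orthant_weight (as m) (bs m) y = orthant_weight a b y"
    by eventually_elim (cases y, auto simp: orthant_weight_def indicator_def)
qed

lemma orthant_integral_tendsto:
  assumes ab: "as \<longlonglongrightarrow> a" "bs \<longlonglongrightarrow> b"
    and nn: "\<And>m. 0 \<le> as m" "\<And>m. 0 \<le> bs m" and d: "0 < \<delta>" "\<And>m. \<delta> \<le> max (as m) (bs m)"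
    and f[measurable]: "f \<in> borel_measurable borel" and B: "\<And>y. cmod (f y) \<le> B"
  shows "(\<lambda>m. orthant_integral f (as m) (bs m)) \<longlonglongrightarrow> orthant_integral f a b"
  unfolding orthant_integral_def
\<comment> \<open>The Cauchy majorant is available only for distances at most 1, hence
  \<open>min \<delta> 1\<close>.\<close>
proof (rule integral_dominated_convergence[where w="\<lambda>y. 8 / min \<delta> 1 ^ 4 * cauchy_weight y * B"])
  show "integrable lborel (\<lambda>y. 8 / min \<delta> 1 ^ 4 * cauchy_weight y * B)"
    using cauchy_weight_integrable by simp
  show "AE y in lborel. (\<lambda>m. complex_of_real (orthant_weight (as m) (bs m) y) * f y)
      \<longlonglongrightarrow> complex_of_real (orthant_weight a b y) * f y"
    using AE_lborel_off_axes[of a b]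
    by eventually_elim (intro tendsto_intros orthant_weight_tendsto ab, auto)
  fix m
  have d': "min \<delta> 1 \<le> max (as m) (bs m)" using d(2)[of m] by linarith
  show "AE y in lborel. norm (complex_of_real (orthant_weight (as m) (bs m) y) * f y) \<le> 8 / min \<delta> 1 ^ 4 * cauchy_weight y * B"
  proof (rule AE_I2)
    fix y
    have "orthant_weight (as m) (bs m) y * cmod (f y) \<le> 8 / min \<delta> 1 ^ 4 * cauchy_weight y * B"
      using d(1) by (intro mult_mono orthant_weight_le_cauchy nn d' B) auto
    then show "norm (complex_of_real (orthant_weight (as m) (bs m) y) * f y) \<le> 8 / min \<delta> 1 ^ 4 * cauchy_weight y * B"
      by (simp add: norm_mult orthant_weight_nonneg)
  qed
qed measurable

text \<open>Every fixed point leaves the orthant once the corner has moved far enough; from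
  \<open>s \<ge> 1\<close> on, the Cauchy majorant with distance 1 dominates. Both axes are treated
  together through the corner \<open>(p s, q s)\<close>.\<close>

lemma orthant_integral_vanish:
  assumes f[measurable]: "f \<in> borel_measurable borel" and B: "\<And>y. cmod (f y) \<le> B"
  shows "((\<lambda>s. orthant_integral f s 0) \<longlongrightarrow> 0) at_top" and "((\<lambda>s. orthant_integral f 0 s) \<longlongrightarrow> 0) at_top"
proof -
  have gen: "((\<lambda>s. orthant_integral f (p s) (q s)) \<longlongrightarrow> 0) at_top"
    if pq: "(p = (\<lambda>s. s) \<and> q = (\<lambda>_. 0)) \<or> (p = (\<lambda>_. 0) \<and> q = (\<lambda>s. s))" for p q :: "real \<Rightarrow> real"
  proof -
    have "((\<lambda>s. \<integral>y. complex_of_real (orthant_weight (p s) (q s) y) * f y \<partial>lborel) \<longlongrightarrow> integral\<^sup>L lborel (\<lambda>_ :: real \<times> real. 0)) at_top"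
    proof (rule integral_dominated_convergence_at_top[where w="\<lambda>y. 8 / 1 ^ 4 * cauchy_weight y * B"])
      show "integrable lborel (\<lambda>y. 8 / 1 ^ 4 * cauchy_weight y * B)"
        using cauchy_weight_integrable by simp
      show "AE y in lborel. ((\<lambda>s. complex_of_real (orthant_weight (p s) (q s) y) * f y) \<longlongrightarrow> 0) at_top"
      proof (rule AE_I2, rule tendsto_eventually)
        fix y :: "real \<times> real"
        show "\<forall>\<^sub>F s in at_top. complex_of_real (orthant_weight (p s) (q s) y) * f y = 0"
          using eventually_gt_at_top[of "max (fst y) (snd y)"]
          by eventually_elim (use pq in \<open>auto simp: orthant_weight_def indicator_def\<close>)
      qed
      show "\<forall>\<^sub>F s in at_top. AE y in lborel. norm (complex_of_real (orthant_weight (p s) (q s) y) * f y) \<le> 8 / 1 ^ 4 * cauchy_weight y * B"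
        using eventually_ge_at_top[of 1]
      proof eventually_elim
        case (elim s)
        show ?case
        proof (rule AE_I2)
          fix y
          have "orthant_weight (p s) (q s) y * cmod (f y) \<le> 8 / 1 ^ 4 * cauchy_weight y * B"
            using elim pq by (intro mult_mono orthant_weight_le_cauchy B) auto
          then show "norm (complex_of_real (orthant_weight (p s) (q s) y) * f y) \<le> 8 / 1 ^ 4 * cauchy_weight y * B"
            by (simp add: norm_mult orthant_weight_nonneg)
        qed
      qed
    qed measurable
    then show ?thesis by (simp add: orthant_integral_def)
  qed
  show "((\<lambda>s. orthant_integral f s 0) \<longlongrightarrow> 0) at_top" "((\<lambda>s. orthant_integral f 0 s) \<longlongrightarrow> 0) at_top"
    using gen[of "\<lambda>s. s" "\<lambda>_. 0"] gen[of "\<lambda>_. 0" "\<lambda>s. s"] by simp_all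
qed

text \<open>The estimated inverses later make the corner itself random, so joint measurability in
  corner and point is required.\<close>

lemma orthant_weight_joint_measurable [measurable]:
  "(\<lambda>p. orthant_weight (f p) (g p) (h p)) \<in> borel_measurable M"
  if [measurable]: "f \<in> borel_measurable M" "g \<in> borel_measurable M" "h \<in> borel_measurable M"
proof -
  have "orthant_weight (f p) (g p) (h p) =
      (if f p \<le> fst (h p) \<and> g p \<le> snd (h p) then 1 / quartic_weight (h p) else 0)" for p
    by (cases "h p") (auto simp: orthant_weight_def indicator_def)
  then show ?thesis by simp
qed

section \<open>Gaussian averages of characteristic functions\<close>

abbreviation std_normal :: "real measure" where
  "std_normal \<equiv> std_normal_distribution"

text \<open>Parseval for a Gaussian: the bump is the standard normal characteristic function at
  \<open>(x - y) / t\<close>, and finiteness of \<open>m\<close> permits exchanging the integrals.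
  Interval bounds and tail bounds are both read off from this identity.\<close>

lemma gauss_average_char:
  assumes "finite_measure m" and [measurable_cong, simp]: "sets m = sets (borel :: real measure)" and t: "0 < t"
  shows "complex_of_real (\<integral>x. exp (- ((x - y) / t)\<^sup>2 / 2) \<partial>m) =
      (\<integral>s. iexp (- (s / t * y)) * char m (s / t) \<partial>std_normal)"
proof -
  interpret m: finite_measure m by fact
  interpret N: real_distribution std_normal by (rule real_dist_normal_dist)
  interpret pair_sigma_finite m std_normal ..
  have [simp]: "space m = UNIV" using sets_eq_imp_space_eq[of m borel] by simp
  have int: "integrable (m \<Otimes>\<^sub>M std_normal) (\<lambda>(x, s). iexp (s * ((x - y) / t)))"
  proof -
    interpret P: finite_measure "m \<Otimes>\<^sub>M std_normal"
      by (rule finite_measure_pair_measure) (unfold_locales)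
    show ?thesis by (rule P.integrable_const_bound[where B=1]) (auto simp: case_prod_beta)
  qed
  have "complex_of_real (exp (- ((x - y) / t)\<^sup>2 / 2)) = (\<integral>s. iexp (s * ((x - y) / t)) \<partial>std_normal)" for x
    using fun_cong[OF char_std_normal_distribution, of "(x - y) / t"]
    by (simp add: char_def mult.commute)
  then have "complex_of_real (\<integral>x. exp (- ((x - y) / t)\<^sup>2 / 2) \<partial>m) =
      (\<integral>x. (\<integral>s. iexp (s * ((x - y) / t)) \<partial>std_normal) \<partial>m)"
    by (simp flip: integral_complex_of_real)
  also have "\<dots> = (\<integral>s. (\<integral>x. iexp (s * ((x - y) / t)) \<partial>m) \<partial>std_normal)"
    using Fubini_integral[of "\<lambda>x s. iexp (s * ((x - y) / t))"] int by simp
  also have "\<dots> = (\<integral>s. iexp (- (s / t * y)) * char m (s / t) \<partial>std_normal)"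
  proof (rule Bochner_Integration.integral_cong[OF refl])
    fix s
    have "iexp (s * ((x - y) / t)) = iexp (- (s / t * y)) * iexp (s / t * x)" for x
      using t by (simp add: field_simps flip: exp_add)
    then show "(\<integral>x. iexp (s * ((x - y) / t)) \<partial>m) = iexp (- (s / t * y)) * char m (s / t)"
      by (simp add: char_def)
  qed
  finally show ?thesis .
qed

lemma integral_std_normal:
  fixes f :: "real \<Rightarrow> real"
  assumes [measurable]: "f \<in> borel_measurable borel"
  shows "(\<integral>s. f s \<partial>std_normal) = (\<integral>s. std_normal_density s * f s \<partial>lborel)"
  by (subst integral_density) auto

lemma std_normal_density_le_half: "std_normal_density s \<le> 1 / 2"
proof -
  have "2 \<le> sqrt (2 * pi)" using pi_ge_two by (intro real_le_rsqrt) simp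
  then have "1 / sqrt (2 * pi) * exp (- s\<^sup>2 / 2) \<le> 1 / 2 * 1"
    by (intro mult_mono) (auto simp: frac_le)
  then show ?thesis by (simp add: std_normal_density_def)
qed

text \<open>For \<open>\<bar>s\<bar> \<le> 1\<close> the density is at most \<open>1 / 2\<close> and
  the integral is elementary, which is where the logarithm in the mass of a strip comes from. For
  larger \<open>\<bar>s\<bar>\<close> the integrand is at most \<open>t\<close>.\<close>

lemma std_normal_average_reciprocal:
  assumes t: "0 < t"
  shows "(\<integral>s. t / (t + \<bar>s\<bar>) \<partial>std_normal) \<le> t * (1 + ln (1 + 1 / t))"
proof -
  interpret N: real_distribution std_normal by (rule real_dist_normal_dist)
  define f where "f = (\<lambda>s::real. indicator {0..1} s * (t / (t + s)))"
  have F: "has_bochner_integral lborel (\<lambda>s. t / (t + s) * indicator {0..1} s) (t * ln (t + 1) - t * ln (t + 0))"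
  proof (rule has_bochner_integral_FTC_Icc_real)
    fix s :: real assume s: "0 \<le> s" "s \<le> 1"
    show "((\<lambda>s. t * ln (t + s)) has_real_derivative t / (t + s)) (at s)"
      using s t by (auto intro!: derivative_eq_intros)
    show "isCont (\<lambda>s. t / (t + s)) s"
      using s t by (intro continuous_intros) auto
  qed simp
  have f_int: "integrable lborel f" and f_val: "integral\<^sup>L lborel f = t * ln (1 + 1 / t)"
  proof -
    have "t * ln (t + 1) - t * ln (t + 0) = t * ln (1 + 1 / t)"
    proof -
      have "1 + 1 / t = (t + 1) / t" using t by (simp add: field_simps)
      then have "ln (1 + 1 / t) = ln (t + 1) - ln t" using t by (simp add: ln_div)
      then show ?thesis by (simp add: right_diff_distrib)
    qed
    then show "integrable lborel f" "integral\<^sup>L lborel f = t * ln (1 + 1 / t)"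
      using F by (auto simp: f_def mult.commute has_bochner_integral_iff)
  qed
  have fm: "integrable lborel (\<lambda>s. f (- s))" "(\<integral>s. f (- s) \<partial>lborel) = integral\<^sup>L lborel f"
    using lborel_integral_affine[of "-1" f 0] f_int by auto
  have f0: "0 \<le> f s" for s using t by (auto simp: f_def indicator_def)
  have i1: "integrable lborel std_normal_density" by (simp add: integrable_normal_density)
  have "(\<integral>s. t / (t + \<bar>s\<bar>) \<partial>std_normal) = (\<integral>s. std_normal_density s * (t / (t + \<bar>s\<bar>)) \<partial>lborel)"
    by (rule integral_std_normal) simp
  also have "\<dots> \<le> (\<integral>s. std_normal_density s * t + (1 / 2 * f s + 1 / 2 * f (- s)) \<partial>lborel)"
  proof (rule integral_mono')
    show "integrable lborel (\<lambda>s. std_normal_density s * t + (1 / 2 * f s + 1 / 2 * f (- s)))"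
      using i1 f_int fm by auto
    show "0 \<le> std_normal_density s * t + (1 / 2 * f s + 1 / 2 * f (- s))" for s
      using t f0[of s] f0[of "-s"] by simp
    fix s :: real
    have d0: "0 \<le> std_normal_density s" by simp
    show "std_normal_density s * (t / (t + \<bar>s\<bar>)) \<le> std_normal_density s * t + (1 / 2 * f s + 1 / 2 * f (- s))"
    proof (cases "\<bar>s\<bar> \<le> 1")
      case True
      have "std_normal_density s * (t / (t + \<bar>s\<bar>)) \<le> 1 / 2 * (t / (t + \<bar>s\<bar>))"
        using std_normal_density_le_half t by (intro mult_right_mono) auto
      moreover have "t / (t + \<bar>s\<bar>) \<le> f s + f (- s)"
        using True f0[of s] f0[of "-s"] by (cases "0 \<le> s") (auto simp: f_def)
      moreover have "0 \<le> std_normal_density s * t" using d0 t by simp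
      ultimately show ?thesis by linarith
    next
      case False
      then have "t / (t + \<bar>s\<bar>) \<le> t / 1" using t by (intro divide_left_mono) auto
      then have "std_normal_density s * (t / (t + \<bar>s\<bar>)) \<le> std_normal_density s * t"
        using d0 by (intro mult_left_mono) auto
      then show ?thesis using f0[of s] f0[of "-s"] by simp
    qed
  qed
  also have "\<dots> = t + t * ln (1 + 1 / t)"
    using i1 f_int fm f_val integral_normal_density[of 1 0] by simp
  finally show ?thesis by (simp add: algebra_simps)
qed

text \<open>
  A centred Gaussian dominates the indicator of an interval and is itself an average of characters.
\<close>

lemma interval_measure_le_char_decay:
  assumes "finite_measure m" and [measurable_cong, simp]: "sets m = sets (borel :: real measure)" and t: "0 < t"
    and decay: "\<And>s. cmod (char m s) \<le> c * inverse (1 + \<bar>s\<bar>)"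
  shows "measure m {x. \<bar>x - y\<bar> \<le> t} \<le> 2 * c * (t * (1 + ln (1 + 1 / t)))"
proof -
  interpret m: finite_measure m by fact
  interpret N: real_distribution std_normal by (rule real_dist_normal_dist)
  have [simp]: "space m = UNIV" using sets_eq_imp_space_eq[of m borel] by simp
  have c0: "0 \<le> c" using decay[of 0] norm_ge_zero[of "char m 0"] by (simp del: norm_ge_zero)
  let ?e = "\<lambda>x. exp (- ((x - y) / t)\<^sup>2 / 2)"
  have e: "integrable m ?e"
    by (rule m.integrable_const_bound[where B=1]) auto
  \<comment> \<open>\<open>exp (- 1 / 2)\<close> is the least value of the bump on the interval;
    that it is at least \<open>1 / 2\<close> gives the factor 2 in the conclusion.\<close>
  have "exp (- 1 / 2) * measure m {x. \<bar>x - y\<bar> \<le> t} = (\<integral>x. exp (- 1 / 2) * indicator {x. \<bar>x - y\<bar> \<le> t} x \<partial>m)"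
    by simp
  also have "\<dots> \<le> (\<integral>x. ?e x \<partial>m)"
  proof (rule integral_mono[OF _ e])
    show "integrable m (\<lambda>x. exp (- 1 / 2) * indicator {x. \<bar>x - y\<bar> \<le> t} x)"
      by (intro integrable_mult_right m.integrable_const_bound[where B=1]) (auto simp: indicator_def)
    fix x
    have "((x - y) / t)\<^sup>2 \<le> 1" if "\<bar>x - y\<bar> \<le> t"
      using that t by (simp add: abs_square_le_1)
    then show "exp (- 1 / 2) * indicator {x. \<bar>x - y\<bar> \<le> t} x \<le> ?e x"
      by (auto simp: indicator_def)
  qed
  also have "\<dots> \<le> cmod (complex_of_real (\<integral>x. ?e x \<partial>m))" by simp
  also have "\<dots> = cmod (\<integral>s. iexp (- (s / t * y)) * char m (s / t) \<partial>std_normal)"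
    by (subst gauss_average_char) (use assms in auto)
  also have "\<dots> \<le> (\<integral>s. c * (t / (t + \<bar>s\<bar>)) \<partial>std_normal)"
  proof (rule norm_integral_le)
    show "integrable std_normal (\<lambda>s. c * (t / (t + \<bar>s\<bar>)))"
    proof (intro integrable_mult_right N.integrable_const_bound[where B=1] AE_I2)
      show "norm (t / (t + \<bar>s\<bar>)) \<le> 1" for s using t by (simp add: abs_div_pos divide_le_eq)
    qed simp
    show "AE s in std_normal. cmod (iexp (- (s / t * y)) * char m (s / t)) \<le> c * (t / (t + \<bar>s\<bar>))"
    proof (rule AE_I2)
      fix s
      show "cmod (iexp (- (s / t * y)) * char m (s / t)) \<le> c * (t / (t + \<bar>s\<bar>))"
        using decay[of "s / t"] t by (simp add: norm_mult field_simps)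
    qed
  qed
  also have "\<dots> \<le> c * (t * (1 + ln (1 + 1 / t)))"
    using std_normal_average_reciprocal[OF t] c0 unfolding integral_mult_right_zero by (rule mult_left_mono)
  finally have *: "exp (- 1 / 2) * measure m {x. \<bar>x - y\<bar> \<le> t} \<le> c * (t * (1 + ln (1 + 1 / t)))" .
  have "1 / 2 \<le> exp (- 1 / 2 :: real)" using exp_ge_add_one_self[of "- 1 / 2 :: real"] by simp
  then have "1 / 2 * measure m {x. \<bar>x - y\<bar> \<le> t} \<le> exp (- 1 / 2) * measure m {x. \<bar>x - y\<bar> \<le> t}"
    by (intro mult_right_mono) auto
  with * show ?thesis by simp
qed

text \<open>One minus a Gaussian bump of width \<open>R\<close> is at least \<open>1 / 3\<close>
  beyond \<open>R\<close>, and its mean is the normal average of \<open>1 - char m (s / R)\<close>.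
  The Lipschitz bound makes that at most \<open>L / R\<close> times the mean of
  \<open>\<bar>s\<bar>\<close>, itself at most 1.\<close>

lemma tail_le_char_lipschitz:
  assumes "prob_space m" and [measurable_cong, simp]: "sets m = sets (borel :: real measure)" and R: "0 < R"
    and lip: "\<And>s. cmod (1 - char m s) \<le> L * \<bar>s\<bar>" 
  shows "measure m {x. R < \<bar>x\<bar>} \<le> 3 * L / R"
proof -
  interpret m: prob_space m by fact
  interpret N: real_distribution std_normal by (rule real_dist_normal_dist)
  have [simp]: "space m = UNIV" using sets_eq_imp_space_eq[of m borel] by simp
  have L0: "0 \<le> L" using order_trans[OF norm_ge_zero lip[of 1]] by simp
  interpret mr: real_distribution m by unfold_locales simp_all
  let ?e = "\<lambda>x. exp (- (x / R)\<^sup>2 / 2)"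
  have e: "integrable m ?e"
    by (rule m.integrable_const_bound[where B=1]) auto
  have i1: "integrable std_normal (\<lambda>s. char m (s / R))"
    using mr.cmod_char_le_1 by (intro N.integrable_const_bound[where B=1]) auto
  have i2: "integrable std_normal (\<lambda>s::real. \<bar>s\<bar>)"
    using integrable_std_normal_moment_abs[of 1] by (subst integrable_density) auto
  have v2: "(\<integral>s. \<bar>s\<bar> \<partial>std_normal) \<le> 1"
    using std_normal_distribution_odd_moments_abs[of 0] pi_ge_two
    by (simp add: real_sqrt_le_1_iff)
  have "1 / 3 * measure m {x. R < \<bar>x\<bar>} = (\<integral>x. (1 / 3 :: real) * indicator {x. R < \<bar>x\<bar>} x \<partial>m)"
    by simp
  also have "\<dots> \<le> (\<integral>x. 1 - ?e x \<partial>m)"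
  proof (rule integral_mono)
    show "integrable m (\<lambda>x. 1 - ?e x)" using e by auto
    show "integrable m (\<lambda>x. (1 / 3 :: real) * indicator {x. R < \<bar>x\<bar>} x)"
      by (intro integrable_mult_right m.integrable_const_bound[where B=1]) (auto simp: indicator_def)
    fix x
    \<comment> \<open>This numerical bound is the origin of the constant \<open>1 / 3\<close>, and
      so of the factor 3 in the conclusion.\<close>
    have e3: "exp (- 1 / 2) \<le> (2 / 3 :: real)"
    proof -
      have "3 / 2 \<le> exp (1 / 2 :: real)" using exp_ge_add_one_self[of "1 / 2 :: real"] by simp
      then have "inverse (exp (1 / 2)) \<le> inverse (3 / 2 :: real)" by (intro le_imp_inverse_le) auto
      then show ?thesis by (simp add: exp_minus)
    qed
    have "1 \<le> (x / R)\<^sup>2" if "R < \<bar>x\<bar>"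
    proof -
      have "1 \<le> \<bar>x / R\<bar>" using that R by simp
      then show ?thesis using one_le_power[of "\<bar>x / R\<bar>" 2] by (simp only: power2_abs)
    qed
    then have eh: "?e x \<le> exp (- 1 / 2)" if "R < \<bar>x\<bar>" using that by simp
    then show "1 / 3 * indicator {x. R < \<bar>x\<bar>} x \<le> 1 - ?e x"
    proof (cases "R < \<bar>x\<bar>")
      case True
      then have "1 / 3 * indicator {x. R < \<bar>x\<bar>} x = (1 / 3 :: real)" by simp
      then show ?thesis using e3 eh[OF True] by linarith
    qed simp
  qed
  also have "\<dots> = 1 - (\<integral>x. ?e x \<partial>m)" using e m.prob_space by simp
  also have "\<dots> \<le> cmod (complex_of_real (1 - (\<integral>x. ?e x \<partial>m)))" by (simp only: norm_of_real abs_ge_self)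
  also have "complex_of_real (1 - (\<integral>x. ?e x \<partial>m)) = (\<integral>s. 1 - char m (s / R) \<partial>std_normal)"
    using gauss_average_char[of m R 0] i1 R m.finite_measure_axioms N.prob_space by simp
  also have "cmod \<dots> \<le> (\<integral>s. L / R * \<bar>s\<bar> \<partial>std_normal)"
  proof (rule norm_integral_le)
    show "integrable std_normal (\<lambda>s. L / R * \<bar>s\<bar>)" using i2 by simp
    show "AE s in std_normal. cmod (1 - char m (s / R)) \<le> L / R * \<bar>s\<bar>"
    proof (rule AE_I2)
      show "cmod (1 - char m (s / R)) \<le> L / R * \<bar>s\<bar>" for s
        using lip[of "s / R"] R by simp
    qed
  qed
  also have "\<dots> \<le> L / R * 1"
    using v2 L0 R unfolding integral_mult_right_zero by (intro mult_left_mono) auto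
  finally show ?thesis by (simp add: mult.commute)
qed

lemma harm_le_ln: "1 \<le> N \<Longrightarrow> harm N \<le> 1 + ln (real N)"
proof -
  assume "1 \<le> N"
  then obtain n where n: "N = Suc n" by (cases N) auto
  have "harm (Suc n) - ln (real (Suc n)) \<le> harm (Suc 0) - ln (real (Suc 0))"
    using decseq_harm_diff_ln by (rule decseqD) simp
  then show ?thesis by (simp add: n harm_def)
qed

text \<open>Tails of order \<open>1 / R\<close> do not give a finite mean, so the mean is truncated
  at height \<open>1 / h\<close>. Summing the tails over integer levels up to there gives a harmonic
  sum, hence one logarithm.\<close>

lemma truncated_mean_le_char_lipschitz:
  assumes "prob_space m" and [measurable_cong, simp]: "sets m = sets (borel :: real measure)"
    and h: "0 < h" "h \<le> 1"
    and lip: "\<And>s. cmod (1 - char m s) \<le> L * \<bar>s\<bar>" 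
  shows "(\<integral>x. min 1 (h * \<bar>x\<bar>) \<partial>m) \<le> h * (1 + 3 * L) * (1 + ln (1 + 1 / h))"
proof -
  interpret m: prob_space m by fact
  have [simp]: "space m = UNIV" using sets_eq_imp_space_eq[of m borel] by simp
  have L0: "0 \<le> L" using order_trans[OF norm_ge_zero lip[of 1]] by simp
  define N where "N = nat \<lceil>1 / h\<rceil>"
  have N1: "1 / h \<le> real N" unfolding N_def by (rule real_nat_ceiling_ge)
  have N2: "real N \<le> 1 / h + 1"
  proof -
    have "0 \<le> 1 / h" using h by simp
    then have "0 \<le> \<lceil>1 / h\<rceil>" by linarith
    then show ?thesis unfolding N_def using of_int_ceiling_le_add_one[of "1 / h"] by simp
  qed
  have N3: "1 \<le> N"
  proof -
    have "1 \<le> 1 / h" using h by simp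
    then have "1 \<le> real N" using N1 by linarith
    then show ?thesis by simp
  qed
  \<comment> \<open>Layer-cake formula in discrete form: the number of integers \<open>R\<close> in
    \<open>1..N\<close> strictly below \<open>\<bar>x\<bar>\<close> is at least
    \<open>min N \<bar>x\<bar> - 1\<close>. The extra summand \<open>h\<close> pays for the
    rounding.\<close>
  have pw: "min 1 (h * \<bar>x\<bar>) \<le> h + h * (\<Sum>R=1..N. indicator {x. real R < \<bar>x\<bar>} x)" for x :: real
  proof -
    have cnt: "(\<Sum>R=1..N. indicator {x. real R < \<bar>x\<bar>} x :: real) = real (card {R\<in>{1..N}. real R < \<bar>x\<bar>})"
      by (simp add: indicator_def sum.If_cases Int_def)
    have "min (real N) \<bar>x\<bar> - 1 \<le> real (card {R\<in>{1..N}. real R < \<bar>x\<bar>})"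
    proof (cases "\<bar>x\<bar> \<le> 1")
      case False
      \<comment> \<open>The ceiling minus one is the largest integer strictly below
        \<open>\<bar>x\<bar>\<close>, also when \<open>\<bar>x\<bar>\<close> is an integer.\<close>
      define k where "k = min N (nat (\<lceil>\<bar>x\<bar>\<rceil> - 1))"
      have "{1..k} \<subseteq> {R\<in>{1..N}. real R < \<bar>x\<bar>}"
      proof
        fix R assume "R \<in> {1..k}"
        then have "1 \<le> R" "R \<le> N" "int R \<le> \<lceil>\<bar>x\<bar>\<rceil> - 1" using False by (auto simp: k_def)
        moreover from this have "real R < \<bar>x\<bar>" by linarith
        ultimately show "R \<in> {R\<in>{1..N}. real R < \<bar>x\<bar>}" by auto
      qed
      then have "card {1..k} \<le> card {R\<in>{1..N}. real R < \<bar>x\<bar>}" by (intro card_mono) auto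
      moreover have "min (real N) \<bar>x\<bar> - 1 \<le> real k"
        unfolding k_def using False by (simp add: min_def) linarith
      ultimately show ?thesis by simp
    qed (auto simp: min_def)
    then have "h * (min (real N) \<bar>x\<bar> - 1) \<le> h * (\<Sum>R=1..N. indicator {x. real R < \<bar>x\<bar>} x)"
      unfolding cnt using h by (intro mult_left_mono) auto
    moreover have "min 1 (h * \<bar>x\<bar>) \<le> h * min (real N) \<bar>x\<bar>"
    proof -
      have "1 \<le> h * real N" using N1 h by (simp add: field_simps)
      then show ?thesis by (auto simp: min_def)
    qed
    ultimately show ?thesis by (simp add: algebra_simps)
  qed
  have ii: "integrable m (\<lambda>x. indicator {x. real R < \<bar>x\<bar>} x :: real)" for R
    by (intro m.integrable_const_bound[where B=1]) (auto simp: indicator_def)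
  have "(\<integral>x. min 1 (h * \<bar>x\<bar>) \<partial>m) \<le> (\<integral>x. h + h * (\<Sum>R=1..N. indicator {x. real R < \<bar>x\<bar>} x) \<partial>m)"
  proof (rule integral_mono)
    show "integrable m (\<lambda>x. min 1 (h * \<bar>x\<bar>))"
      using h by (intro m.integrable_const_bound[where B=1]) auto
    show "integrable m (\<lambda>x. h + h * (\<Sum>R=1..N. indicator {x. real R < \<bar>x\<bar>} x))"
      using ii by auto
  qed (rule pw)
  also have "\<dots> = h + h * (\<Sum>R=1..N. measure m {x. real R < \<bar>x\<bar>})"
    using ii m.prob_space by simp
  also have "\<dots> \<le> h + h * (\<Sum>R=1..N. 3 * L / real R)"
    using h tail_le_char_lipschitz[OF assms(1,2) _ lip]
    by (intro add_left_mono mult_left_mono sum_mono) auto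
  also have "(\<Sum>R=1..N. 3 * L / real R) = 3 * L * harm N"
    by (simp add: harm_def sum_distrib_left divide_inverse)
  also have "\<dots> \<le> 3 * L * (1 + ln (1 + 1 / h))"
  proof -
    have "ln (real N) \<le> ln (1 + 1 / h)" using N2 N3 by (subst ln_le_cancel_iff) auto
    then show ?thesis using harm_le_ln[OF N3] L0 by (intro mult_left_mono) auto
  qed
  finally have "(\<integral>x. min 1 (h * \<bar>x\<bar>) \<partial>m) \<le> h + h * (3 * L * (1 + ln (1 + 1 / h)))"
    using h by (simp add: mult_left_mono)
  moreover have "h * 1 \<le> h * (1 + ln (1 + 1 / h))" using h by (intro mult_left_mono) auto
  ultimately show ?thesis by (simp add: algebra_simps)
qed

section \<open>Fourier inversion in the plane\<close>

definition gauss_density2 :: "real \<times> real \<Rightarrow> real" where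
  "gauss_density2 x = std_normal_density (fst x) * std_normal_density (snd x)"

definition gauss2 :: "(real \<times> real) measure" where
  "gauss2 = density lborel (\<lambda>x. ennreal (gauss_density2 x))"

lemma gauss_density2_nonneg [simp]: "0 \<le> gauss_density2 x"
  by (simp add: gauss_density2_def)

lemma gauss_density2_measurable [measurable]: "gauss_density2 \<in> borel_measurable borel"
  unfolding gauss_density2_def[abs_def] by measurable

lemma gauss_density2_le: "gauss_density2 x \<le> 1"
proof -
  have "std_normal_density (fst x) * std_normal_density (snd x) \<le> 1 / 2 * (1 / 2)"
    using std_normal_density_le_half by (intro mult_mono) auto
  then show ?thesis by (simp add: gauss_density2_def)
qed

lemma gauss_density2_integrable: "integrable lborel gauss_density2"
  and gauss_density2_integral: "integral\<^sup>L lborel gauss_density2 = 1"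
proof -
  have i: "integrable lborel std_normal_density" by (simp add: integrable_normal_density)
  show "integrable lborel gauss_density2"
    using lborel_pair_integral_mult(1)[OF i i] by (simp add: gauss_density2_def[abs_def])
  show "integral\<^sup>L lborel gauss_density2 = 1"
    using lborel_pair_integral_mult(2)[OF i i] by (simp add: gauss_density2_def[abs_def])
qed

lemma sets_gauss2 [simp, measurable_cong]: "sets gauss2 = sets borel"
  by (simp add: gauss2_def)

lemma space_gauss2 [simp]: "space gauss2 = UNIV"
  by (simp add: gauss2_def)

lemma prob_space_gauss2: "prob_space gauss2"
proof
  have "emeasure gauss2 UNIV = (\<integral>\<^sup>+x. ennreal (gauss_density2 x) \<partial>lborel)"
    by (simp add: gauss2_def emeasure_density)
  also have "\<dots> = 1"
    using nn_integral_eq_integral[OF gauss_density2_integrable] gauss_density2_integral by simp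
  finally show "emeasure gauss2 (space gauss2) = 1" by simp
qed

lemma integral_gauss2:
  fixes f :: "real \<times> real \<Rightarrow> 'b::{banach,second_countable_topology}"
  assumes [measurable]: "f \<in> borel_measurable borel"
  shows "(\<integral>x. f x \<partial>gauss2) = (\<integral>x. gauss_density2 x *\<^sub>R f x \<partial>lborel)"
  unfolding gauss2_def by (subst integral_density) auto

lemma gauss2_norm_integrable: "integrable gauss2 norm"
proof -
  have i0: "integrable lborel std_normal_density" by (simp add: integrable_normal_density)
  have i1: "integrable lborel (\<lambda>s. std_normal_density s * \<bar>s\<bar>)"
    using integrable_std_normal_moment_abs[of 1] by simp
  have "integrable lborel (\<lambda>x::real\<times>real. (std_normal_density (fst x) * \<bar>fst x\<bar>) * std_normal_density (snd x)
     + std_normal_density (fst x) * (std_normal_density (snd x) * \<bar>snd x\<bar>))"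
    by (intro Bochner_Integration.integrable_add lborel_pair_integral_mult i0 i1)
  then have "integrable lborel (\<lambda>x. gauss_density2 x *\<^sub>R norm x)"
  proof (rule Bochner_Integration.integrable_bound)
    show "AE x in lborel. norm (gauss_density2 x *\<^sub>R norm x) \<le>
       norm ((std_normal_density (fst x) * \<bar>fst x\<bar>) * std_normal_density (snd x)
     + std_normal_density (fst x) * (std_normal_density (snd x) * \<bar>snd x\<bar>))"
    proof (rule AE_I2)
      fix x :: "real \<times> real"
      have "norm x \<le> \<bar>fst x\<bar> + \<bar>snd x\<bar>" using norm_Pair_le[of "fst x" "snd x"] by simp
      then have "gauss_density2 x * norm x \<le> gauss_density2 x * (\<bar>fst x\<bar> + \<bar>snd x\<bar>)"
        by (intro mult_left_mono) auto
      also have "\<dots> = std_normal_density (fst x) * \<bar>fst x\<bar> * std_normal_density (snd x)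
         + std_normal_density (fst x) * (std_normal_density (snd x) * \<bar>snd x\<bar>)"
        by (simp add: gauss_density2_def algebra_simps)
      finally show "norm (gauss_density2 x *\<^sub>R norm x) \<le>
       norm ((std_normal_density (fst x) * \<bar>fst x\<bar>) * std_normal_density (snd x)
         + std_normal_density (fst x) * (std_normal_density (snd x) * \<bar>snd x\<bar>))"
        by simp
    qed
  qed simp
  then show ?thesis unfolding gauss2_def by (subst integrable_density) auto
qed

lemma gauss_density2_eq: "gauss_density2 v = exp (- (v \<bullet> v) / 2) / (2 * pi)"
proof -
  have "gauss_density2 v = 1 / (sqrt (2 * pi) * sqrt (2 * pi)) * (exp (- (fst v)\<^sup>2 / 2) * exp (- (snd v)\<^sup>2 / 2))"
    by (simp add: gauss_density2_def std_normal_density_def)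
  also have "exp (- (fst v)\<^sup>2 / 2) * exp (- (snd v)\<^sup>2 / 2) = exp (- (v \<bullet> v) / 2)"
    by (simp add: inner_prod_def power2_eq_square field_simps flip: exp_add)
  finally show ?thesis by simp
qed

lemma gauss_density2_fourier:
  "(\<integral>u. iexp (u \<bullet> v) * complex_of_real (gauss_density2 u) \<partial>lborel) = complex_of_real (exp (- (v \<bullet> v) / 2))"
proof -
  have i0: "integrable lborel std_normal_density" by (simp add: integrable_normal_density)
  have i: "integrable lborel (\<lambda>s. iexp (s * t) * complex_of_real (std_normal_density s))" for t
    by (rule Bochner_Integration.integrable_bound[OF i0]) (auto simp: norm_mult)
  have v1: "(\<integral>s. iexp (s * t) * complex_of_real (std_normal_density s) \<partial>lborel) = complex_of_real (exp (- t\<^sup>2 / 2))" for t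
  proof -
    have "char std_normal t = (\<integral>s. std_normal_density s *\<^sub>R iexp (t * s) \<partial>lborel)"
      unfolding char_def by (subst integral_density) auto
    then show ?thesis
      using fun_cong[OF char_std_normal_distribution, of t]
      by (simp add: scaleR_conv_of_real mult.commute)
  qed
  have "iexp (u \<bullet> v) * complex_of_real (gauss_density2 u) =
      (iexp (fst u * fst v) * complex_of_real (std_normal_density (fst u))) *
      (iexp (snd u * snd v) * complex_of_real (std_normal_density (snd u)))" for u
    by (simp add: gauss_density2_def inner_prod_def distrib_left exp_add)
  then have "(\<integral>u. iexp (u \<bullet> v) * complex_of_real (gauss_density2 u) \<partial>lborel) =
     complex_of_real (exp (- (fst v)\<^sup>2 / 2)) * complex_of_real (exp (- (snd v)\<^sup>2 / 2))"
    using lborel_pair_integral_mult(2)[OF i i, of "fst v" "snd v"] by (simp only: v1)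
  also have "\<dots> = complex_of_real (exp (- (v \<bullet> v) / 2))"
    by (simp add: inner_prod_def power2_eq_square field_simps flip: exp_add of_real_mult)
  finally show ?thesis .
qed

text \<open>Self-duality of the Gaussian after scaling. One factor \<open>2 * pi\<close> comes from
  normalising the density in the integrand, the other from the density on the right.\<close>

lemma gauss_kernel_fourier:
  assumes e: "0 < \<epsilon>"
  shows "(\<integral>u. iexp (u \<bullet> v) * complex_of_real (exp (- (\<epsilon>\<^sup>2 * (u \<bullet> u)) / 2)) \<partial>lborel) =
     complex_of_real ((2 * pi)\<^sup>2 * (gauss_density2 ((1 / \<epsilon>) *\<^sub>R v) / \<epsilon>\<^sup>2))"
proof -
  define F where "F = (\<lambda>u. iexp (u \<bullet> ((1 / \<epsilon>) *\<^sub>R v)) * complex_of_real (gauss_density2 u))"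
  have [measurable]: "F \<in> borel_measurable borel" unfolding F_def by measurable
  have "integral\<^sup>L lborel F = \<epsilon>\<^sup>2 *\<^sub>R (\<integral>u. F (\<epsilon> *\<^sub>R u) \<partial>lborel)"
    using lborel_integral_affine(1)[of \<epsilon> F 0] e by (simp add: power2_eq_square)
  moreover have "integral\<^sup>L lborel F = complex_of_real (2 * pi * gauss_density2 ((1 / \<epsilon>) *\<^sub>R v))"
    unfolding F_def gauss_density2_fourier by (simp add: gauss_density2_eq)
  moreover have "F (\<epsilon> *\<^sub>R u) = iexp (u \<bullet> v) * complex_of_real (exp (- (\<epsilon>\<^sup>2 * (u \<bullet> u)) / 2)) * complex_of_real (1 / (2 * pi))" for u
    using e by (simp add: F_def gauss_density2_eq power2_eq_square)
  ultimately have "complex_of_real (2 * pi * gauss_density2 ((1 / \<epsilon>) *\<^sub>R v)) =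
      \<epsilon>\<^sup>2 *\<^sub>R ((\<integral>u. iexp (u \<bullet> v) * complex_of_real (exp (- (\<epsilon>\<^sup>2 * (u \<bullet> u)) / 2)) \<partial>lborel) * complex_of_real (1 / (2 * pi)))"
    by (simp only: integral_mult_left_zero)
  then show ?thesis using e by (simp add: scaleR_conv_of_real field_simps power2_eq_square)
qed

lemma inv_fourier_measurable [measurable]:
  assumes [measurable]: "f \<in> borel_measurable borel"
  shows "inv_fourier f \<in> borel_measurable borel"
  unfolding inv_fourier_def[abs_def] by measurable

lemma inv_fourier_norm_le:
  assumes "integrable lborel w" "\<And>u. cmod (f u) \<le> w u"
  shows "cmod (inv_fourier f y) \<le> integral\<^sup>L lborel w / (2 * pi)\<^sup>2"
proof -
  have "cmod (\<integral>u. iexp (- (u \<bullet> y)) * f u \<partial>lborel) \<le> integral\<^sup>L lborel w"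
    by (rule norm_integral_le[OF assms(1)]) (simp add: norm_mult assms(2))
  then have "1 / (2 * pi)\<^sup>2 * cmod (\<integral>u. iexp (- (u \<bullet> y)) * f u \<partial>lborel) \<le> 1 / (2 * pi)\<^sup>2 * integral\<^sup>L lborel w"
    by (intro mult_left_mono) auto
  moreover have "\<bar>1 / (2 * pi)\<^sup>2\<bar> = 1 / (2 * pi)\<^sup>2" by simp
  ultimately show ?thesis unfolding inv_fourier_def norm_mult norm_of_real by simp
qed

lemma fourier_measure_norm_le:
  assumes "finite_measure \<mu>"
  shows "cmod (fourier_measure \<mu> u) \<le> measure \<mu> (space \<mu>)"
proof -
  interpret finite_measure \<mu> by fact
  have "cmod (fourier_measure \<mu> u) \<le> (\<integral>x. 1 \<partial>\<mu>)"
    unfolding fourier_measure_def by (rule norm_integral_le) auto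
  then show ?thesis by simp
qed

lemma fourier_measure_measurable:
  assumes "finite_measure (\<mu> :: (real\<times>real) measure)" and [measurable_cong]: "sets \<mu> = sets borel"
  shows "fourier_measure \<mu> \<in> borel_measurable borel"
proof -
  interpret finite_measure \<mu> by fact
  show ?thesis unfolding fourier_measure_def[abs_def] by measurable
qed

text \<open>The Gaussian damping makes the double integral absolutely convergent, so the formula
  holds for every finite measure, with or without an integrable transform.\<close>

lemma gauss_regularised_inversion:
  assumes "finite_measure \<theta>" and [measurable_cong, simp]: "sets \<theta> = sets (borel :: (real \<times> real) measure)"
    and e: "0 < \<epsilon>"
  shows "inv_fourier (\<lambda>u. fourier_measure \<theta> u * complex_of_real (exp (- (\<epsilon>\<^sup>2 * (u \<bullet> u)) / 2))) y
     = complex_of_real (\<integral>x. gauss_density2 ((1 / \<epsilon>) *\<^sub>R (x - y)) / \<epsilon>\<^sup>2 \<partial>\<theta>)"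
proof -
  interpret l: finite_measure \<theta> by fact
  interpret pair_sigma_finite lborel \<theta> ..
  let ?E = "\<lambda>u::real\<times>real. exp (- (\<epsilon>\<^sup>2 * (u \<bullet> u)) / 2)"
  have iE: "integrable lborel ?E"
  proof -
    have "integrable lborel (\<lambda>u. 2 * pi * gauss_density2 (0 + \<epsilon> *\<^sub>R u))"
      using lborel_integral_affine(2)[of \<epsilon> gauss_density2 0] e gauss_density2_integrable by simp
    then show ?thesis by (simp add: gauss_density2_eq power2_eq_square mult.assoc)
  qed
  have int: "integrable (lborel \<Otimes>\<^sub>M \<theta>) (\<lambda>(u, x). iexp (u \<bullet> (x - y)) * complex_of_real (?E u))"
  proof (rule Bochner_Integration.integrable_bound)
    show "integrable (lborel \<Otimes>\<^sub>M \<theta>) (\<lambda>p. ?E (fst p) * (\<lambda>_. 1) (snd p))"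
      by (rule prod_integral_mult(1)[OF _ _ iE]) (unfold_locales, simp)
  qed (auto simp: norm_mult)
  have "(\<integral>u. iexp (- (u \<bullet> y)) * (fourier_measure \<theta> u * complex_of_real (?E u)) \<partial>lborel)
     = (\<integral>u. (\<integral>x. iexp (u \<bullet> (x - y)) * complex_of_real (?E u) \<partial>\<theta>) \<partial>lborel)"
  proof (rule Bochner_Integration.integral_cong[OF refl])
    fix u
    have "iexp (u \<bullet> (x - y)) * complex_of_real (?E u) = iexp (- (u \<bullet> y)) * complex_of_real (?E u) * iexp (u \<bullet> x)" for x
      by (simp add: inner_diff_right algebra_simps exp_diff exp_minus field_simps)
    then show "iexp (- (u \<bullet> y)) * (fourier_measure \<theta> u * complex_of_real (?E u)) =
       (\<integral>x. iexp (u \<bullet> (x - y)) * complex_of_real (?E u) \<partial>\<theta>)"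
      by (simp add: fourier_measure_def)
  qed
  also have "\<dots> = (\<integral>x. (\<integral>u. iexp (u \<bullet> (x - y)) * complex_of_real (?E u) \<partial>lborel) \<partial>\<theta>)"
    by (rule Fubini_integral[symmetric, OF int])
  also have "\<dots> = complex_of_real ((2 * pi)\<^sup>2) * complex_of_real (\<integral>x. gauss_density2 ((1 / \<epsilon>) *\<^sub>R (x - y)) / \<epsilon>\<^sup>2 \<partial>\<theta>)"
    unfolding gauss_kernel_fourier[OF e]
    by (simp only: integral_complex_of_real integral_mult_right_zero of_real_mult)
  finally show ?thesis unfolding inv_fourier_def by simp
qed

text \<open>
  Inversion is kept in this regularised form: the smoothed integrals on the left are estimated
  uniformly in \<open>m\<close> later on, so neither continuity of \<open>g\<close> nor inversion for \<open>K\<close> is needed.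
\<close>

lemma fourier_inversion_limit:
  fixes g :: "real \<times> real \<Rightarrow> real"
  assumes lfin: "finite_measure \<theta>" and [measurable_cong, simp]: "sets \<theta> = sets (borel :: (real \<times> real) measure)"
    and Fint: "integrable lborel (fourier_measure \<theta>)"
    and g: "integrable lborel g"
  shows "(\<lambda>m. complex_of_real (\<integral>x. (\<integral>z. g (x + (1 / real (Suc m)) *\<^sub>R z) \<partial>gauss2) \<partial>\<theta>))
     \<longlonglongrightarrow> (\<integral>y. complex_of_real (g y) * inv_fourier (fourier_measure \<theta>) y \<partial>lborel)"
proof -
  interpret l: finite_measure \<theta> by fact
  interpret pair_sigma_finite lborel \<theta> ..
  have gm[measurable]: "g \<in> borel_measurable borel" using g by auto
  have Fm[measurable]: "fourier_measure \<theta> \<in> borel_measurable borel" using Fint by auto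
  define \<epsilon> where "\<epsilon> = (\<lambda>m. 1 / real (Suc m))"
  have e0: "0 < \<epsilon> m" for m by (simp add: \<epsilon>_def)
  have e_lim: "\<epsilon> \<longlonglongrightarrow> 0" unfolding \<epsilon>_def using LIMSEQ_inverse_real_of_nat by (simp add: inverse_eq_divide)
  define I where "I = (\<lambda>m. inv_fourier (\<lambda>u. fourier_measure \<theta> u * complex_of_real (exp (- ((\<epsilon> m)\<^sup>2 * (u \<bullet> u)) / 2))))"
  have Im[measurable]: "I m \<in> borel_measurable borel" for m unfolding I_def by measurable
  have le: "cmod (fourier_measure \<theta> u * complex_of_real (exp (- ((\<epsilon> m)\<^sup>2 * (u \<bullet> u)) / 2))) \<le> cmod (fourier_measure \<theta> u)" for m u
    by (simp add: norm_mult mult_left_le)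
  have I_lim: "(\<lambda>m. I m y) \<longlonglongrightarrow> inv_fourier (fourier_measure \<theta>) y" for y
    unfolding I_def inv_fourier_def
  proof (intro tendsto_mult tendsto_const integral_dominated_convergence[where w="\<lambda>u. cmod (fourier_measure \<theta> u)"])
    show "AE u in lborel. (\<lambda>m. iexp (- (u \<bullet> y)) * (fourier_measure \<theta> u * complex_of_real (exp (- ((\<epsilon> m)\<^sup>2 * (u \<bullet> u)) / 2))))
       \<longlonglongrightarrow> iexp (- (u \<bullet> y)) * fourier_measure \<theta> u"
    proof (rule AE_I2)
      fix u :: "real \<times> real"
      have "(\<lambda>m. iexp (- (u \<bullet> y)) * (fourier_measure \<theta> u * complex_of_real (exp (- ((\<epsilon> m)\<^sup>2 * (u \<bullet> u)) / 2))))
       \<longlonglongrightarrow> iexp (- (u \<bullet> y)) * (fourier_measure \<theta> u * complex_of_real (exp (- (0\<^sup>2 * (u \<bullet> u)) / 2)))"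
        by (intro tendsto_intros e_lim) auto
      then show "(\<lambda>m. iexp (- (u \<bullet> y)) * (fourier_measure \<theta> u * complex_of_real (exp (- ((\<epsilon> m)\<^sup>2 * (u \<bullet> u)) / 2))))
       \<longlonglongrightarrow> iexp (- (u \<bullet> y)) * fourier_measure \<theta> u" by simp
    qed
    show "AE u in lborel. norm (iexp (- (u \<bullet> y)) * (fourier_measure \<theta> u * complex_of_real (exp (- ((\<epsilon> m)\<^sup>2 * (u \<bullet> u)) / 2))))
        \<le> cmod (fourier_measure \<theta> u)" for m
      using le[of _ m] by (simp add: norm_mult)
    show "integrable lborel (\<lambda>u. cmod (fourier_measure \<theta> u))" using Fint by auto
  qed measurable
  define C0 where "C0 = (\<integral>u. cmod (fourier_measure \<theta> u) \<partial>lborel) / (2 * pi)\<^sup>2"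
  have I_le: "cmod (I m y) \<le> C0" for m y
    unfolding I_def C0_def using Fint by (intro inv_fourier_norm_le le) auto
  have "(\<lambda>m. \<integral>y. complex_of_real (g y) * I m y \<partial>lborel)
     \<longlonglongrightarrow> (\<integral>y. complex_of_real (g y) * inv_fourier (fourier_measure \<theta>) y \<partial>lborel)"
  proof (rule integral_dominated_convergence[where w="\<lambda>y. \<bar>g y\<bar> * C0"])
    show "integrable lborel (\<lambda>y. \<bar>g y\<bar> * C0)" using g by auto
    show "AE y in lborel. (\<lambda>m. complex_of_real (g y) * I m y) \<longlonglongrightarrow> complex_of_real (g y) * inv_fourier (fourier_measure \<theta>) y"
      by (intro AE_I2 tendsto_intros I_lim)
    show "AE y in lborel. norm (complex_of_real (g y) * I m y) \<le> \<bar>g y\<bar> * C0" for m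
      using I_le[of m] by (simp add: norm_mult mult_left_mono)
  qed measurable
  moreover have "(\<integral>y. complex_of_real (g y) * I m y \<partial>lborel) =
      complex_of_real (\<integral>x. (\<integral>z. g (x + (1 / real (Suc m)) *\<^sub>R z) \<partial>gauss2) \<partial>\<theta>)" for m
  proof -
    have int: "integrable (lborel \<Otimes>\<^sub>M \<theta>) (\<lambda>(y, x). g y * (gauss_density2 ((1 / \<epsilon> m) *\<^sub>R (x - y)) / (\<epsilon> m)\<^sup>2))"
    proof (rule Bochner_Integration.integrable_bound)
      show "integrable (lborel \<Otimes>\<^sub>M \<theta>) (\<lambda>p. g (fst p) * (\<lambda>_. 1 / (\<epsilon> m)\<^sup>2) (snd p))"
        by (rule prod_integral_mult(1)[OF _ _ g]) (unfold_locales, simp)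
      show "AE p in lborel \<Otimes>\<^sub>M \<theta>. norm (case p of (y, x) \<Rightarrow> g y * (gauss_density2 ((1 / \<epsilon> m) *\<^sub>R (x - y)) / (\<epsilon> m)\<^sup>2))
          \<le> norm (g (fst p) * (1 / (\<epsilon> m)\<^sup>2))"
      proof (rule AE_I2)
        fix p :: "(real \<times> real) \<times> (real \<times> real)"
        have "\<bar>g (fst p)\<bar> * (gauss_density2 ((1 / \<epsilon> m) *\<^sub>R (snd p - fst p)) / (\<epsilon> m)\<^sup>2) \<le> \<bar>g (fst p)\<bar> * (1 / (\<epsilon> m)\<^sup>2)"
          using gauss_density2_le by (intro mult_left_mono divide_right_mono) auto
        then show "norm (case p of (y, x) \<Rightarrow> g y * (gauss_density2 ((1 / \<epsilon> m) *\<^sub>R (x - y)) / (\<epsilon> m)\<^sup>2))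
          \<le> norm (g (fst p) * (1 / (\<epsilon> m)\<^sup>2))"
          by (simp add: case_prod_beta abs_mult)
      qed
    qed measurable
    have "(\<integral>y. complex_of_real (g y) * I m y \<partial>lborel) =
       (\<integral>y. complex_of_real (\<integral>x. g y * (gauss_density2 ((1 / \<epsilon> m) *\<^sub>R (x - y)) / (\<epsilon> m)\<^sup>2) \<partial>\<theta>) \<partial>lborel)"
      unfolding I_def gauss_regularised_inversion[OF lfin assms(2) e0]
      by (simp only: integral_mult_right_zero of_real_mult)
    also have "\<dots> = complex_of_real (\<integral>y. (\<integral>x. g y * (gauss_density2 ((1 / \<epsilon> m) *\<^sub>R (x - y)) / (\<epsilon> m)\<^sup>2) \<partial>\<theta>) \<partial>lborel)"
      by (rule integral_complex_of_real)
    also have "(\<integral>y. (\<integral>x. g y * (gauss_density2 ((1 / \<epsilon> m) *\<^sub>R (x - y)) / (\<epsilon> m)\<^sup>2) \<partial>\<theta>) \<partial>lborel) =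
       (\<integral>x. (\<integral>y. g y * (gauss_density2 ((1 / \<epsilon> m) *\<^sub>R (x - y)) / (\<epsilon> m)\<^sup>2) \<partial>lborel) \<partial>\<theta>)"
      by (rule Fubini_integral[symmetric, OF int])
    \<comment> \<open>Substitution \<open>y = x + \<epsilon> z\<close>; the Jacobian cancels the
      normalising factor and evenness of the Gaussian removes the sign.\<close>
    also have "\<dots> = (\<integral>x. (\<integral>z. g (x + \<epsilon> m *\<^sub>R z) \<partial>gauss2) \<partial>\<theta>)"
    proof (rule Bochner_Integration.integral_cong[OF refl])
      fix x :: "real \<times> real"
      have even: "gauss_density2 (- z) = gauss_density2 z" for z by (simp add: gauss_density2_eq)
      have "(\<integral>y. g y * (gauss_density2 ((1 / \<epsilon> m) *\<^sub>R (x - y)) / (\<epsilon> m)\<^sup>2) \<partial>lborel) =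
        (\<epsilon> m)\<^sup>2 * (\<integral>z. g (x + \<epsilon> m *\<^sub>R z) * (gauss_density2 ((1 / \<epsilon> m) *\<^sub>R (x - (x + \<epsilon> m *\<^sub>R z))) / (\<epsilon> m)\<^sup>2) \<partial>lborel)"
        using lborel_integral_affine(1)[of "\<epsilon> m" "\<lambda>y. g y * (gauss_density2 ((1 / \<epsilon> m) *\<^sub>R (x - y)) / (\<epsilon> m)\<^sup>2)" x] e0[of m]
        by (simp add: power2_eq_square)
      also have "\<dots> = (\<integral>z. gauss_density2 z *\<^sub>R g (x + \<epsilon> m *\<^sub>R z) \<partial>lborel)"
        using e0[of m] by (simp add: even mult.commute)
      also have "\<dots> = (\<integral>z. g (x + \<epsilon> m *\<^sub>R z) \<partial>gauss2)"
        by (rule integral_gauss2[symmetric]) measurable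
      finally show "(\<integral>y. g y * (gauss_density2 ((1 / \<epsilon> m) *\<^sub>R (x - y)) / (\<epsilon> m)\<^sup>2) \<partial>lborel) = (\<integral>z. g (x + \<epsilon> m *\<^sub>R z) \<partial>gauss2)" .
    qed
    finally show ?thesis by (simp add: \<epsilon>_def)
  qed
  ultimately show ?thesis by simp
qed

section \<open>The smoothing bias\<close>

text \<open>Let \<open>P\<close> and \<open>m\<close> be the larger and the smaller of the two
  maximum norms. The difference of the weights is at most \<open>8 * P^3\<close> times the distance,
  their product at least \<open>P^4 * m^4\<close>, and \<open>P * m^4 \<ge> \<delta>^5\<close>.
  Using the larger norm in both bounds makes the powers of \<open>P\<close> cancel.\<close>

lemma quartic_weight_inverse_lipschitz:
  assumes x: "x \<in> orthant a b" and y: "y \<in> orthant a b"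
    and ab: "0 \<le> a" "0 \<le> b" and d: "0 < \<delta>" "\<delta> \<le> max a b"
  shows "\<bar>1 / quartic_weight y - 1 / quartic_weight x\<bar> \<le> 8 / \<delta> ^ 5 * norm (y - x)"
proof -
  define p where "p = max (fst x) (snd x)"
  define q where "q = max (fst y) (snd y)"
  define P where "P = max p q"
  define m where "m = min p q"
  have pos: "0 \<le> fst x" "0 \<le> snd x" "0 \<le> fst y" "0 \<le> snd y"
    using x y ab by (cases x; cases y; auto)+
  have "\<delta> \<le> p" "\<delta> \<le> q" using x y d unfolding p_def q_def by (cases x; cases y; auto)+
  then have dm: "\<delta> \<le> m" "m \<le> P" by (auto simp: m_def P_def)
  have wx: "p ^ 4 \<le> quartic_weight x"
    unfolding p_def quartic_weight_def by (cases "fst x \<le> snd x") (auto simp: max_def)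
  have wy: "q ^ 4 \<le> quartic_weight y"
    unfolding q_def quartic_weight_def by (cases "fst y \<le> snd y") (auto simp: max_def)
  have pp: "0 < p" "0 < q" "0 < P" "0 < m" using \<open>\<delta> \<le> p\<close> \<open>\<delta> \<le> q\<close> dm d by auto
  have "P ^ 4 * m ^ 4 = p ^ 4 * q ^ 4"
    by (cases "p \<le> q") (auto simp: P_def m_def mult.commute)
  also have "\<dots> \<le> quartic_weight x * quartic_weight y"
    using wx wy pp by (intro mult_mono) (auto simp: quartic_weight_nonneg)
  finally have prod: "P ^ 4 * m ^ 4 \<le> quartic_weight x * quartic_weight y" .
  have w0: "0 < quartic_weight x" "0 < quartic_weight y"
    using wx wy pp by (auto intro: less_le_trans[OF zero_less_power])
  have one: "\<bar>s ^ 4 - t ^ 4\<bar> \<le> 4 * P ^ 3 * \<bar>s - t\<bar>" if "0 \<le> s" "0 \<le> t" "s \<le> P" "t \<le> P" for s t :: real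
  proof -
    have "s ^ 4 - t ^ 4 = (s - t) * (s ^ 3 + s ^ 2 * t + s * t ^ 2 + t ^ 3)"
      by (simp add: algebra_simps eval_nat_numeral)
    then have "\<bar>s ^ 4 - t ^ 4\<bar> = \<bar>s - t\<bar> * (s ^ 3 + s ^ 2 * t + s * t ^ 2 + t ^ 3)"
      using that by (simp add: abs_mult)
    also have "\<dots> \<le> \<bar>s - t\<bar> * (P ^ 3 + P ^ 2 * P + P * P ^ 2 + P ^ 3)"
      using that by (intro mult_left_mono add_mono mult_mono power_mono) auto
    also have "\<dots> = 4 * P ^ 3 * \<bar>s - t\<bar>" by (simp add: eval_nat_numeral)
    finally show ?thesis .
  qed
  have nf: "\<bar>fst x - fst y\<bar> \<le> norm (y - x)" "\<bar>snd x - snd y\<bar> \<le> norm (y - x)"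
    using norm_fst_le[of "fst (y - x)" "snd (y - x)"] norm_snd_le[of "snd (y - x)" "fst (y - x)"]
    unfolding prod.collapse by (auto simp: fst_diff snd_diff)
  have "\<bar>quartic_weight x - quartic_weight y\<bar> \<le> \<bar>fst x ^ 4 - fst y ^ 4\<bar> + \<bar>snd x ^ 4 - snd y ^ 4\<bar>"
    by (simp add: quartic_weight_def)
  also have "\<dots> \<le> 4 * P ^ 3 * \<bar>fst x - fst y\<bar> + 4 * P ^ 3 * \<bar>snd x - snd y\<bar>"
    using pos by (intro add_mono one) (auto simp: P_def p_def q_def)
  also have "\<dots> \<le> 4 * P ^ 3 * norm (y - x) + 4 * P ^ 3 * norm (y - x)"
    using pp nf by (intro add_mono mult_left_mono) auto
  finally have num: "\<bar>quartic_weight x - quartic_weight y\<bar> \<le> 8 * P ^ 3 * norm (y - x)" by (simp add: mult_ac)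
  have "\<bar>1 / quartic_weight y - 1 / quartic_weight x\<bar> =
      \<bar>quartic_weight x - quartic_weight y\<bar> / (quartic_weight x * quartic_weight y)"
    using w0 by (simp add: diff_frac_eq abs_mult abs_div mult.commute)
  also have "\<dots> \<le> 8 * P ^ 3 * norm (y - x) / (P ^ 4 * m ^ 4)"
    using num prod pp w0 by (intro frac_le) auto
  also have "\<dots> = 8 * norm (y - x) / (P * m ^ 4)"
    using pp by (simp add: field_simps eval_nat_numeral)
  also have "\<dots> \<le> 8 * norm (y - x) / \<delta> ^ 5"
  proof -
    have "\<delta> * \<delta> ^ 4 \<le> P * m ^ 4" using dm d by (intro mult_mono power_mono) auto
    then have "\<delta> ^ 5 \<le> P * m ^ 4" by (simp add: eval_nat_numeral)
    then show ?thesis using d by (intro divide_left_mono) (auto intro!: mult_pos_pos pp)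
  qed
  finally show ?thesis by simp
qed

definition log_factor :: "real \<Rightarrow> real" where
  "log_factor h = 1 + ln (1 + 1 / h)"

lemma log_factor_ge_1: "0 < h \<Longrightarrow> 1 \<le> log_factor h"
  by (simp add: log_factor_def)

lemma log_factor_antimono: "0 < h \<Longrightarrow> h \<le> t \<Longrightarrow> log_factor t \<le> log_factor h"
  unfolding log_factor_def by (intro add_left_mono, subst ln_le_cancel_iff) (auto simp: add_pos_pos frac_le)

lemma char_distr_fst:
  fixes \<mu> :: "(real \<times> real) measure"
  assumes [measurable_cong]: "sets \<mu> = sets borel"
  shows "char (distr \<mu> borel fst) s = fourier_measure \<mu> (s, 0)"
    and "char (distr \<mu> borel snd) s = fourier_measure \<mu> (0, s)"
  by (simp_all add: char_def fourier_measure_def integral_distr inner_prod_def)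

locale decaying_measure =
  fixes \<mu> :: "(real \<times> real) measure" and c :: real
  assumes mu_finite: "finite_measure \<mu>" and mu_sets [measurable_cong, simp]: "sets \<mu> = sets borel"
    and decay: "\<And>u. cmod (fourier_measure \<mu> u) \<le> c * inverse (1 + \<bar>fst u\<bar>) * inverse (1 + \<bar>snd u\<bar>)"
begin

sublocale finite_measure \<mu> by (rule mu_finite)

lemma space_mu [simp]: "space \<mu> = UNIV"
  using sets_eq_imp_space_eq[OF mu_sets] by simp

lemma c_nonneg: "0 \<le> c"
  using order_trans[OF norm_ge_zero decay[of 0]] by simp

lemma strip_measure_le:
  assumes "0 < t"
  shows "measure \<mu> {x. \<bar>fst x - y\<bar> \<le> t} \<le> 2 * c * (t * log_factor t)"
    and "measure \<mu> {x. \<bar>snd x - y\<bar> \<le> t} \<le> 2 * c * (t * log_factor t)"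
proof -
  have f: "finite_measure (distr \<mu> borel fst)" "finite_measure (distr \<mu> borel snd)"
    by (auto intro!: finite_measure_distr)
  have d: "cmod (char (distr \<mu> borel fst) s) \<le> c * inverse (1 + \<bar>s\<bar>)"
      "cmod (char (distr \<mu> borel snd) s) \<le> c * inverse (1 + \<bar>s\<bar>)" for s
    using decay[of "(s, 0)"] decay[of "(0, s)"] by (simp_all add: char_distr_fst)
  have "measure (distr \<mu> borel fst) {x. \<bar>x - y\<bar> \<le> t} = measure \<mu> {x. \<bar>fst x - y\<bar> \<le> t}"
    by (subst measure_distr) (auto simp: vimage_def)
  with interval_measure_le_char_decay[OF f(1) _ assms d(1), of y]
  show "measure \<mu> {x. \<bar>fst x - y\<bar> \<le> t} \<le> 2 * c * (t * log_factor t)" by (simp add: log_factor_def)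
  have "measure (distr \<mu> borel snd) {x. \<bar>x - y\<bar> \<le> t} = measure \<mu> {x. \<bar>snd x - y\<bar> \<le> t}"
    by (subst measure_distr) (auto simp: vimage_def)
  with interval_measure_le_char_decay[OF f(2) _ assms d(2), of y]
  show "measure \<mu> {x. \<bar>snd x - y\<bar> \<le> t} \<le> 2 * c * (t * log_factor t)" by (simp add: log_factor_def)
qed

lemma orthant_weight_mu_integrable:
  assumes "0 \<le> a" "0 \<le> b" "0 < \<delta>" "\<delta> \<le> max a b"
  shows "integrable \<mu> (\<lambda>x. orthant_weight a b (x + v))"
  using orthant_weight_le[OF assms] orthant_weight_nonneg
  by (intro integrable_const_bound[where B="1 / \<delta> ^ 4"]) auto

text \<open>Where \<open>x\<close> and \<open>x + v\<close> lie on the same side of the orthant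
  boundary, the weight is Lipschitz or vanishes at both. Otherwise \<open>x\<close> is within
  \<open>norm v\<close> of an edge line, and the strip bounds apply. The minimum with 1 keeps the
  estimate useful for kernels with heavy tails.\<close>

lemma shift_difference_le:
  assumes ab: "0 \<le> a" "0 \<le> b" and d: "0 < \<delta>" "\<delta> \<le> 1" "\<delta> \<le> max a b" and h: "0 < h"
  shows "\<bar>(\<integral>x. orthant_weight a b (x + v) \<partial>\<mu>) - (\<integral>x. orthant_weight a b x \<partial>\<mu>)\<bar>
     \<le> (8 * measure \<mu> UNIV + 4 * c) / \<delta> ^ 5 * log_factor h * min 1 (h + norm v)"
proof -
  let ?m = "measure \<mu> UNIV" and ?g = "orthant_weight a b"
  \<comment> \<open>Widening the strips by \<open>h\<close> gives a positive width also for
    \<open>v = 0\<close> and bounds the logarithmic factor by its value at \<open>h\<close>,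
    uniformly in \<open>v\<close>.\<close>
  define t where "t = h + norm v"
  have t: "0 < t" "h \<le> t" "norm v \<le> t" using h by (auto simp: t_def add_pos_nonneg)
  define A where "A = {x::real\<times>real. \<bar>fst x - a\<bar> \<le> t}"
  define B where "B = {x::real\<times>real. \<bar>snd x - b\<bar> \<le> t}"
  have [measurable]: "A \<in> sets borel" "B \<in> sets borel"
    unfolding A_def B_def by measurable
  have d4: "0 < \<delta> ^ 4" "0 < \<delta> ^ 5" using d by auto
  have d54: "1 / \<delta> ^ 4 \<le> 1 / \<delta> ^ 5"
    using d by (intro divide_left_mono power_decreasing) auto
  have g1: "\<bar>?g x - ?g y\<bar> \<le> 1 / \<delta> ^ 4" for x y
    using orthant_weight_le[OF ab d(1,3)] orthant_weight_nonneg[of a b]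
    by (smt (verit))
  have pw: "\<bar>?g (x + v) - ?g x\<bar> \<le> 8 / \<delta> ^ 5 * norm v + 1 / \<delta> ^ 4 * (indicator A x + indicator B x)" for x
  proof (cases "x \<in> orthant a b \<longleftrightarrow> x + v \<in> orthant a b")
    case True
    have "\<bar>?g (x + v) - ?g x\<bar> \<le> 8 / \<delta> ^ 5 * norm v"
    proof (cases "x \<in> orthant a b")
      case in1: True
      then have "x + v \<in> orthant a b" using True by simp
      from quartic_weight_inverse_lipschitz[OF in1 this ab d(1,3)]
      show ?thesis using in1 \<open>x + v \<in> orthant a b\<close> by (simp add: orthant_weight_def)
    next
      case False
      then show ?thesis using True d by (simp add: orthant_weight_def)
    qed
    moreover have "0 \<le> 1 / \<delta> ^ 4 * (indicator A x + indicator B x :: real)" using d by simp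
    ultimately show ?thesis by linarith
  next
    case False
    have "\<bar>fst v\<bar> \<le> t" "\<bar>snd v\<bar> \<le> t"
      using norm_fst_le[of "fst v" "snd v"] norm_snd_le[of "snd v" "fst v"] t by auto
    then have "x \<in> A \<or> x \<in> B"
      using False by (cases x; cases v) (auto simp: A_def B_def)
    then have "1 \<le> (indicator A x + indicator B x :: real)" by (auto simp: indicator_def)
    then have "1 / \<delta> ^ 4 * 1 \<le> 1 / \<delta> ^ 4 * (indicator A x + indicator B x)"
      using d by (intro mult_left_mono) auto
    moreover have "0 \<le> 8 / \<delta> ^ 5 * norm v" using d by simp
    ultimately show ?thesis using g1[of "x + v" x] by linarith
  qed
  have gi: "integrable \<mu> (\<lambda>x. ?g (x + v))" "integrable \<mu> ?g"
    using orthant_weight_mu_integrable[OF ab d(1,3), of v] orthant_weight_mu_integrable[OF ab d(1,3), of 0] by simp_all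
  have ii: "integrable \<mu> (indicator A :: _ \<Rightarrow> real)" "integrable \<mu> (indicator B :: _ \<Rightarrow> real)"
    by (auto intro!: integrable_const_bound[where B=1] simp: indicator_def)
  have eq: "(\<integral>x. ?g (x + v) \<partial>\<mu>) - (\<integral>x. ?g x \<partial>\<mu>) = (\<integral>x. ?g (x + v) - ?g x \<partial>\<mu>)"
    using gi by simp
  have l1: "1 \<le> log_factor h" using log_factor_ge_1[OF h] .
  have m0: "0 \<le> ?m" by simp
  have "norm (\<integral>x. ?g (x + v) - ?g x \<partial>\<mu>) \<le> (\<integral>x. 8 / \<delta> ^ 5 * norm v + 1 / \<delta> ^ 4 * (indicator A x + indicator B x) \<partial>\<mu>)"
    using pw ii by (intro norm_integral_le) auto
  also have "\<dots> = 8 / \<delta> ^ 5 * norm v * ?m + 1 / \<delta> ^ 4 * (measure \<mu> A + measure \<mu> B)"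
    using ii by (simp add: mult.commute)
  also have "\<dots> \<le> 8 / \<delta> ^ 5 * (t * log_factor h) * ?m + 1 / \<delta> ^ 5 * (4 * c * (t * log_factor h))"
  proof (intro add_mono mult_right_mono mult_mono)
    have "t * 1 \<le> t * log_factor h" using l1 t by (intro mult_left_mono) auto
    then show "norm v \<le> t * log_factor h" using t by linarith
    have "t * log_factor t \<le> t * log_factor h" using log_factor_antimono[OF h t(2)] t by (intro mult_left_mono) auto
    then have "2 * c * (t * log_factor t) \<le> 2 * c * (t * log_factor h)" by (rule mult_left_mono) (use c_nonneg in simp)
    then show "measure \<mu> A + measure \<mu> B \<le> 4 * c * (t * log_factor h)"
      using strip_measure_le[OF t(1), of a] strip_measure_le[OF t(1), of b] by (simp add: A_def B_def)
  qed (use d d54 m0 in auto)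
  also have "\<dots> = (8 * ?m + 4 * c) / \<delta> ^ 5 * log_factor h * t" by (simp add: add_divide_distrib algebra_simps)
  finally have b1: "norm (\<integral>x. ?g (x + v) - ?g x \<partial>\<mu>) \<le> (8 * ?m + 4 * c) / \<delta> ^ 5 * log_factor h * t" .
  \<comment> \<open>Trivial bound for large shifts, enlarged so that it shares its constant with the
    first bound.\<close>
  have "norm (\<integral>x. ?g (x + v) - ?g x \<partial>\<mu>) \<le> (\<integral>x. 1 / \<delta> ^ 4 \<partial>\<mu>)"
    using g1 by (intro norm_integral_le) auto
  also have "\<dots> = 1 / \<delta> ^ 4 * ?m" by simp
  also have "\<dots> \<le> 1 / \<delta> ^ 5 * (8 * ?m + 4 * c)"
    using d54 d m0 c_nonneg by (intro mult_mono) auto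
  also have "\<dots> \<le> 1 / \<delta> ^ 5 * (8 * ?m + 4 * c) * log_factor h"
    using mult_left_mono[OF l1, of "1 / \<delta> ^ 5 * (8 * ?m + 4 * c)"] d c_nonneg by simp
  finally have b2: "norm (\<integral>x. ?g (x + v) - ?g x \<partial>\<mu>) \<le> (8 * ?m + 4 * c) / \<delta> ^ 5 * log_factor h * 1" by simp
  show ?thesis unfolding eq using b1 b2 by (auto simp: min_def t_def)
qed

end

lemma fourier_scaled_kernel:
  assumes [measurable]: "K \<in> borel_measurable borel" and h: "0 < h"
  shows "fourier (\<lambda>z. complex_of_real (scaled_kernel K h z)) u = fourier (\<lambda>z. complex_of_real (K z)) (h *\<^sub>R u)"
proof -
  have [measurable]: "(\<lambda>x. iexp (u \<bullet> x) * complex_of_real (scaled_kernel K h x)) \<in> borel_measurable borel"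
    unfolding scaled_kernel_def by measurable
  have "fourier (\<lambda>z. complex_of_real (scaled_kernel K h z)) u =
     (h * h) *\<^sub>R (\<integral>x. iexp (u \<bullet> (h *\<^sub>R x)) * complex_of_real (scaled_kernel K h (h *\<^sub>R x)) \<partial>lborel)"
    unfolding fourier_def using h
    by (subst lborel_integral_affine(1)[of h _ 0]) (auto simp: power2_eq_square)
  also have "\<dots> = (\<integral>x. (h * h) *\<^sub>R (iexp (u \<bullet> (h *\<^sub>R x)) * complex_of_real (scaled_kernel K h (h *\<^sub>R x))) \<partial>lborel)"
    by simp
  also have "\<dots> = fourier (\<lambda>z. complex_of_real (K z)) (h *\<^sub>R u)"
    unfolding fourier_def using h
    by (intro Bochner_Integration.integral_cong refl)
       (simp add: scaled_kernel_def power2_eq_square scaleR_conv_of_real)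
  finally show ?thesis .
qed

context decaying_measure
begin

text \<open>The inverse transform is replaced by its Gaussian regularisation. Integrating out
  \<open>\<mu>\<close> first turns that into an average of shift differences over the kernel law and
  a Gaussian of width \<open>\<epsilon>\<close>. The bound is uniform in \<open>\<epsilon>\<close>
  up to a vanishing term and passes to the limit.\<close>

lemma smoothing_bias_le:
  assumes "prob_space \<kappa>" and [measurable_cong, simp]: "sets \<kappa> = sets (borel :: (real \<times> real) measure)"
    and lip: "\<And>u. cmod (1 - fourier_measure \<kappa> u) \<le> L * norm u"
    and ab: "0 \<le> a" "0 \<le> b" and d: "0 < \<delta>" "\<delta> \<le> 1" "\<delta> \<le> max a b" and h: "0 < h" "h \<le> 1"
    and Fint: "integrable lborel (\<lambda>u. fourier_measure \<mu> u * fourier_measure \<kappa> (h *\<^sub>R u))"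
  shows "cmod ((\<integral>y. complex_of_real (orthant_weight a b y) *
        inv_fourier (\<lambda>u. fourier_measure \<mu> u * fourier_measure \<kappa> (h *\<^sub>R u)) y \<partial>lborel)
        - complex_of_real (\<integral>x. orthant_weight a b x \<partial>\<mu>))
     \<le> (8 * measure \<mu> UNIV + 4 * c) * (3 + 6 * L) * (h * (log_factor h)\<^sup>2 / \<delta> ^ 5)"
proof -
  interpret k: prob_space \<kappa> by fact
  interpret G: prob_space gauss2 by (rule prob_space_gauss2)
  interpret MK: pair_sigma_finite \<mu> \<kappa> ..
  interpret MG: pair_sigma_finite \<mu> gauss2 ..
  interpret MKf: finite_measure "\<mu> \<Otimes>\<^sub>M \<kappa>" by (rule finite_measure_pair_measure) unfold_locales
  interpret MGf: finite_measure "\<mu> \<Otimes>\<^sub>M gauss2" by (rule finite_measure_pair_measure) unfold_locales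
  have [simp]: "space \<kappa> = UNIV" using sets_eq_imp_space_eq[of \<kappa> borel] by simp
  have k1: "k.prob UNIV = 1" using k.prob_space by simp
  have G1: "G.prob UNIV = 1" using G.prob_space by simp
  let ?g = "orthant_weight a b"
  \<comment> \<open>Convolution of \<open>\<mu>\<close> with the kernel law scaled by
    \<open>h\<close>, realised as the image of a product measure; its transform is the given
    product.\<close>
  define \<theta> where "\<theta> = distr (\<mu> \<Otimes>\<^sub>M \<kappa>) borel (\<lambda>p. fst p + h *\<^sub>R snd p)"
  have \<theta>_fin: "finite_measure \<theta>"
    unfolding \<theta>_def by (rule MKf.finite_measure_distr) measurable
  have \<theta>_sets: "sets \<theta> = sets borel" by (simp add: \<theta>_def)
  have L0: "0 \<le> L" using order_trans[OF norm_ge_zero lip[of "(1, 0)"]] by simp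
  have F\<theta>: "fourier_measure \<theta> = (\<lambda>u. fourier_measure \<mu> u * fourier_measure \<kappa> (h *\<^sub>R u))"
  proof
    fix u
    have i: "integrable \<mu> (\<lambda>x. iexp (u \<bullet> x))" "integrable \<kappa> (\<lambda>x. iexp ((h *\<^sub>R u) \<bullet> x))"
      by (auto intro!: integrable_const_bound[where B=1] k.integrable_const_bound[where B=1])
    have "fourier_measure \<theta> u = (\<integral>p. iexp (u \<bullet> fst p) * iexp ((h *\<^sub>R u) \<bullet> snd p) \<partial>(\<mu> \<Otimes>\<^sub>M \<kappa>))"
      unfolding fourier_measure_def \<theta>_def
      by (subst integral_distr) (auto simp: inner_add_right distrib_left exp_add)
    also have "\<dots> = fourier_measure \<mu> u * fourier_measure \<kappa> (h *\<^sub>R u)"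
      unfolding fourier_measure_def by (rule prod_integral_mult(2)[OF _ _ i]) unfold_locales
    finally show "fourier_measure \<theta> u = fourier_measure \<mu> u * fourier_measure \<kappa> (h *\<^sub>R u)" .
  qed
  have gi: "integrable lborel ?g" by (rule orthant_weight_integrable(1)[OF ab d])
  define N where "N = (\<lambda>v. \<integral>x. ?g (x + v) \<partial>\<mu>)"
  have [measurable]: "N \<in> borel_measurable borel" unfolding N_def by measurable
  define D where "D = (8 * measure \<mu> UNIV + 4 * c) / \<delta> ^ 5 * log_factor h"
  have D0: "0 \<le> D" using c_nonneg d log_factor_ge_1[OF h(1)] by (auto simp: D_def intro!: mult_nonneg_nonneg)
  have Nd: "\<bar>N v - N 0\<bar> \<le> D * min 1 (h + norm v)" for v
    using shift_difference_le[OF ab d h(1), of v] by (simp add: N_def D_def)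
  define kk where "kk = (\<integral>z. norm z \<partial>gauss2)"
  define mm where "mm = (\<integral>z. min 1 (h * norm z) \<partial>\<kappa>)"
  have g_bd: "\<bar>?g x\<bar> \<le> 1 / \<delta> ^ 4" for x
    using orthant_weight_le[OF ab d(1,3), of x] orthant_weight_nonneg[of a b x] by simp
  have mmi: "integrable \<kappa> (\<lambda>z. min 1 (h * norm z))"
    using h by (intro k.integrable_const_bound[where B=1]) auto
  \<comment> \<open>\<open>mm\<close> is the truncated mean of the kernel law and \<open>kk\<close>
    the mean norm of the Gaussian. Subadditivity of the truncation separates the shift
    \<open>h v + \<epsilon> z\<close> into its two parts.\<close>
  have approx: "\<bar>(\<integral>x. (\<integral>z. ?g (x + \<epsilon> *\<^sub>R z) \<partial>gauss2) \<partial>\<theta>) - N 0\<bar> \<le> D * (h + mm + \<epsilon> * kk)" if e: "0 < \<epsilon>" for \<epsilon>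
  proof -
    have m1[measurable]: "(\<lambda>x. \<integral>z. ?g (x + \<epsilon> *\<^sub>R z) \<partial>gauss2) \<in> borel_measurable borel" by measurable
    have "\<bar>\<integral>z. ?g (x + \<epsilon> *\<^sub>R z) \<partial>gauss2\<bar> \<le> 1 / \<delta> ^ 4" for x
    proof -
      have "norm (\<integral>z. ?g (x + \<epsilon> *\<^sub>R z) \<partial>gauss2) \<le> (\<integral>z. 1 / \<delta> ^ 4 \<partial>gauss2)"
        using g_bd by (intro norm_integral_le) auto
      then show ?thesis by (simp add: G1)
    qed
    then have i1: "integrable (\<mu> \<Otimes>\<^sub>M \<kappa>) (\<lambda>p. \<integral>z. ?g (fst p + h *\<^sub>R snd p + \<epsilon> *\<^sub>R z) \<partial>gauss2)"
      by (intro MKf.integrable_const_bound[where B="1 / \<delta> ^ 4"]) auto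
    have "(\<integral>x. (\<integral>z. ?g (x + \<epsilon> *\<^sub>R z) \<partial>gauss2) \<partial>\<theta>) =
      (\<integral>p. (\<integral>z. ?g (fst p + h *\<^sub>R snd p + \<epsilon> *\<^sub>R z) \<partial>gauss2) \<partial>(\<mu> \<Otimes>\<^sub>M \<kappa>))"
      unfolding \<theta>_def by (subst integral_distr) auto
    also have "\<dots> = (\<integral>v. (\<integral>x. (\<integral>z. ?g (x + h *\<^sub>R v + \<epsilon> *\<^sub>R z) \<partial>gauss2) \<partial>\<mu>) \<partial>\<kappa>)"
      using MK.integral_snd[of "\<lambda>x v. \<integral>z. ?g (x + h *\<^sub>R v + \<epsilon> *\<^sub>R z) \<partial>gauss2"] i1
      by (simp add: case_prod_beta')
    also have "\<dots> = (\<integral>v. (\<integral>z. N (h *\<^sub>R v + \<epsilon> *\<^sub>R z) \<partial>gauss2) \<partial>\<kappa>)"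
    proof (rule Bochner_Integration.integral_cong[OF refl])
      fix v
      have "integrable (\<mu> \<Otimes>\<^sub>M gauss2) (\<lambda>(x, z). ?g (x + h *\<^sub>R v + \<epsilon> *\<^sub>R z))"
        using g_bd by (intro MGf.integrable_const_bound[where B="1 / \<delta> ^ 4"]) (auto simp: case_prod_beta)
      from MG.Fubini_integral[OF this]
      show "(\<integral>x. (\<integral>z. ?g (x + h *\<^sub>R v + \<epsilon> *\<^sub>R z) \<partial>gauss2) \<partial>\<mu>) = (\<integral>z. N (h *\<^sub>R v + \<epsilon> *\<^sub>R z) \<partial>gauss2)"
        by (simp add: N_def add.assoc)
    qed
    finally have e1: "(\<integral>x. (\<integral>z. ?g (x + \<epsilon> *\<^sub>R z) \<partial>gauss2) \<partial>\<theta>) = (\<integral>v. (\<integral>z. N (h *\<^sub>R v + \<epsilon> *\<^sub>R z) \<partial>gauss2) \<partial>\<kappa>)" .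
    have bN: "norm (N v) \<le> \<bar>N 0\<bar> + D" for v
    proof -
      have "D * min 1 (h + norm v) \<le> D * 1" using D0 by (intro mult_left_mono) auto
      then show ?thesis using Nd[of v] by simp
    qed
    have iN: "integrable gauss2 (\<lambda>z. N (h *\<^sub>R v + \<epsilon> *\<^sub>R z))" for v
      using bN by (intro G.integrable_const_bound[where B="\<bar>N 0\<bar> + D"]) auto
    have inner: "\<bar>(\<integral>z. N (h *\<^sub>R v + \<epsilon> *\<^sub>R z) \<partial>gauss2) - N 0\<bar> \<le> D * (h + min 1 (h * norm v) + \<epsilon> * kk)" for v
    proof -
      have "(\<integral>z. N (h *\<^sub>R v + \<epsilon> *\<^sub>R z) \<partial>gauss2) - N 0 = (\<integral>z. N (h *\<^sub>R v + \<epsilon> *\<^sub>R z) - N 0 \<partial>gauss2)"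
        using iN by (simp add: G1)
      also have "norm \<dots> \<le> (\<integral>z. D * (h + min 1 (h * norm v) + \<epsilon> * norm z) \<partial>gauss2)"
      proof (rule norm_integral_le)
        show "integrable gauss2 (\<lambda>z. D * (h + min 1 (h * norm v) + \<epsilon> * norm z))"
          using gauss2_norm_integrable by simp
        show "AE z in gauss2. norm (N (h *\<^sub>R v + \<epsilon> *\<^sub>R z) - N 0) \<le> D * (h + min 1 (h * norm v) + \<epsilon> * norm z)"
        proof (rule AE_I2)
          fix z :: "real \<times> real"
          have "norm (h *\<^sub>R v + \<epsilon> *\<^sub>R z) \<le> h * norm v + \<epsilon> * norm z"
            using norm_triangle_ineq[of "h *\<^sub>R v" "\<epsilon> *\<^sub>R z"] h e by simp
          then have "min 1 (h + norm (h *\<^sub>R v + \<epsilon> *\<^sub>R z)) \<le> h + min 1 (h * norm v) + \<epsilon> * norm z"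
          proof -
            assume "norm (h *\<^sub>R v + \<epsilon> *\<^sub>R z) \<le> h * norm v + \<epsilon> * norm z"
            moreover have "0 \<le> \<epsilon> * norm z" using e by simp
            ultimately show ?thesis using h by linarith
          qed
          then have "D * min 1 (h + norm (h *\<^sub>R v + \<epsilon> *\<^sub>R z)) \<le> D * (h + min 1 (h * norm v) + \<epsilon> * norm z)"
            using D0 by (rule mult_left_mono)
          then show "norm (N (h *\<^sub>R v + \<epsilon> *\<^sub>R z) - N 0) \<le> D * (h + min 1 (h * norm v) + \<epsilon> * norm z)"
            using Nd[of "h *\<^sub>R v + \<epsilon> *\<^sub>R z"] by simp
        qed
      qed
      also have "\<dots> = D * (h + min 1 (h * norm v) + \<epsilon> * kk)"
        using gauss2_norm_integrable G1 by (simp add: kk_def)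
      finally show ?thesis by simp
    qed
    have i2: "integrable \<kappa> (\<lambda>v. \<integral>z. N (h *\<^sub>R v + \<epsilon> *\<^sub>R z) \<partial>gauss2)"
    proof (rule k.integrable_const_bound[where B="\<bar>N 0\<bar> + D"])
      have "norm (\<integral>z. N (h *\<^sub>R v + \<epsilon> *\<^sub>R z) \<partial>gauss2) \<le> (\<integral>z. \<bar>N 0\<bar> + D \<partial>gauss2)" for v
        using bN by (intro norm_integral_le) auto
      then show "AE v in \<kappa>. norm (\<integral>z. N (h *\<^sub>R v + \<epsilon> *\<^sub>R z) \<partial>gauss2) \<le> \<bar>N 0\<bar> + D"
        by (simp add: G1)
    qed measurable
    have "(\<integral>v. (\<integral>z. N (h *\<^sub>R v + \<epsilon> *\<^sub>R z) \<partial>gauss2) \<partial>\<kappa>) - N 0 =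
       (\<integral>v. (\<integral>z. N (h *\<^sub>R v + \<epsilon> *\<^sub>R z) \<partial>gauss2) - N 0 \<partial>\<kappa>)"
      using i2 by (simp add: k1)
    also have "norm \<dots> \<le> (\<integral>v. D * (h + min 1 (h * norm v) + \<epsilon> * kk) \<partial>\<kappa>)"
      using inner mmi by (intro norm_integral_le) auto
    also have "\<dots> = D * (h + mm + \<epsilon> * kk)" using mmi by (simp add: mm_def k1)
    finally show ?thesis unfolding e1 by simp
  qed
  let ?I = "\<integral>y. complex_of_real (?g y) * inv_fourier (fourier_measure \<theta>) y \<partial>lborel"
  have lim: "(\<lambda>m. complex_of_real (\<integral>x. (\<integral>z. ?g (x + (1 / real (Suc m)) *\<^sub>R z) \<partial>gauss2) \<partial>\<theta>)) \<longlonglongrightarrow> ?I"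
    by (rule fourier_inversion_limit[OF \<theta>_fin \<theta>_sets _ gi]) (use Fint in \<open>simp add: F\<theta>\<close>)
  then have lim': "(\<lambda>m. cmod (complex_of_real (\<integral>x. (\<integral>z. ?g (x + (1 / real (Suc m)) *\<^sub>R z) \<partial>gauss2) \<partial>\<theta>) - complex_of_real (N 0)))
     \<longlonglongrightarrow> cmod (?I - complex_of_real (N 0))"
    by (intro tendsto_intros)
  have "(\<lambda>m. 1 / real (Suc m)) \<longlonglongrightarrow> 0"
    using LIMSEQ_inverse_real_of_nat by (simp add: inverse_eq_divide)
  then have "(\<lambda>m. D * (h + mm + (1 / real (Suc m)) * kk)) \<longlonglongrightarrow> D * (h + mm + 0 * kk)"
    by (intro tendsto_intros)
  then have lim2: "(\<lambda>m. D * (h + mm + (1 / real (Suc m)) * kk)) \<longlonglongrightarrow> D * (h + mm)" by simp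
  have "cmod (?I - complex_of_real (N 0)) \<le> D * (h + mm)"
  proof (rule LIMSEQ_le[OF lim' lim2], intro exI[of _ 0] allI impI)
    fix m :: nat
    have "cmod (complex_of_real (\<integral>x. (\<integral>z. ?g (x + (1 / real (Suc m)) *\<^sub>R z) \<partial>gauss2) \<partial>\<theta>) - complex_of_real (N 0))
      = \<bar>(\<integral>x. (\<integral>z. ?g (x + (1 / real (Suc m)) *\<^sub>R z) \<partial>gauss2) \<partial>\<theta>) - N 0\<bar>"
      by (simp only: of_real_diff[symmetric] norm_of_real)
    also have "\<dots> \<le> D * (h + mm + (1 / real (Suc m)) * kk)" by (rule approx) simp
    finally show "cmod (complex_of_real (\<integral>x. (\<integral>z. ?g (x + (1 / real (Suc m)) *\<^sub>R z) \<partial>gauss2) \<partial>\<theta>) - complex_of_real (N 0))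
      \<le> D * (h + mm + (1 / real (Suc m)) * kk)" .
  qed
  also have "\<dots> \<le> D * (h * (3 + 6 * L) * log_factor h)"
  proof (intro mult_left_mono D0)
    have p: "prob_space (distr \<kappa> borel fst)" "prob_space (distr \<kappa> borel snd)"
      by (auto intro!: k.prob_space_distr)
    have l: "cmod (1 - char (distr \<kappa> borel fst) s) \<le> L * \<bar>s\<bar>" "cmod (1 - char (distr \<kappa> borel snd) s) \<le> L * \<bar>s\<bar>" for s
      using lip[of "(s, 0)"] lip[of "(0, s)"] by (simp_all add: char_distr_fst norm_prod_def)
    have j: "integrable \<kappa> (\<lambda>z. min 1 (h * \<bar>fst z\<bar>))" "integrable \<kappa> (\<lambda>z. min 1 (h * \<bar>snd z\<bar>))"
      using h by (auto intro!: k.integrable_const_bound[where B=1])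
    \<comment> \<open>Splitting the norm into coordinates reduces the truncated mean to the two
      marginal laws. Each contributes \<open>1 + 3 * L\<close>; together with the summand
      \<open>h\<close> this gives \<open>3 + 6 * L\<close>.\<close>
    have "mm \<le> (\<integral>z. min 1 (h * \<bar>fst z\<bar>) + min 1 (h * \<bar>snd z\<bar>) \<partial>\<kappa>)"
      unfolding mm_def
    proof (rule integral_mono[OF mmi])
      fix z :: "real \<times> real"
      have "norm z \<le> \<bar>fst z\<bar> + \<bar>snd z\<bar>" using norm_Pair_le[of "fst z" "snd z"] by simp
      then have "h * norm z \<le> h * \<bar>fst z\<bar> + h * \<bar>snd z\<bar>"
        using h by (simp add: mult_left_mono flip: distrib_left)
      moreover have "0 \<le> h * \<bar>fst z\<bar>" "0 \<le> h * \<bar>snd z\<bar>" using h by auto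
      ultimately show "min 1 (h * norm z) \<le> min 1 (h * \<bar>fst z\<bar>) + min 1 (h * \<bar>snd z\<bar>)"
        by (auto simp: min_def)
    qed (use j in auto)
    also have "\<dots> = (\<integral>x. min 1 (h * \<bar>x\<bar>) \<partial>distr \<kappa> borel fst) + (\<integral>x. min 1 (h * \<bar>x\<bar>) \<partial>distr \<kappa> borel snd)"
      using j by (simp add: integral_distr)
    also have "\<dots> \<le> h * (1 + 3 * L) * log_factor h + h * (1 + 3 * L) * log_factor h"
      using truncated_mean_le_char_lipschitz[OF p(1) _ h l(1)] truncated_mean_le_char_lipschitz[OF p(2) _ h l(2)]
      by (intro add_mono) (auto simp: log_factor_def)
    finally have "mm \<le> h * (2 + 6 * L) * log_factor h" by (simp add: algebra_simps)
    moreover have "h * 1 \<le> h * log_factor h" using log_factor_ge_1[OF h(1)] h by (intro mult_left_mono) auto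
    ultimately show "h + mm \<le> h * (3 + 6 * L) * log_factor h" by (simp add: algebra_simps)
  qed
  also have "\<dots> = (8 * measure \<mu> UNIV + 4 * c) * (3 + 6 * L) * (h * (log_factor h)\<^sup>2 / \<delta> ^ 5)"
    by (simp add: D_def power2_eq_square)
  finally show ?thesis by (simp add: F\<theta> N_def)
qed

end

section \<open>Moments and cumulants from the characteristic function\<close>

lemma partial_deriv_eqI:
  "((\<lambda>s. f (u + s *\<^sub>R e)) has_vector_derivative d) (at 0) \<Longrightarrow> partial_deriv e f u = d"
  unfolding partial_deriv_def by (rule vector_derivative_at)

text \<open>Differentiation under the integral sign with an explicit quadratic remainder in place of
  dominated convergence; every use has such a remainder from the Taylor bound for
  \<open>iexp\<close>.\<close>

lemma has_vector_derivative_integral: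
  fixes F :: "real \<Rightarrow> 'a \<Rightarrow> complex"
  assumes F: "\<And>s. integrable P (F s)" and D: "integrable P D" and H: "integrable P H"
    and le: "\<And>s x. cmod (F s x - F 0 x - complex_of_real s * D x) \<le> s\<^sup>2 * H x"
  shows "((\<lambda>s. integral\<^sup>L P (F s)) has_vector_derivative integral\<^sup>L P D) (at 0)"
  unfolding has_vector_derivative_def
proof (rule has_derivativeI_sandwich[where e=1 and H="\<lambda>s. \<bar>s\<bar> * integral\<^sup>L P H"])
  show "bounded_linear (\<lambda>x. x *\<^sub>R integral\<^sup>L P D)" by (rule bounded_linear_scaleR_left)
  show "((\<lambda>s. \<bar>s\<bar> * integral\<^sup>L P H) \<longlongrightarrow> 0) (at 0)"
    by (auto intro!: tendsto_eq_intros)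
  fix s :: real assume "s \<noteq> 0"
  have "integral\<^sup>L P (F s) - integral\<^sup>L P (F 0) - s *\<^sub>R integral\<^sup>L P D
      = (\<integral>x. F s x - F 0 x - complex_of_real s * D x \<partial>P)"
    using F D by (simp add: scaleR_conv_of_real)
  also have "norm \<dots> \<le> (\<integral>x. s\<^sup>2 * H x \<partial>P)"
    using H le by (intro norm_integral_le) auto
  also have "\<dots> = s\<^sup>2 * integral\<^sup>L P H" by simp
  finally show "norm (integral\<^sup>L P (F s) - integral\<^sup>L P (F 0) - (s - 0) *\<^sub>R integral\<^sup>L P D) / norm (s - 0)
      \<le> \<bar>s\<bar> * integral\<^sup>L P H"
    using \<open>s \<noteq> 0\<close> by (simp add: field_simps power2_eq_square abs_mult_self_eq flip: abs_mult)
qed auto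

text \<open>The \<open>j\<close>-th derivative of the Fourier transform in direction
  \<open>e\<close>. For a Levy measure it is used with \<open>j \<ge> 2\<close>, where small jumps
  do not spoil integrability.\<close>

definition fourier_moment :: "'a::euclidean_space measure \<Rightarrow> 'a \<Rightarrow> nat \<Rightarrow> 'a \<Rightarrow> complex" where
  "fourier_moment P e j u = (\<integral>x. (\<i> * complex_of_real (e \<bullet> x)) ^ j * iexp (u \<bullet> x) \<partial>P)"

lemma iexp_second_order: "cmod (iexp t - 1 - \<i> * complex_of_real t) \<le> t\<^sup>2 / 2"
  using iexp_approx1[of t 1] by (simp add: power2_eq_square diff_diff_eq)

lemma iexp_inner_add:
  "iexp ((u + s *\<^sub>R e) \<bullet> x) = iexp (u \<bullet> x) * iexp (s * (e \<bullet> x))"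
  by (simp add: inner_add_left distrib_left exp_add)

text \<open>The moment of order \<open>j + 2\<close> pays for the quadratic remainder. Fourth
  derivatives start from \<open>j \<le> 3\<close> and thus take moments up to order five.\<close>

lemma fourier_moment_has_derivative:
  fixes P :: "'a::euclidean_space measure"
  assumes [measurable_cong]: "sets P = sets borel"
    and j0: "integrable P (\<lambda>x. \<bar>e \<bullet> x\<bar> ^ j)" and j1: "integrable P (\<lambda>x. \<bar>e \<bullet> x\<bar> ^ Suc j)"
    and j2: "integrable P (\<lambda>x. \<bar>e \<bullet> x\<bar> ^ (j + 2))"
  shows "((\<lambda>s. fourier_moment P e j (u + s *\<^sub>R e)) has_vector_derivative fourier_moment P e (Suc j) u) (at 0)"
  unfolding fourier_moment_def
proof (rule has_vector_derivative_integral)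
  show "integrable P (\<lambda>x. (\<i> * complex_of_real (e \<bullet> x)) ^ j * iexp ((u + s *\<^sub>R e) \<bullet> x))" for s
    by (rule Bochner_Integration.integrable_bound[OF j0]) (auto simp: norm_mult norm_power)
  show "integrable P (\<lambda>x. (\<i> * complex_of_real (e \<bullet> x)) ^ Suc j * iexp (u \<bullet> x))"
    by (rule Bochner_Integration.integrable_bound[OF j1]) (auto simp: norm_mult norm_power)
  show "integrable P (\<lambda>x. \<bar>e \<bullet> x\<bar> ^ (j + 2) / 2)" using j2 by simp
  fix s x
  have "(\<i> * complex_of_real (e \<bullet> x)) ^ j * iexp ((u + s *\<^sub>R e) \<bullet> x) -
        (\<i> * complex_of_real (e \<bullet> x)) ^ j * iexp ((u + 0 *\<^sub>R e) \<bullet> x) -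
        complex_of_real s * ((\<i> * complex_of_real (e \<bullet> x)) ^ Suc j * iexp (u \<bullet> x))
     = (\<i> * complex_of_real (e \<bullet> x)) ^ j * iexp (u \<bullet> x) * (iexp (s * (e \<bullet> x)) - 1 - \<i> * complex_of_real (s * (e \<bullet> x)))"
    unfolding iexp_inner_add by (simp add: algebra_simps)
  also have "cmod \<dots> = \<bar>e \<bullet> x\<bar> ^ j * cmod (iexp (s * (e \<bullet> x)) - 1 - \<i> * complex_of_real (s * (e \<bullet> x)))"
    by (simp add: norm_mult norm_power)
  also have "\<dots> \<le> \<bar>e \<bullet> x\<bar> ^ j * ((s * (e \<bullet> x))\<^sup>2 / 2)"
    by (intro mult_left_mono iexp_second_order) simp
  also have "\<dots> = s\<^sup>2 * (\<bar>e \<bullet> x\<bar> ^ (j + 2) / 2)"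
    by (simp add: power_mult_distrib power_add power2_eq_square)
  finally show "cmod ((\<i> * complex_of_real (e \<bullet> x)) ^ j * iexp ((u + s *\<^sub>R e) \<bullet> x) -
        (\<i> * complex_of_real (e \<bullet> x)) ^ j * iexp ((u + 0 *\<^sub>R e) \<bullet> x) -
        complex_of_real s * ((\<i> * complex_of_real (e \<bullet> x)) ^ Suc j * iexp (u \<bullet> x)))
     \<le> s\<^sup>2 * (\<bar>e \<bullet> x\<bar> ^ (j + 2) / 2)" .
qed

lemma partial_deriv_iter_fourier_measure:
  fixes P :: "'a::euclidean_space measure"
  assumes "sets P = sets borel" and "\<And>k. k \<le> N + 1 \<Longrightarrow> integrable P (\<lambda>x. \<bar>e \<bullet> x\<bar> ^ k)"
    and "j \<le> N"
  shows "(partial_deriv e ^^ j) (fourier_measure P) = fourier_moment P e j"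
  using assms(3)
proof (induction j)
  case 0
  show ?case by (auto simp: fourier_measure_def fourier_moment_def)
next
  case (Suc j)
  have "partial_deriv e (fourier_moment P e j) = fourier_moment P e (Suc j)"
    using Suc.prems by (intro ext partial_deriv_eqI fourier_moment_has_derivative assms) auto
  then show ?case using Suc by simp
qed

lemma partial_deriv_iter_ecf:
  "(partial_deriv e ^^ j) (ecf n x) =
     (\<lambda>u. (\<Sum>t=1..n. (\<i> * complex_of_real (e \<bullet> increment x t)) ^ j * iexp (u \<bullet> increment x t)) / of_nat n)"
proof (induction j)
  case 0
  show ?case by (auto simp: ecf_def)
next
  case (Suc j)
  have "((\<lambda>s. iexp ((u + s *\<^sub>R e) \<bullet> y)) has_vector_derivative
      \<i> * complex_of_real (e \<bullet> y) * iexp (u \<bullet> y)) (at 0)" for u y :: 'a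
  proof -
    have "((\<lambda>s. u \<bullet> y + s * (e \<bullet> y)) has_vector_derivative (e \<bullet> y)) (at 0)"
      by (auto intro!: derivative_eq_intros simp: has_vector_derivative_def)
    moreover have "(iexp has_vector_derivative \<i> * iexp (u \<bullet> y + 0 * (e \<bullet> y))) (at (u \<bullet> y + 0 * (e \<bullet> y)))"
      by (rule has_vector_derivative_iexp)
    ultimately have "(iexp \<circ> (\<lambda>s. u \<bullet> y + s * (e \<bullet> y)) has_vector_derivative
        (e \<bullet> y) *\<^sub>R (\<i> * iexp (u \<bullet> y + 0 * (e \<bullet> y)))) (at 0)"
      by (rule vector_diff_chain_at)
    then show ?thesis by (simp add: o_def inner_add_left scaleR_conv_of_real mult_ac)
  qed
  note d = this
  have "partial_deriv e (\<lambda>u. (\<Sum>t=1..n. (\<i> * complex_of_real (e \<bullet> increment x t)) ^ j * iexp (u \<bullet> increment x t)) / of_nat n)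
     = (\<lambda>u. (\<Sum>t=1..n. (\<i> * complex_of_real (e \<bullet> increment x t)) ^ j *
         (\<i> * complex_of_real (e \<bullet> increment x t) * iexp (u \<bullet> increment x t))) / of_nat n)"
    by (intro ext partial_deriv_eqI)
       (intro has_vector_derivative_divide has_vector_derivative_sum has_vector_derivative_mult_right d)
  then show ?case using Suc by (simp add: mult_ac)
qed

text \<open>The derivatives of \<open>exp \<Psi>\<close> are \<open>exp \<Psi>\<close> times the
  complete Bell polynomials in \<open>\<Psi> 1, ..., \<Psi> 4\<close>. In the combination defining
  \<open>log_deriv4\<close> the exponentials and all terms except \<open>\<Psi> 4\<close> cancel.
  Passing the derivatives as a family lets each order be given by its own formula.\<close>

lemma log_deriv4_exp:
  fixes \<Psi> :: "nat \<Rightarrow> 'a::euclidean_space \<Rightarrow> complex"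
  assumes d: "\<And>j u. j < 4 \<Longrightarrow> ((\<lambda>s. \<Psi> j (u + s *\<^sub>R e)) has_vector_derivative \<Psi> (Suc j) u) (at 0)"
  shows "log_deriv4 e (\<lambda>u. exp (\<Psi> 0 u)) u = \<Psi> 4 u"
proof -
  let ?E = "\<lambda>u. exp (\<Psi> 0 u)"
  have dE: "((\<lambda>s. ?E (u + s *\<^sub>R e)) has_vector_derivative \<Psi> 1 u * ?E u) (at 0)" for u
  proof -
    have "(exp has_field_derivative ?E u) (at (\<Psi> 0 (u + 0 *\<^sub>R e)))"
      by (auto intro!: derivative_eq_intros)
    from field_vector_diff_chain_at[OF d[of 0 u] this]
    show ?thesis by (simp add: o_def)
  qed
  have d0: "((\<lambda>s. \<Psi> 1 (u + s *\<^sub>R e)) has_vector_derivative \<Psi> 2 u) (at 0)"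
       "((\<lambda>s. \<Psi> 2 (u + s *\<^sub>R e)) has_vector_derivative \<Psi> 3 u) (at 0)"
       "((\<lambda>s. \<Psi> 3 (u + s *\<^sub>R e)) has_vector_derivative \<Psi> 4 u) (at 0)" for u
    using d[of 1 u] d[of 2 u] d[of 3 u] by (simp_all add: eval_nat_numeral)
  have step: "partial_deriv e (\<lambda>u. A u * ?E u) u = (A' u + A u * \<Psi> 1 u) * ?E u"
    if "((\<lambda>s. A (u + s *\<^sub>R e)) has_vector_derivative A' u) (at 0)" for A A' u
    using has_vector_derivative_mult[OF that dE[of u]]
    by (intro partial_deriv_eqI) (simp add: algebra_simps)
  have p1: "partial_deriv e ?E = (\<lambda>u. \<Psi> 1 u * ?E u)"
    using dE by (auto intro!: partial_deriv_eqI)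
  have p2: "partial_deriv e (\<lambda>u. \<Psi> 1 u * ?E u) = (\<lambda>u. (\<Psi> 2 u + \<Psi> 1 u * \<Psi> 1 u) * ?E u)"
    by (intro ext step d0)
  \<comment> \<open>The product rule evaluates undifferentiated factors at
    \<open>u + 0 *\<^sub>R e\<close>; the bulky form matches the rule, and \<open>p3'\<close>
    restores the readable one.\<close>
  have p3: "partial_deriv e (\<lambda>u. (\<Psi> 2 u + \<Psi> 1 u * \<Psi> 1 u) * ?E u) =
     (\<lambda>u. ((\<Psi> 3 u + (\<Psi> 1 (u + 0 *\<^sub>R e) * \<Psi> 2 u + \<Psi> 2 u * \<Psi> 1 (u + 0 *\<^sub>R e))) + (\<Psi> 2 u + \<Psi> 1 u * \<Psi> 1 u) * \<Psi> 1 u) * ?E u)"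
    by (intro ext step has_vector_derivative_add has_vector_derivative_mult d0)
  have p3': "partial_deriv e (\<lambda>u. (\<Psi> 2 u + \<Psi> 1 u * \<Psi> 1 u) * ?E u) =
     (\<lambda>u. (\<Psi> 3 u + (3 * (\<Psi> 1 u * \<Psi> 2 u) + \<Psi> 1 u * (\<Psi> 1 u * \<Psi> 1 u))) * ?E u)"
    unfolding p3 by (auto simp: algebra_simps)
  have p4: "partial_deriv e (\<lambda>u. (\<Psi> 3 u + (3 * (\<Psi> 1 u * \<Psi> 2 u) + \<Psi> 1 u * (\<Psi> 1 u * \<Psi> 1 u))) * ?E u) =
     (\<lambda>u. ((\<Psi> 4 u + (3 * (\<Psi> 1 (u + 0 *\<^sub>R e) * \<Psi> 3 u + \<Psi> 2 u * \<Psi> 2 (u + 0 *\<^sub>R e)) +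
        (\<Psi> 1 (u + 0 *\<^sub>R e) * (\<Psi> 1 (u + 0 *\<^sub>R e) * \<Psi> 2 u + \<Psi> 2 u * \<Psi> 1 (u + 0 *\<^sub>R e)) +
          \<Psi> 2 u * (\<Psi> 1 (u + 0 *\<^sub>R e) * \<Psi> 1 (u + 0 *\<^sub>R e)))))
       + (\<Psi> 3 u + (3 * (\<Psi> 1 u * \<Psi> 2 u) + \<Psi> 1 u * (\<Psi> 1 u * \<Psi> 1 u))) * \<Psi> 1 u) * ?E u)"
    by (intro ext step has_vector_derivative_add has_vector_derivative_mult has_vector_derivative_mult_right d0)
  have n: "(4::nat) = Suc (Suc (Suc (Suc 0)))" "(3::nat) = Suc (Suc (Suc 0))" "(2::nat) = Suc (Suc 0)" by auto
  let ?d = "\<lambda>j. (partial_deriv e ^^ j) ?E u"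
  have D1: "?d 1 = \<Psi> 1 u * ?E u" using p1 by simp
  have D2: "?d 2 = (\<Psi> 2 u + \<Psi> 1 u * \<Psi> 1 u) * ?E u" unfolding n(3) using p1 p2 by (simp add: numeral_2_eq_2)
  have D3: "?d 3 = (\<Psi> 3 u + (3 * (\<Psi> 1 u * \<Psi> 2 u) + \<Psi> 1 u * (\<Psi> 1 u * \<Psi> 1 u))) * ?E u"
    by (subst n(2)) (simp only: funpow.simps o_apply id_apply p1 p2 p3')
  have D4: "?d 4 = (\<Psi> 4 u + (3 * (\<Psi> 1 u * \<Psi> 3 u + \<Psi> 2 u * \<Psi> 2 u) + 3 * (\<Psi> 1 u * \<Psi> 1 u * \<Psi> 2 u))
       + (\<Psi> 3 u + (3 * (\<Psi> 1 u * \<Psi> 2 u) + \<Psi> 1 u * (\<Psi> 1 u * \<Psi> 1 u))) * \<Psi> 1 u) * ?E u"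
    by (subst n(1)) (simp only: funpow.simps o_apply id_apply p1 p2 p3' p4, simp add: algebra_simps)
  show ?thesis
    unfolding log_deriv4_def Let_def D1 D2 D3 D4
    by (simp add: power2_eq_square power3_eq_cube power4_eq_xxxx) (simp add: algebra_simps)
qed

section \<open>Levy exponents: moments, lower bound and fourth derivative\<close>

lemma levy_measure_moments:
  fixes \<nu> :: "'a::euclidean_space measure"
  assumes lm: "levy_measure \<nu>" and mom: "(\<integral>\<^sup>+x. ennreal (norm x powr p) \<partial>\<nu>) < \<infinity>"
    and k: "2 \<le> k" "real k \<le> p"
  shows "integrable \<nu> (\<lambda>x. norm x ^ k)"
proof (rule integrableI_bounded)
  have [measurable_cong]: "sets \<nu> = sets borel" using lm by (simp add: levy_measure_def)
  show "(\<lambda>x. norm x ^ k) \<in> borel_measurable \<nu>" by measurable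
  have "(\<integral>\<^sup>+x. ennreal (norm (norm x ^ k)) \<partial>\<nu>) \<le>
      (\<integral>\<^sup>+x. ennreal (min 1 ((norm x)\<^sup>2)) + ennreal (norm x powr p) \<partial>\<nu>)"
  proof (rule nn_integral_mono)
    fix x :: 'a
    show "ennreal (norm (norm x ^ k)) \<le> ennreal (min 1 ((norm x)\<^sup>2)) + ennreal (norm x powr p)"
    \<comment> \<open>Near the origin \<open>k \<ge> 2\<close> lets the Levy condition dominate,
      away from it \<open>k \<le> p\<close> lets the moment hypothesis dominate.\<close>
    proof (cases "norm x \<le> 1")
      case True
      then have "norm x ^ k \<le> (norm x)\<^sup>2" using k by (intro power_decreasing) auto
      moreover have "(norm x)\<^sup>2 \<le> 1" using True by (simp add: power_le_one)
      ultimately have "norm x ^ k \<le> min 1 ((norm x)\<^sup>2)" by simp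
      then show ?thesis by (simp add: ennreal_leI add_increasing2)
    next
      case False
      then have "0 < norm x" by linarith
      then have "norm x ^ k = norm x powr real k" by (simp add: powr_realpow)
      also have "\<dots> \<le> norm x powr p" using False k by (intro powr_mono) auto
      finally show ?thesis by (simp add: ennreal_leI add_increasing)
    qed
  qed
  also have "\<dots> = (\<integral>\<^sup>+x. ennreal (min 1 ((norm x)\<^sup>2)) \<partial>\<nu>) + (\<integral>\<^sup>+x. ennreal (norm x powr p) \<partial>\<nu>)"
    by (rule nn_integral_add) auto
  also have "\<dots> < \<infinity>" using lm mom by (simp add: levy_measure_def)
  finally show "(\<integral>\<^sup>+x. ennreal (norm (norm x ^ k)) \<partial>\<nu>) < \<infinity>" .
qed

lemma integrable_inner_power:
  fixes \<nu> :: "'a::euclidean_space measure"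
  assumes [measurable_cong]: "sets \<nu> = sets borel" and "integrable \<nu> (\<lambda>x. norm x ^ k)"
  shows "integrable \<nu> (\<lambda>x. \<bar>e \<bullet> x\<bar> ^ k)"
proof (rule Bochner_Integration.integrable_bound)
  show "integrable \<nu> (\<lambda>x. norm e ^ k * norm x ^ k)" using assms by simp
  show "AE x in \<nu>. norm (\<bar>e \<bullet> x\<bar> ^ k) \<le> norm (norm e ^ k * norm x ^ k)"
    by (intro AE_I2) (auto simp: Cauchy_Schwarz_ineq2 power_mono simp flip: power_mult_distrib)
qed measurable

text \<open>An explicit logarithm of the characteristic function, so that no branch of the complex
  logarithm has to be chosen.\<close>

definition levy_exponent ::
    "('a::euclidean_space \<Rightarrow> 'a) \<Rightarrow> 'a measure \<Rightarrow> 'a \<Rightarrow> 'a \<Rightarrow> complex" where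
  "levy_exponent \<Sigma> \<nu> \<alpha> u =
     - complex_of_real (u \<bullet> \<Sigma> u) / 2 + \<i> * complex_of_real (u \<bullet> \<alpha>)
          + (\<integral>x. (iexp (u \<bullet> x) - 1 - \<i> * complex_of_real (u \<bullet> x)) \<partial>\<nu>)"

lemma levy_khintchine_eq: "levy_khintchine \<Sigma> \<nu> \<alpha> = (\<lambda>u. exp (levy_exponent \<Sigma> \<nu> \<alpha> u))"
  by (simp add: fun_eq_iff levy_khintchine_def levy_exponent_def)

lemma compensated_integrable:
  fixes \<nu> :: "'a::euclidean_space measure"
  assumes [measurable_cong]: "sets \<nu> = sets borel" and m2: "integrable \<nu> (\<lambda>x. norm x ^ 2)"
  shows "integrable \<nu> (\<lambda>x. iexp (u \<bullet> x) - 1 - \<i> * complex_of_real (u \<bullet> x))"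
    and "cmod (\<integral>x. (iexp (u \<bullet> x) - 1 - \<i> * complex_of_real (u \<bullet> x)) \<partial>\<nu>) \<le> (norm u)\<^sup>2 * (\<integral>x. norm x ^ 2 \<partial>\<nu>)"
proof -
  have le: "cmod (iexp (u \<bullet> x) - 1 - \<i> * complex_of_real (u \<bullet> x)) \<le> (norm u)\<^sup>2 * norm x ^ 2" for x
  proof -
    have "cmod (iexp (u \<bullet> x) - 1 - \<i> * complex_of_real (u \<bullet> x)) \<le> (u \<bullet> x)\<^sup>2 / 2"
      by (rule iexp_second_order)
    also have "\<dots> \<le> (u \<bullet> x)\<^sup>2" by simp
    also have "\<dots> = \<bar>u \<bullet> x\<bar>\<^sup>2" by simp
    also have "\<dots> \<le> (norm u * norm x)\<^sup>2" by (intro power_mono Cauchy_Schwarz_ineq2) auto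
    finally show ?thesis by (simp add: power_mult_distrib)
  qed
  have i: "integrable \<nu> (\<lambda>x. (norm u)\<^sup>2 * norm x ^ 2)" using m2 by simp
  show I: "integrable \<nu> (\<lambda>x. iexp (u \<bullet> x) - 1 - \<i> * complex_of_real (u \<bullet> x))"
    by (rule Bochner_Integration.integrable_bound[OF i]) (use le in auto)
  have "cmod (\<integral>x. (iexp (u \<bullet> x) - 1 - \<i> * complex_of_real (u \<bullet> x)) \<partial>\<nu>) \<le> (\<integral>x. (norm u)\<^sup>2 * norm x ^ 2 \<partial>\<nu>)"
    by (rule norm_integral_le[OF i]) (use le in auto)
  then show "cmod (\<integral>x. (iexp (u \<bullet> x) - 1 - \<i> * complex_of_real (u \<bullet> x)) \<partial>\<nu>) \<le> (norm u)\<^sup>2 * (\<integral>x. norm x ^ 2 \<partial>\<nu>)"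
    by simp
qed

text \<open>The modulus is the exponential of the real part of the exponent. Both the Gaussian part
  and, thanks to the finite second moment of \<open>\<nu>\<close>, the jump part are bounded
  quadratically in \<open>u\<close>.\<close>

lemma levy_khintchine_lower_bound:
  fixes \<nu> :: "'a::euclidean_space measure"
  assumes "sets \<nu> = sets borel" and m2: "integrable \<nu> (\<lambda>x. norm x ^ 2)" and lin: "linear \<Sigma>"
  shows "\<exists>c\<ge>0. \<forall>u. exp (- c * (norm u)\<^sup>2) \<le> cmod (levy_khintchine \<Sigma> \<nu> \<alpha> u)"
proof -
  obtain B where B: "0 < B" "\<And>u. norm (\<Sigma> u) \<le> B * norm u" using linear_bounded_pos[OF lin] by blast
  define c where "c = B + (\<integral>x. norm x ^ 2 \<partial>\<nu>)"
  have "0 \<le> (\<integral>x. norm x ^ 2 \<partial>\<nu>)" by simp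
  then have "0 \<le> c" using B by (simp add: c_def)
  moreover have "exp (- c * (norm u)\<^sup>2) \<le> cmod (levy_khintchine \<Sigma> \<nu> \<alpha> u)" for u
  proof -
    let ?I = "\<integral>x. (iexp (u \<bullet> x) - 1 - \<i> * complex_of_real (u \<bullet> x)) \<partial>\<nu>"
    have "\<bar>u \<bullet> \<Sigma> u\<bar> \<le> norm u * (B * norm u)"
      using Cauchy_Schwarz_ineq2[of u "\<Sigma> u"] B(2)[of u]
      by (meson mult_left_mono norm_ge_zero order_trans)
    then have "u \<bullet> \<Sigma> u / 2 \<le> B * (norm u)\<^sup>2" 
      using B(1) by (smt (verit) mult.commute mult.left_commute power2_eq_square field_sum_of_halves)
    moreover have "- ((norm u)\<^sup>2 * (\<integral>x. norm x ^ 2 \<partial>\<nu>)) \<le> Re ?I"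
      using compensated_integrable(2)[OF assms(1,2), of u] abs_Re_le_cmod[of ?I] by linarith
    ultimately have "- c * (norm u)\<^sup>2 \<le> Re (levy_exponent \<Sigma> \<nu> \<alpha> u)"
      by (simp add: levy_exponent_def c_def algebra_simps)
    then show ?thesis by (simp add: levy_khintchine_eq norm_exp_eq_Re)
  qed
  ultimately show ?thesis by blast
qed

text \<open>Drift and covariance contribute a polynomial of degree two to the exponent and disappear
  after four derivatives. What remains is the fourth Fourier moment of \<open>\<nu>\<close>, without
  sign since the fourth power of the imaginary unit is 1.\<close>

lemma log_deriv4_levy_khintchine:
  fixes \<nu> :: "'a::euclidean_space measure"
  assumes [measurable_cong]: "sets \<nu> = sets borel"
    and m: "\<And>k. 2 \<le> k \<Longrightarrow> k \<le> 5 \<Longrightarrow> integrable \<nu> (\<lambda>x. norm x ^ k)"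
    and cov: "covariance_operator \<Sigma>"
  shows "log_deriv4 e (levy_khintchine \<Sigma> \<nu> \<alpha>) u = (\<integral>x. complex_of_real ((e \<bullet> x) ^ 4) * iexp (u \<bullet> x) \<partial>\<nu>)"
proof -
  have lin: "linear \<Sigma>" and sym: "\<And>u v. \<Sigma> u \<bullet> v = u \<bullet> \<Sigma> v"
    using cov by (auto simp: covariance_operator_def)
  \<comment> \<open>Orders 0 and 1 keep the compensator inside the integral, because
    \<open>\<nu>\<close> may be infinite near the origin. From order 2 on the moment functions are
    integrable by themselves.\<close>
  define \<Psi> where "\<Psi> = (\<lambda>j u. case j of
      0 \<Rightarrow> levy_exponent \<Sigma> \<nu> \<alpha> u
    | Suc 0 \<Rightarrow> - complex_of_real (e \<bullet> \<Sigma> u) + \<i> * complex_of_real (e \<bullet> \<alpha>)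
        + (\<integral>x. \<i> * complex_of_real (e \<bullet> x) * (iexp (u \<bullet> x) - 1) \<partial>\<nu>)
    | Suc (Suc 0) \<Rightarrow> - complex_of_real (e \<bullet> \<Sigma> e) + fourier_moment \<nu> e 2 u
    | _ \<Rightarrow> fourier_moment \<nu> e j u)"
  have m': "integrable \<nu> (\<lambda>x. \<bar>e \<bullet> x\<bar> ^ k)" if "2 \<le> k" "k \<le> 5" for k
    using that by (intro integrable_inner_power[OF assms(1)] m)
  have m2: "integrable \<nu> (\<lambda>x. norm x ^ 2)" by (rule m) auto
  have i1: "integrable \<nu> (\<lambda>x. \<i> * complex_of_real (e \<bullet> x) * (iexp (v \<bullet> x) - 1))" for v
  proof (rule Bochner_Integration.integrable_bound)
    show "integrable \<nu> (\<lambda>x. norm e * norm v * norm x ^ 2)" using m2 by simp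
    show "AE x in \<nu>. norm (\<i> * complex_of_real (e \<bullet> x) * (iexp (v \<bullet> x) - 1)) \<le> norm (norm e * norm v * norm x ^ 2)"
    proof (rule AE_I2)
      fix x
      have "cmod (iexp (v \<bullet> x) - 1) \<le> \<bar>v \<bullet> x\<bar>" using iexp_approx1[of "v \<bullet> x" 0] by simp
      also have "\<dots> \<le> norm v * norm x" by (rule Cauchy_Schwarz_ineq2)
      finally have "\<bar>e \<bullet> x\<bar> * cmod (iexp (v \<bullet> x) - 1) \<le> (norm e * norm x) * (norm v * norm x)"
        by (intro mult_mono Cauchy_Schwarz_ineq2) auto
      then show "norm (\<i> * complex_of_real (e \<bullet> x) * (iexp (v \<bullet> x) - 1)) \<le> norm (norm e * norm v * norm x ^ 2)"
        by (simp add: norm_mult power2_eq_square mult_ac)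
    qed
  qed measurable
  have "((\<lambda>s. \<Psi> j (u + s *\<^sub>R e)) has_vector_derivative \<Psi> (Suc j) u) (at 0)" if j: "j < 4" for j u
  proof -
    have q: "((\<lambda>s. - complex_of_real ((u + s *\<^sub>R e) \<bullet> \<Sigma> (u + s *\<^sub>R e)) / 2 + \<i> * complex_of_real ((u + s *\<^sub>R e) \<bullet> \<alpha>))
        has_vector_derivative - complex_of_real (e \<bullet> \<Sigma> u) + \<i> * complex_of_real (e \<bullet> \<alpha>)) (at 0)"
    proof -
      have E: "- complex_of_real ((u + s *\<^sub>R e) \<bullet> \<Sigma> (u + s *\<^sub>R e)) / 2 + \<i> * complex_of_real ((u + s *\<^sub>R e) \<bullet> \<alpha>) =
         complex_of_real (- (u \<bullet> \<Sigma> u) / 2 - s * (e \<bullet> \<Sigma> u) - s\<^sup>2 * (e \<bullet> \<Sigma> e) / 2)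
          + complex_of_real (u \<bullet> \<alpha> + s * (e \<bullet> \<alpha>)) * \<i>" for s
        using sym[of u e]
        by (simp add: linear_add[OF lin] linear_scale[OF lin] inner_add_left inner_add_right inner_commute
            power2_eq_square field_simps)
      have r1: "((\<lambda>s. - (u \<bullet> \<Sigma> u) / 2 - s * (e \<bullet> \<Sigma> u) - s\<^sup>2 * (e \<bullet> \<Sigma> e) / 2) has_real_derivative - (e \<bullet> \<Sigma> u)) (at 0)"
        by (auto intro!: derivative_eq_intros)
      have r2: "((\<lambda>s. u \<bullet> \<alpha> + s * (e \<bullet> \<alpha>)) has_real_derivative e \<bullet> \<alpha>) (at 0)"
        by (auto intro!: derivative_eq_intros)
      show ?thesis unfolding E
        using has_vector_derivative_add[OF has_vector_derivative_of_real[OF r1]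
            has_vector_derivative_mult_left[OF has_vector_derivative_of_real[OF r2]], of \<i>]
        by (simp add: mult.commute)
    qed
    consider "j = 0" | "j = 1" | "j = 2" | "j = 3" using j by linarith
    then show ?thesis
    proof cases
      case 1
      have "((\<lambda>s. \<integral>x. (iexp ((u + s *\<^sub>R e) \<bullet> x) - 1 - \<i> * complex_of_real ((u + s *\<^sub>R e) \<bullet> x)) \<partial>\<nu>)
        has_vector_derivative (\<integral>x. \<i> * complex_of_real (e \<bullet> x) * (iexp (u \<bullet> x) - 1) \<partial>\<nu>)) (at 0)"
      proof (rule has_vector_derivative_integral[where H="\<lambda>x. \<bar>e \<bullet> x\<bar> ^ 2 / 2"])
        show "integrable \<nu> (\<lambda>x. \<bar>e \<bullet> x\<bar> ^ 2 / 2)" using m'[of 2] by simp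
        fix s x
        have "iexp ((u + s *\<^sub>R e) \<bullet> x) - 1 - \<i> * complex_of_real ((u + s *\<^sub>R e) \<bullet> x) -
            (iexp ((u + 0 *\<^sub>R e) \<bullet> x) - 1 - \<i> * complex_of_real ((u + 0 *\<^sub>R e) \<bullet> x)) -
            complex_of_real s * (\<i> * complex_of_real (e \<bullet> x) * (iexp (u \<bullet> x) - 1))
          = iexp (u \<bullet> x) * (iexp (s * (e \<bullet> x)) - 1 - \<i> * complex_of_real (s * (e \<bullet> x)))"
          unfolding iexp_inner_add by (simp add: algebra_simps)
        also have "cmod \<dots> \<le> (s * (e \<bullet> x))\<^sup>2 / 2"
          using iexp_second_order[of "s * (e \<bullet> x)"] by (simp only: norm_mult norm_exp_i_times mult_1)
        finally show "cmod (iexp ((u + s *\<^sub>R e) \<bullet> x) - 1 - \<i> * complex_of_real ((u + s *\<^sub>R e) \<bullet> x) -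
            (iexp ((u + 0 *\<^sub>R e) \<bullet> x) - 1 - \<i> * complex_of_real ((u + 0 *\<^sub>R e) \<bullet> x)) -
            complex_of_real s * (\<i> * complex_of_real (e \<bullet> x) * (iexp (u \<bullet> x) - 1))) \<le> s\<^sup>2 * (\<bar>e \<bullet> x\<bar> ^ 2 / 2)"
          by (simp add: power_mult_distrib)
      qed (intro compensated_integrable(1) assms(1) m2 i1)+
      from has_vector_derivative_add[OF q this] show ?thesis
        by (simp add: 1 \<Psi>_def levy_exponent_def)
    next
      case 2
      have "((\<lambda>s. \<integral>x. \<i> * complex_of_real (e \<bullet> x) * (iexp ((u + s *\<^sub>R e) \<bullet> x) - 1) \<partial>\<nu>)
        has_vector_derivative fourier_moment \<nu> e 2 u) (at 0)"
        unfolding fourier_moment_def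
      proof (rule has_vector_derivative_integral[where H="\<lambda>x. \<bar>e \<bullet> x\<bar> ^ 3 / 2"])
        show "integrable \<nu> (\<lambda>x. \<bar>e \<bullet> x\<bar> ^ 3 / 2)" using m'[of 3] by simp
        show "integrable \<nu> (\<lambda>x. (\<i> * complex_of_real (e \<bullet> x))\<^sup>2 * iexp (u \<bullet> x))"
          by (rule Bochner_Integration.integrable_bound[OF m'[of 2]]) (auto simp: norm_mult norm_power)
        fix s x
        have "\<i> * complex_of_real (e \<bullet> x) * (iexp ((u + s *\<^sub>R e) \<bullet> x) - 1) -
            \<i> * complex_of_real (e \<bullet> x) * (iexp ((u + 0 *\<^sub>R e) \<bullet> x) - 1) -
            complex_of_real s * ((\<i> * complex_of_real (e \<bullet> x))\<^sup>2 * iexp (u \<bullet> x))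
          = \<i> * complex_of_real (e \<bullet> x) * iexp (u \<bullet> x) * (iexp (s * (e \<bullet> x)) - 1 - \<i> * complex_of_real (s * (e \<bullet> x)))"
          unfolding iexp_inner_add by (simp add: algebra_simps power2_eq_square)
        also have "cmod \<dots> = \<bar>e \<bullet> x\<bar> * cmod (iexp (s * (e \<bullet> x)) - 1 - \<i> * complex_of_real (s * (e \<bullet> x)))"
          by (simp add: norm_mult)
        also have "\<dots> \<le> \<bar>e \<bullet> x\<bar> * ((s * (e \<bullet> x))\<^sup>2 / 2)"
          by (intro mult_left_mono iexp_second_order) simp
        also have "\<dots> = s\<^sup>2 * (\<bar>e \<bullet> x\<bar> * \<bar>e \<bullet> x\<bar>\<^sup>2 / 2)" by (simp add: power_mult_distrib)
        also have "\<bar>e \<bullet> x\<bar> * \<bar>e \<bullet> x\<bar>\<^sup>2 = \<bar>e \<bullet> x\<bar> ^ 3" by (simp add: power3_eq_cube power2_eq_square mult.assoc)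
        finally show "cmod (\<i> * complex_of_real (e \<bullet> x) * (iexp ((u + s *\<^sub>R e) \<bullet> x) - 1) -
            \<i> * complex_of_real (e \<bullet> x) * (iexp ((u + 0 *\<^sub>R e) \<bullet> x) - 1) -
            complex_of_real s * ((\<i> * complex_of_real (e \<bullet> x))\<^sup>2 * iexp (u \<bullet> x))) \<le> s\<^sup>2 * (\<bar>e \<bullet> x\<bar> ^ 3 / 2)" .
      qed (rule i1)
      moreover have "((\<lambda>s. - complex_of_real (e \<bullet> \<Sigma> (u + s *\<^sub>R e)) + \<i> * complex_of_real (e \<bullet> \<alpha>))
         has_vector_derivative - complex_of_real (e \<bullet> \<Sigma> e)) (at 0)"
      proof -
        have E: "- complex_of_real (e \<bullet> \<Sigma> (u + s *\<^sub>R e)) + \<i> * complex_of_real (e \<bullet> \<alpha>) =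
            complex_of_real (- (e \<bullet> \<Sigma> u) - s * (e \<bullet> \<Sigma> e)) + \<i> * complex_of_real (e \<bullet> \<alpha>)" for s
          by (simp add: linear_add[OF lin] linear_scale[OF lin] inner_add_right)
        have r: "((\<lambda>s. - (e \<bullet> \<Sigma> u) - s * (e \<bullet> \<Sigma> e)) has_real_derivative - (e \<bullet> \<Sigma> e)) (at 0)"
          by (auto intro!: derivative_eq_intros)
        show ?thesis unfolding E
          using has_vector_derivative_add[OF has_vector_derivative_of_real[OF r] has_vector_derivative_const[of "\<i> * complex_of_real (e \<bullet> \<alpha>)"]]
          by simp
      qed
      ultimately show ?thesis
        using has_vector_derivative_add by (fastforce simp: 2 \<Psi>_def numeral_2_eq_2)
    next
      case 3
      have "((\<lambda>s. fourier_moment \<nu> e 2 (u + s *\<^sub>R e)) has_vector_derivative fourier_moment \<nu> e (Suc 2) u) (at 0)"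
        using m'[of 2] m'[of 3] m'[of 4] by (intro fourier_moment_has_derivative assms(1)) simp_all
      from has_vector_derivative_add[OF has_vector_derivative_const[of "- complex_of_real (e \<bullet> \<Sigma> e)"] this]
      show ?thesis by (simp add: 3 \<Psi>_def numeral_2_eq_2)
    next
      case 4
      have "((\<lambda>s. fourier_moment \<nu> e 3 (u + s *\<^sub>R e)) has_vector_derivative fourier_moment \<nu> e (Suc 3) u) (at 0)"
        using m'[of 3] m'[of 4] m'[of 5] by (intro fourier_moment_has_derivative assms(1)) simp_all
      then show ?thesis by (simp add: 4 \<Psi>_def numeral_3_eq_3)
    qed
  qed
  then have "log_deriv4 e (\<lambda>u. exp (\<Psi> 0 u)) u = \<Psi> 4 u" by (rule log_deriv4_exp)
  moreover have "(\<lambda>u. exp (\<Psi> 0 u)) = levy_khintchine \<Sigma> \<nu> \<alpha>" by (simp add: \<Psi>_def levy_khintchine_eq)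
  moreover have "\<Psi> 4 u = fourier_moment \<nu> e 4 u" by (simp add: \<Psi>_def eval_nat_numeral)
  ultimately show ?thesis by (simp add: fourier_moment_def power_mult_distrib)
qed

section \<open>Eighth-order expansions and the eighth moment of the increments\<close>

text \<open>
  The filter is \<open>nhds 0\<close> and not \<open>at 0\<close>, so that the bound survives the substitution of
  \<open>(real j - 4) * s\<close>, which vanishes for \<open>j = 4\<close>.
\<close>

definition expands8 :: "(real \<Rightarrow> complex) \<Rightarrow> complex poly \<Rightarrow> bool" where
  "expands8 f p \<longleftrightarrow> (\<lambda>s. f s - poly p (of_real s)) \<in> O[nhds 0](\<lambda>s. of_real s ^ 8)"

lemma poly_bigo_1: "(\<lambda>s. poly p (of_real s :: complex)) \<in> O[nhds (0::real)](\<lambda>_. 1 :: complex)"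
proof (rule bigoI_tendsto)
  have "((\<lambda>s. poly p (of_real s :: complex)) \<longlongrightarrow> poly p (of_real 0)) (at (0::real))"
    by (intro tendsto_intros)
  then have "((\<lambda>s. poly p (of_real s :: complex)) \<longlongrightarrow> poly p (of_real 0)) (nhds (0::real))"
    using tendsto_at_iff_tendsto_nhds[of "\<lambda>s. poly p (of_real s :: complex)" 0] by simp
  then show "((\<lambda>s. poly p (of_real s :: complex) / 1) \<longlongrightarrow> poly p (of_real 0)) (nhds (0::real))" by simp
qed simp

lemma power_bigo_power:
  assumes "m \<le> n"
  shows "(\<lambda>s. of_real s ^ n :: complex) \<in> O[nhds (0::real)](\<lambda>s. of_real s ^ m)"
proof -
  have "(\<lambda>s. of_real s ^ m * of_real s ^ (n - m) :: complex) \<in> O[nhds (0::real)](\<lambda>s. of_real s ^ m * 1)"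
    using poly_bigo_1[of "monom 1 (n - m)"]
    by (intro landau_o.big.mult landau_o.big_refl) (simp add: poly_monom)
  then show ?thesis using assms by (simp flip: power_add)
qed

lemma expands8_bigo_1:
  assumes "expands8 f p"
  shows "f \<in> O[nhds 0](\<lambda>_. 1)"
proof -
  have "(\<lambda>s. f s - poly p (of_real s)) \<in> O[nhds 0](\<lambda>_. 1)"
    using assms power_bigo_power[of 0 8] unfolding expands8_def by (auto elim: landau_o.big.trans)
  from sum_in_bigo(1)[OF this poly_bigo_1[of p]] show ?thesis by simp
qed

lemma expands8_const: "expands8 (\<lambda>_. c) [:c:]"
  by (simp add: expands8_def)

lemma expands8_add: "expands8 f p \<Longrightarrow> expands8 g q \<Longrightarrow> expands8 (\<lambda>s. f s + g s) (p + q)"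
  unfolding expands8_def by (drule (1) sum_in_bigo(1)) (simp add: algebra_simps)

lemma expands8_mult:
  assumes f: "expands8 f p" and g: "expands8 g q"
  shows "expands8 (\<lambda>s. f s * g s) (p * q)"
proof -
  have "(\<lambda>s. (f s - poly p (of_real s)) * g s) \<in> O[nhds 0](\<lambda>s. of_real s ^ 8 * 1)"
    using f expands8_bigo_1[OF g] unfolding expands8_def by (rule landau_o.big.mult)
  moreover have "(\<lambda>s. poly p (of_real s) * (g s - poly q (of_real s))) \<in> O[nhds 0](\<lambda>s. 1 * of_real s ^ 8)"
    using poly_bigo_1[of p] g unfolding expands8_def by (rule landau_o.big.mult)
  ultimately have "(\<lambda>s. (f s - poly p (of_real s)) * g s + poly p (of_real s) * (g s - poly q (of_real s)))
      \<in> O[nhds 0](\<lambda>s. of_real s ^ 8)"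
    by (intro sum_in_bigo) simp_all
  then show ?thesis by (simp add: expands8_def algebra_simps)
qed

lemma expands8_power: "expands8 f p \<Longrightarrow> expands8 (\<lambda>s. f s ^ n) (p ^ n)"
proof (induction n)
  case 0
  show ?case using expands8_const[of 1] by (simp add: one_pCons)
next
  case (Suc n)
  then show ?case using expands8_mult[of f p] by simp
qed

lemma expands8_sum:
  "(\<And>k. k \<in> A \<Longrightarrow> expands8 (f k) (p k)) \<Longrightarrow> expands8 (\<lambda>s. \<Sum>k\<in>A. f k s) (\<Sum>k\<in>A. p k)"
proof (induction A rule: infinite_finite_induct)
  case (insert x A)
  then show ?case using expands8_add[of "f x" "p x"] by simp
qed (use expands8_const[of 0] in simp_all)

text \<open>Since the polynomial vanishes at 0, \<open>f\<close> is \<open>O(s)\<close>. The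
  exponential series cut after the seventh power then leaves a remainder \<open>O(s^8)\<close>, and
  the partial sum is covered by the algebra of expansions.\<close>

lemma expands8_exp:
  assumes f: "expands8 f p" and p0: "poly p 0 = 0"
  shows "\<exists>q. expands8 (\<lambda>s. exp (f s)) q"
proof -
  obtain p' where p': "p = pCons 0 p'" using p0 by (cases p) auto
  have "(\<lambda>s. of_real s * poly p' (of_real s)) \<in> O[nhds (0::real)](\<lambda>s. of_real s * 1 :: complex)"
    by (intro landau_o.big.mult landau_o.big_refl poly_bigo_1)
  then have "(\<lambda>s. poly p (of_real s)) \<in> O[nhds (0::real)](\<lambda>s. of_real s :: complex)"
    by (simp add: p')
  moreover have "(\<lambda>s. f s - poly p (of_real s)) \<in> O[nhds 0](\<lambda>s. of_real s)"
    using f power_bigo_power[of 1 8] unfolding expands8_def by (auto elim: landau_o.big.trans)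
  ultimately have "(\<lambda>s. (f s - poly p (of_real s)) + poly p (of_real s)) \<in> O[nhds 0](\<lambda>s. of_real s)"
    by (intro sum_in_bigo(1))
  then have fs: "f \<in> O[nhds 0](\<lambda>s. of_real s)" by simp
  have e1: "(\<lambda>s. of_real (exp (norm (f s)))) \<in> O[nhds 0](\<lambda>_. 1 :: complex)"
  proof -
    obtain C where C: "eventually (\<lambda>s. norm (f s) \<le> C * norm (1::complex)) (nhds 0)"
      using expands8_bigo_1[OF f] by (elim landau_o.bigE)
    show ?thesis
      by (rule bigoI[of _ "exp C"]) (use C in eventually_elim, simp)
  qed
  have "(\<lambda>s. exp (f s) - (\<Sum>k\<le>7. f s ^ k / fact k)) \<in> O[nhds 0](\<lambda>s. of_real (exp (norm (f s))) * f s ^ 8)"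
  proof (rule bigoI[of _ 1], intro always_eventually allI)
    fix s
    have "norm (exp (f s) - (\<Sum>k\<le>7. f s ^ k / fact k)) \<le> exp \<bar>Re (f s)\<bar> * norm (f s) ^ Suc 7 / fact 7"
      by (rule Taylor_exp)
    also have "\<dots> \<le> exp \<bar>Re (f s)\<bar> * norm (f s) ^ Suc 7 / 1"
      by (intro divide_left_mono) (auto simp: fact_numeral)
    also have "\<dots> \<le> exp (norm (f s)) * norm (f s) ^ 8"
      by (simp add: mult_right_mono abs_Re_le_cmod)
    finally show "norm (exp (f s) - (\<Sum>k\<le>7. f s ^ k / fact k)) \<le> 1 * norm (of_real (exp (norm (f s))) * f s ^ 8)"
      by (simp add: norm_mult norm_power)
  qed
  also have "(\<lambda>s. of_real (exp (norm (f s))) * f s ^ 8) \<in> O[nhds 0](\<lambda>s. 1 * of_real s ^ 8)"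
    by (intro landau_o.big.mult e1 landau_o.big_power fs)
  finally have A: "expands8 (\<lambda>s. exp (f s) - (\<Sum>k\<le>7. f s ^ k / fact k)) 0"
    by (simp add: expands8_def)
  have B: "expands8 (\<lambda>s. \<Sum>k\<le>7. f s ^ k / fact k) (\<Sum>k\<le>7. [:1 / fact k:] * p ^ k)"
  proof (rule expands8_sum)
    fix k
    show "expands8 (\<lambda>s. f s ^ k / fact k) ([:1 / fact k:] * p ^ k)"
      using expands8_mult[OF expands8_const[of "1 / fact k"] expands8_power[OF f, of k]] by simp
  qed
  show ?thesis using expands8_add[OF A B] by auto
qed

text \<open>An eighth difference annihilates polynomials of degree below eight. The eight cases are
  computed over the integers and then mapped into the ring.\<close>

lemma eighth_difference_monomial:
  assumes "k < 8"
  shows "(\<Sum>j\<le>8. (-1) ^ j * of_nat (8 choose j) * (of_nat j - 4) ^ k) = (0 :: 'a::comm_ring_1)"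
proof -
  have "k = 0 \<or> k = 1 \<or> k = 2 \<or> k = 3 \<or> k = 4 \<or> k = 5 \<or> k = 6 \<or> k = 7" using assms by linarith
  then have "(\<Sum>j\<le>8. (-1) ^ j * of_nat (8 choose j) * (of_nat j - 4) ^ k) = (0 :: int)"
    by (elim disjE) (simp_all add: atMost_nat_numeral atMost_Suc binomial_eq_0 numeral_eq_Suc)
  then have "of_int (\<Sum>j\<le>8. (-1) ^ j * of_nat (8 choose j) * (of_nat j - 4) ^ k) = (of_int 0 :: 'a)"
    by (simp only:)
  then show ?thesis by simp
qed

text \<open>The remainders at the nine scaled arguments are \<open>O(s^8)\<close>. In the polynomial
  part the difference leaves only terms of degree at least eight.\<close>

lemma eighth_difference_bigo:
  assumes f: "expands8 f p"
  shows "(\<lambda>s. \<Sum>j\<le>8. (-1) ^ j * of_nat (8 choose j) * f ((real j - 4) * s)) \<in> O[nhds 0](\<lambda>s. of_real s ^ 8)"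
proof -
  let ?w = "\<lambda>j. (-1) ^ j * of_nat (8 choose j) :: complex"
  have r: "(\<lambda>s. f (c * s) - poly p (of_real (c * s))) \<in> O[nhds 0](\<lambda>s. of_real s ^ 8)" for c :: real
  proof -
    have "filterlim (\<lambda>s. c * s) (nhds 0) (nhds 0)"
      using tendsto_mult[OF tendsto_const[of c] tendsto_ident_at] 
      by (auto intro!: tendsto_eq_intros filterlim_ident)
    from landau_o.big.compose[OF f[unfolded expands8_def] this]
    have "(\<lambda>s. f (c * s) - poly p (of_real (c * s))) \<in> O[nhds 0](\<lambda>s. of_real (c * s) ^ 8)" .
    also have "(\<lambda>s. of_real (c * s) ^ 8 :: complex) \<in> O[nhds 0](\<lambda>s. of_real s ^ 8)"
      by (rule bigoI[of _ "\<bar>c\<bar> ^ 8"]) (simp add: norm_mult norm_power power_mult_distrib)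
    finally show ?thesis .
  qed
  have A: "(\<lambda>s. \<Sum>j\<le>8. ?w j * (f ((real j - 4) * s) - poly p (of_real ((real j - 4) * s)))) \<in> O[nhds 0](\<lambda>s. of_real s ^ 8)"
  proof (rule big_sum_in_bigo)
    fix j :: nat
    show "(\<lambda>s. ?w j * (f ((real j - 4) * s) - poly p (of_real ((real j - 4) * s)))) \<in> O[nhds 0](\<lambda>s. of_real s ^ 8)"
      using r[of "real j - 4"] by (cases "?w j = 0") (auto simp del: of_real_mult)
  qed
  have eq: "(\<Sum>j\<le>8. ?w j * poly p (of_real ((real j - 4) * s))) =
     (\<Sum>k\<le>degree p. coeff p k * (\<Sum>j\<le>8. ?w j * (of_nat j - 4) ^ k) * of_real s ^ k)" for s
  proof -
    have "(\<Sum>j\<le>8. ?w j * poly p (of_real ((real j - 4) * s))) =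
       (\<Sum>j\<le>8. \<Sum>k\<le>degree p. ?w j * (coeff p k * ((of_nat j - 4) ^ k * of_real s ^ k)))"
      by (simp add: poly_altdef sum_distrib_left power_mult_distrib)
    also have "\<dots> = (\<Sum>k\<le>degree p. \<Sum>j\<le>8. ?w j * (coeff p k * ((of_nat j - 4) ^ k * of_real s ^ k)))"
      by (rule sum.swap)
    also have "\<dots> = (\<Sum>k\<le>degree p. coeff p k * (\<Sum>j\<le>8. ?w j * (of_nat j - 4) ^ k) * of_real s ^ k)"
      by (intro sum.cong refl) (simp add: sum_distrib_left sum_distrib_right mult_ac)
    finally show ?thesis .
  qed
  have B: "(\<lambda>s. \<Sum>j\<le>8. ?w j * poly p (of_real ((real j - 4) * s))) \<in> O[nhds 0](\<lambda>s. of_real s ^ 8)"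
    unfolding eq
  proof (rule big_sum_in_bigo)
    fix k
    show "(\<lambda>s. coeff p k * (\<Sum>j\<le>8. ?w j * (of_nat j - 4) ^ k) * of_real s ^ k) \<in> O[nhds 0](\<lambda>s. of_real s ^ 8)"
    proof (cases "k < 8")
      case True
      then show ?thesis using eighth_difference_monomial[OF True, where 'a=complex] by simp
    next
      case False
      define C where "C = coeff p k * (\<Sum>j\<le>8. ?w j * (of_nat j - 4) ^ k)"
      have "(\<lambda>s. C * of_real s ^ k) \<in> O[nhds 0](\<lambda>s. of_real s ^ 8)"
        using power_bigo_power[of 8 k] False by (cases "C = 0") auto
      then show ?thesis by (simp add: C_def)
    qed
  qed
  show ?thesis using sum_in_bigo(1)[OF A B] by (simp add: algebra_simps sum.distrib sum_subtractf)
qed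

text \<open>With \<open>z = iexp \<theta>\<close> and inverse \<open>w\<close>,
  \<open>2 - 2 * cos \<theta>\<close> equals \<open>- ((1 - z)^2 * w)\<close>. Its fourth power is
  \<open>(1 - z)^8 * w^4\<close>, and the binomial theorem gives the central difference.\<close>

lemma cos_eighth_difference:
  "complex_of_real ((2 - 2 * cos \<theta>) ^ 4) = (\<Sum>j\<le>8. (-1) ^ j * of_nat (8 choose j) * iexp ((real j - 4) * \<theta>))"
proof -
  define z w where "z = iexp \<theta>" and "w = iexp (- \<theta>)"
  have zw: "z * w = 1" by (simp add: z_def w_def flip: exp_add)
  have "complex_of_real (2 - 2 * cos \<theta>) = 2 - z - w"
    by (simp add: z_def w_def complex_eq_iff Re_exp Im_exp)
  also have "\<dots> = - ((1 - z)\<^sup>2 * w)"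
  proof -
    have "(1 - z)\<^sup>2 * w = w - 2 * (z * w) + z * (z * w)"
      by (simp add: power2_eq_square algebra_simps)
    then show ?thesis by (simp add: zw)
  qed
  finally have "complex_of_real (2 - 2 * cos \<theta>) = - ((1 - z)\<^sup>2 * w)" .
  then have "complex_of_real ((2 - 2 * cos \<theta>) ^ 4) = (- ((1 - z)\<^sup>2 * w)) ^ 4" by (metis of_real_power)
  also have "\<dots> = (- z + 1) ^ 8 * w ^ 4"
    by (simp add: power_mult_distrib flip: power_mult)
  also have "\<dots> = (\<Sum>j\<le>8. of_nat (8 choose j) * (- z) ^ j * w ^ 4)"
    by (subst binomial_ring) (simp add: sum_distrib_right)
  also have "\<dots> = (\<Sum>j\<le>8. (-1) ^ j * of_nat (8 choose j) * iexp ((real j - 4) * \<theta>))"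
  proof (rule sum.cong[OF refl])
    fix j
    have "z ^ j * w ^ 4 = iexp ((real j - 4) * \<theta>)"
      by (simp add: z_def w_def algebra_simps flip: exp_of_nat_mult exp_add)
    then show "of_nat (8 choose j) * (- z) ^ j * w ^ 4 = (-1) ^ j * of_nat (8 choose j) * iexp ((real j - 4) * \<theta>)"
      by (simp add: power_minus[of z] mult_ac)
  qed
  finally show ?thesis .
qed

lemma two_minus_two_cos_ge:
  fixes t :: real
  shows "\<bar>t\<bar> \<le> 1 \<Longrightarrow> t\<^sup>2 / 2 \<le> 2 - 2 * cos t"
proof -
  assume t: "\<bar>t\<bar> \<le> 1"
  have "Re (iexp t - (\<Sum>k\<le>3. (\<i> * t) ^ k / fact k)) \<le> \<bar>t\<bar> ^ Suc 3 / fact (Suc 3)"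
    using iexp_approx1[of t 3] complex_Re_le_cmod order_trans by blast
  moreover have "Re (iexp t - (\<Sum>k\<le>3. (\<i> * t) ^ k / fact k)) = cos t - 1 + t\<^sup>2 / 2"
    by (simp add: Re_exp atMost_nat_numeral fact_numeral numeral_eq_Suc power2_eq_square)
  moreover have "\<bar>t\<bar> ^ 4 \<le> t\<^sup>2"
  proof -
    have "\<bar>t\<bar> ^ 4 \<le> \<bar>t\<bar> ^ 2" using t by (intro power_decreasing) auto
    then show ?thesis by simp
  qed
  moreover have "\<bar>t\<bar> ^ Suc 3 / fact (Suc 3) = \<bar>t\<bar> ^ 4 / 24" by (simp add: fact_numeral)
  moreover have "0 \<le> t\<^sup>2" by simp
  ultimately show ?thesis by linarith
qed

text \<open>
  \<open>E ((2 - 2 cos (s Y))\<^sup>4)\<close> is an eighth central difference of the characteristic function, hence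
  \<open>O(s\<^sup>8)\<close>, whereas \<open>(2 - 2 cos (s Y))\<^sup>4\<close> is at least \<open>(s Y)\<^sup>8 / 16\<close> where \<open>|s Y| \<le> 1\<close>.
\<close>

lemma eighth_moment_integrable:
  fixes P :: "'a::euclidean_space measure"
  assumes "prob_space P" and [measurable_cong, simp]: "sets P = sets borel"
    and ex: "expands8 (\<lambda>s. fourier_measure P (s *\<^sub>R e)) p"
  shows "integrable P (\<lambda>x. \<bar>e \<bullet> x\<bar> ^ 8)"
proof -
  interpret prob_space P by fact
  define I where "I = (\<lambda>s. \<integral>x. (2 - 2 * cos (s * (e \<bullet> x))) ^ 4 \<partial>P)"
  have c4: "0 \<le> 2 - 2 * cos t" "2 - 2 * cos t \<le> 4" for t :: real
    using cos_le_one[of t] cos_ge_minus_one[of t] by linarith+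
  have int: "integrable P (\<lambda>x. (2 - 2 * cos (s * (e \<bullet> x))) ^ 4)" for s
    using c4 by (intro integrable_const_bound[where B="4 ^ 4"]) (auto intro!: power_mono simp del: power_numeral)
  have ie: "integrable P (\<lambda>x. iexp (r * (e \<bullet> x)))" for r
    by (rule integrable_const_bound[where B=1]) auto
  have "complex_of_real (I s) = (\<Sum>j\<le>8. (-1) ^ j * of_nat (8 choose j) * fourier_measure P (((real j - 4) * s) *\<^sub>R e))" for s
  proof -
    have "complex_of_real (I s) = (\<integral>x. complex_of_real ((2 - 2 * cos (s * (e \<bullet> x))) ^ 4) \<partial>P)"
      unfolding I_def by (rule integral_complex_of_real[symmetric])
    also have "\<dots> = (\<integral>x. (\<Sum>j\<le>8. (-1) ^ j * of_nat (8 choose j) * iexp (((real j - 4) * s) * (e \<bullet> x))) \<partial>P)"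
      unfolding cos_eighth_difference by (simp add: mult.assoc)
    also have "\<dots> = (\<Sum>j\<le>8. (-1) ^ j * of_nat (8 choose j) * (\<integral>x. iexp (((real j - 4) * s) * (e \<bullet> x)) \<partial>P))"
      using ie by (subst Bochner_Integration.integral_sum) (auto simp del: of_real_mult)
    finally show ?thesis by (simp add: fourier_measure_def)
  qed
  then have "(\<lambda>s. complex_of_real (I s)) \<in> O[nhds 0](\<lambda>s. of_real s ^ 8)"
    using eighth_difference_bigo[OF ex] by simp
  then obtain C where "C > 0" "eventually (\<lambda>s. norm (complex_of_real (I s)) \<le> C * norm (complex_of_real s ^ 8)) (nhds 0)"
    by (elim landau_o.bigE)
  then obtain d where C: "C > 0" and d: "d > 0" "\<And>s. \<bar>s\<bar> < d \<Longrightarrow> \<bar>I s\<bar> \<le> C * \<bar>s\<bar> ^ 8"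
    by (auto simp: eventually_nhds_metric dist_norm norm_power)
  define m0 where "m0 = nat \<lceil>1 / d\<rceil> + 1"
  \<comment> \<open>Truncating at \<open>m\<close> is matched with the step
    \<open>s = 1 / m\<close>, which keeps \<open>\<bar>s Y\<bar> \<le> 1\<close> on the truncated
    set. The bound does not depend on \<open>m\<close>, so monotone convergence removes the
    truncation.\<close>
  define F where "F = (\<lambda>m x. ennreal (indicator {x. \<bar>e \<bullet> x\<bar> \<le> real m} x * \<bar>e \<bullet> x\<bar> ^ 8))"
  have [measurable]: "F m \<in> borel_measurable P" for m unfolding F_def by measurable
  have bound: "(\<integral>\<^sup>+x. F m x \<partial>P) \<le> ennreal (16 * C)" if m: "m0 \<le> m" for m
  proof -
    have m1: "1 / d < real m" "0 < real m"
    proof -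
      have "1 / d \<le> real (nat \<lceil>1 / d\<rceil>)" by (rule real_nat_ceiling_ge)
      then show "1 / d < real m" using m by (simp add: m0_def)
      show "0 < real m" using m by (simp add: m0_def)
    qed
    then have md: "\<bar>1 / real m\<bar> < d" using d(1) by (simp add: field_simps)
    \<comment> \<open>The constant 16 undoes the fourth power of the factor \<open>1 / 2\<close> in
      the lower bound for \<open>2 - 2 * cos t\<close>.\<close>
    have le: "indicator {x. \<bar>e \<bullet> x\<bar> \<le> real m} x * \<bar>e \<bullet> x\<bar> ^ 8 \<le> 16 * real m ^ 8 * (2 - 2 * cos (1 / real m * (e \<bullet> x))) ^ 4" for x
    proof (cases "\<bar>e \<bullet> x\<bar> \<le> real m")
      case True
      define t where "t = 1 / real m * (e \<bullet> x)"
      have "\<bar>t\<bar> \<le> 1" using True m1 by (simp add: t_def abs_mult)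
      then have "(t\<^sup>2 / 2) ^ 4 \<le> (2 - 2 * cos t) ^ 4" by (intro power_mono two_minus_two_cos_ge) auto
      then have "16 * real m ^ 8 * (t\<^sup>2 / 2) ^ 4 \<le> 16 * real m ^ 8 * (2 - 2 * cos t) ^ 4"
        by (intro mult_left_mono) auto
      moreover have "16 * real m ^ 8 * (t\<^sup>2 / 2) ^ 4 = \<bar>e \<bullet> x\<bar> ^ 8"
        using m1 by (simp add: t_def power_divide power_mult_distrib flip: power_mult)
      ultimately show ?thesis using True by (simp add: t_def)
    next
      case False
      then show ?thesis using c4 by simp
    qed
    have "(\<integral>\<^sup>+x. F m x \<partial>P) \<le> (\<integral>\<^sup>+x. ennreal (16 * real m ^ 8 * (2 - 2 * cos (1 / real m * (e \<bullet> x))) ^ 4) \<partial>P)"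
      unfolding F_def by (intro nn_integral_mono ennreal_leI le)
    also have "\<dots> = ennreal (\<integral>x. 16 * real m ^ 8 * (2 - 2 * cos (1 / real m * (e \<bullet> x))) ^ 4 \<partial>P)"
      using c4 by (intro nn_integral_eq_integral integrable_mult_right int) auto
    also have "\<dots> = ennreal (16 * real m ^ 8 * I (1 / real m))" by (simp add: I_def)
    also have "\<dots> \<le> ennreal (16 * real m ^ 8 * (C * \<bar>1 / real m\<bar> ^ 8))"
      using d(2)[OF md] by (intro ennreal_leI mult_left_mono) auto
    also have "16 * real m ^ 8 * (C * \<bar>1 / real m\<bar> ^ 8) = 16 * C"
      using m1 by (simp add: power_divide)
    finally show ?thesis .
  qed
  have "(\<lambda>m. \<integral>\<^sup>+x. F m x \<partial>P) \<longlonglongrightarrow> (\<integral>\<^sup>+x. ennreal (\<bar>e \<bullet> x\<bar> ^ 8) \<partial>P)"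
  proof (rule nn_integral_LIMSEQ)
    show "incseq F"
      unfolding F_def by (auto simp: incseq_def le_fun_def indicator_def intro!: ennreal_leI)
    fix x
    have "eventually (\<lambda>m. F m x = ennreal (\<bar>e \<bullet> x\<bar> ^ 8)) sequentially"
      using eventually_ge_at_top[of "nat \<lceil>\<bar>e \<bullet> x\<bar>\<rceil>"]
    proof eventually_elim
      case (elim m)
      then have "\<bar>e \<bullet> x\<bar> \<le> real m" by linarith
      then show ?case by (simp add: F_def)
    qed
    then show "(\<lambda>m. F m x) \<longlonglongrightarrow> ennreal (\<bar>e \<bullet> x\<bar> ^ 8)" by (rule tendsto_eventually)
  qed measurable
  then have "(\<integral>\<^sup>+x. ennreal (\<bar>e \<bullet> x\<bar> ^ 8) \<partial>P) \<le> ennreal (16 * C)"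
    by (rule LIMSEQ_le_const2) (use bound in auto)
  then show ?thesis
    by (intro integrableI_bounded) (auto simp: le_less_trans[OF _ ennreal_less_top] simp flip: power_abs)
qed

text \<open>The compensator cancels the Taylor terms of order 0 and 1 under the integral, so the
  expansion only involves \<open>\<nu>\<close>-moments of orders 2 to 7, and the remainder the one
  of order 8.\<close>

lemma levy_exponent_expands8:
  fixes \<nu> :: "'a::euclidean_space measure"
  assumes [measurable_cong]: "sets \<nu> = sets borel"
    and m: "\<And>k. 2 \<le> k \<Longrightarrow> k \<le> 8 \<Longrightarrow> integrable \<nu> (\<lambda>x. norm x ^ k)"
    and lin: "linear \<Sigma>"
  shows "\<exists>p. expands8 (\<lambda>s. levy_exponent \<Sigma> \<nu> \<alpha> (s *\<^sub>R e)) p \<and> poly p 0 = 0"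
proof -
  have m': "integrable \<nu> (\<lambda>x. \<bar>e \<bullet> x\<bar> ^ k)" if "2 \<le> k" "k \<le> 8" for k
    using that by (intro integrable_inner_power[OF assms(1)] m)
  have m'': "integrable \<nu> (\<lambda>x. (e \<bullet> x) ^ k)" if "2 \<le> k" "k \<le> 8" for k
    by (rule Bochner_Integration.integrable_bound[OF m'[OF that]]) (auto simp: power_abs)
  \<comment> \<open>The first polynomial carries the drift in degree one and the Gaussian part in
    degree two; the sum holds the jump contributions.\<close>
  define p where "p = [:0, \<i> * complex_of_real (e \<bullet> \<alpha>), - complex_of_real (e \<bullet> \<Sigma> e) / 2:] +
     (\<Sum>k=2..7. monom (\<i> ^ k / fact k * complex_of_real (\<integral>x. (e \<bullet> x) ^ k \<partial>\<nu>)) k)"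
  let ?D = "\<integral>x. \<bar>e \<bullet> x\<bar> ^ 8 \<partial>\<nu>"
  have "cmod (levy_exponent \<Sigma> \<nu> \<alpha> (s *\<^sub>R e) - poly p (of_real s)) \<le> ?D * \<bar>s\<bar> ^ 8" for s
  proof -
    let ?g = "\<lambda>x. iexp (s * (e \<bullet> x)) - 1 - \<i> * complex_of_real (s * (e \<bullet> x))"
    let ?T = "\<lambda>x. \<Sum>k=2..7. (\<i> * complex_of_real (s * (e \<bullet> x))) ^ k / fact k"
    have gi: "integrable \<nu> ?g"
      using compensated_integrable(1)[OF assms(1), of "s *\<^sub>R e"] m[of 2] by simp
    have Ti: "integrable \<nu> (\<lambda>x. (\<i> * complex_of_real (s * (e \<bullet> x))) ^ k / fact k)" if "k \<in> {2..7}" for k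
    proof -
      have "integrable \<nu> (\<lambda>x. (\<i> * s) ^ k / fact k * complex_of_real ((e \<bullet> x) ^ k))"
        using m''[of k] that by (intro integrable_mult_right integrable_of_real) auto
      then show ?thesis by (simp add: power_mult_distrib mult_ac)
    qed
    have Tv: "(\<integral>x. ?T x \<partial>\<nu>) = (\<Sum>k=2..7. \<i> ^ k / fact k * complex_of_real (\<integral>x. (e \<bullet> x) ^ k \<partial>\<nu>) * of_real s ^ k)"
    proof -
      have "(\<integral>x. ?T x \<partial>\<nu>) = (\<Sum>k=2..7. \<integral>x. (\<i> * complex_of_real (s * (e \<bullet> x))) ^ k / fact k \<partial>\<nu>)"
        using Ti by (rule Bochner_Integration.integral_sum)
      also have "\<dots> = (\<Sum>k=2..7. \<integral>x. (\<i> ^ k / fact k * of_real s ^ k) * complex_of_real ((e \<bullet> x) ^ k) \<partial>\<nu>)"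
        by (intro sum.cong refl Bochner_Integration.integral_cong) (simp add: power_mult_distrib mult_ac)
      also have "\<dots> = (\<Sum>k=2..7. (\<i> ^ k / fact k * of_real s ^ k) * complex_of_real (\<integral>x. (e \<bullet> x) ^ k \<partial>\<nu>))"
        by (simp only: integral_mult_right_zero integral_complex_of_real)
      finally show ?thesis by (simp only: mult_ac)
    qed
    have "levy_exponent \<Sigma> \<nu> \<alpha> (s *\<^sub>R e) - poly p (of_real s) = (\<integral>x. ?g x \<partial>\<nu>) - (\<integral>x. ?T x \<partial>\<nu>)"
    proof -
      have pp: "poly p (of_real s) = of_real s * (\<i> * complex_of_real (e \<bullet> \<alpha>))
          - of_real s * (of_real s * (complex_of_real (e \<bullet> \<Sigma> e) / 2)) + (\<integral>x. ?T x \<partial>\<nu>)"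
        unfolding Tv by (simp add: p_def poly_sum poly_monom algebra_simps)
      show ?thesis unfolding pp by (simp add: levy_exponent_def linear_scale[OF lin])
    qed
    also have "\<dots> = (\<integral>x. ?g x - ?T x \<partial>\<nu>)"
      using gi Ti by (intro Bochner_Integration.integral_diff[symmetric] Bochner_Integration.integrable_sum) auto
    also have "cmod \<dots> \<le> (\<integral>x. \<bar>s\<bar> ^ 8 * \<bar>e \<bullet> x\<bar> ^ 8 \<partial>\<nu>)"
    proof (rule norm_integral_le)
      show "integrable \<nu> (\<lambda>x. \<bar>s\<bar> ^ 8 * \<bar>e \<bullet> x\<bar> ^ 8)" using m'[of 8] by simp
      show "AE x in \<nu>. cmod (?g x - ?T x) \<le> \<bar>s\<bar> ^ 8 * \<bar>e \<bullet> x\<bar> ^ 8"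
      proof (rule AE_I2)
        fix x
        let ?t = "s * (e \<bullet> x)"
        have "{..7::nat} = {0, 1} \<union> {2..7}" by auto
        then have "(\<Sum>k\<le>7. (\<i> * complex_of_real ?t) ^ k / fact k) = 1 + \<i> * complex_of_real ?t + ?T x"
          by (subst \<open>{..7} = _\<close>, subst sum.union_disjoint) auto
        then have "?g x - ?T x = iexp ?t - (\<Sum>k\<le>7. (\<i> * complex_of_real ?t) ^ k / fact k)"
          by (simp add: algebra_simps)
        then have "cmod (?g x - ?T x) \<le> \<bar>?t\<bar> ^ Suc 7 / fact (Suc 7)"
          using iexp_approx1[of ?t 7] by (simp only:)
        also have "\<dots> \<le> \<bar>?t\<bar> ^ 8 / 1"
          by (intro frac_le) (auto simp: fact_numeral)
        finally show "cmod (?g x - ?T x) \<le> \<bar>s\<bar> ^ 8 * \<bar>e \<bullet> x\<bar> ^ 8"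
          by (simp add: abs_mult power_mult_distrib)
      qed
    qed
    finally show ?thesis by (simp add: mult.commute)
  qed
  then have "expands8 (\<lambda>s. levy_exponent \<Sigma> \<nu> \<alpha> (s *\<^sub>R e)) p"
    unfolding expands8_def by (intro bigoI[of _ ?D]) (simp add: norm_power)
  moreover have "poly p 0 = 0" by (simp add: p_def poly_sum poly_monom)
  ultimately show ?thesis by blast
qed

section \<open>Deviation of the empirical characteristic function\<close>

lemma (in prob_space) iid_mean_second_moment:
  fixes \<eta> :: "nat \<Rightarrow> 'a \<Rightarrow> 'b" and f :: "'b \<Rightarrow> real"
  assumes ind: "indep_vars (\<lambda>_. S) \<eta> {..<n}"
    and dist: "\<And>i. i < n \<Longrightarrow> distr M S (\<eta> i) = P"
    and [measurable]: "f \<in> borel_measurable S"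
    and sq: "integrable P (\<lambda>x. (f x)\<^sup>2)" and n: "0 < n"
  shows "integrable M (\<lambda>\<omega>. ((\<Sum>i<n. f (\<eta> i \<omega>)) / real n - (\<integral>x. f x \<partial>P))\<^sup>2)"
    and "(\<integral>\<omega>. ((\<Sum>i<n. f (\<eta> i \<omega>)) / real n - (\<integral>x. f x \<partial>P))\<^sup>2 \<partial>M) \<le> (\<integral>x. (f x)\<^sup>2 \<partial>P) / real n"
proof -
  define m where "m = (\<integral>x. f x \<partial>P)"
  define Z where "Z = (\<lambda>i \<omega>. f (\<eta> i \<omega>) - m)"
  have \<eta>m: "\<eta> i \<in> measurable M S" if "i < n" for i
    using ind that by (auto simp: indep_vars_def)
  have P: "prob_space P" using prob_space_distr[OF \<eta>m[OF n]] dist[OF n] by simp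
  interpret P: prob_space P by fact
  have setsP: "sets P = sets S" using dist[OF n] by (metis sets_distr)
  have fP[measurable]: "f \<in> borel_measurable P" by (subst measurable_cong_sets[OF setsP refl]) simp
  have f1: "integrable P f"
    by (rule P.square_integrable_imp_integrable[OF fP sq])
  have tr: "integrable M (\<lambda>\<omega>. g (\<eta> i \<omega>))" "(\<integral>\<omega>. g (\<eta> i \<omega>) \<partial>M) = integral\<^sup>L P g"
    if "i < n" "integrable P g" for g :: "'b \<Rightarrow> real" and i
  proof -
    have gm: "g \<in> borel_measurable S"
      using borel_measurable_integrable[OF that(2)] measurable_cong_sets[OF setsP refl] by blast
    show "integrable M (\<lambda>\<omega>. g (\<eta> i \<omega>))"
      using that dist integrable_distr_eq[OF \<eta>m gm] by metis
    show "(\<integral>\<omega>. g (\<eta> i \<omega>) \<partial>M) = integral\<^sup>L P g"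
      using that dist integral_distr[OF \<eta>m gm] by metis
  qed
  have sq2: "integrable P (\<lambda>x. (f x - m)\<^sup>2)"
    using sq f1 by (simp add: power2_diff)
  have Z1: "integrable M (Z i)" and Z0: "expectation (Z i) = 0" if "i < n" for i
    using tr[OF that, of "\<lambda>x. f x - m"] f1 by (auto simp: Z_def m_def P.prob_space)
  have Zsq: "integrable M (\<lambda>\<omega>. (Z i \<omega>)\<^sup>2)" "expectation (\<lambda>\<omega>. (Z i \<omega>)\<^sup>2) = (\<integral>x. (f x - m)\<^sup>2 \<partial>P)" if "i < n" for i
    using tr[OF that sq2] by (auto simp: Z_def)
  have Zind: "indep_vars (\<lambda>_. borel) Z {..<n}"
    unfolding Z_def by (rule indep_vars_compose2[OF ind]) measurable
  have ZZ: "integrable M (\<lambda>\<omega>. Z i \<omega> * Z j \<omega>)" "expectation (\<lambda>\<omega>. Z i \<omega> * Z j \<omega>) = (if i = j then (\<integral>x. (f x - m)\<^sup>2 \<partial>P) else 0)"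
    if "i < n" "j < n" for i j
  proof -
    have A: "integrable M (\<lambda>\<omega>. \<Prod>k\<in>{i, j}. Z k \<omega>)" "expectation (\<lambda>\<omega>. \<Prod>k\<in>{i, j}. Z k \<omega>) = (\<Prod>k\<in>{i, j}. expectation (Z k))"
      using that Z1
      by (auto intro!: indep_vars_integrable indep_vars_lebesgue_integral indep_vars_subset[OF Zind])
    show "integrable M (\<lambda>\<omega>. Z i \<omega> * Z j \<omega>)"
      using A(1) Zsq(1)[OF that(1)] by (cases "i = j") (auto simp: power2_eq_square)
    show "expectation (\<lambda>\<omega>. Z i \<omega> * Z j \<omega>) = (if i = j then (\<integral>x. (f x - m)\<^sup>2 \<partial>P) else 0)"
      using A(2) Zsq(2)[OF that(1)] Z0 that by (cases "i = j") (auto simp: power2_eq_square)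
  qed
  have eq: "((\<Sum>i<n. f (\<eta> i \<omega>)) / real n - m)\<^sup>2 = (\<Sum>i<n. \<Sum>j<n. Z i \<omega> * Z j \<omega>) / (real n)\<^sup>2" for \<omega>
  proof -
    have "(\<Sum>i<n. f (\<eta> i \<omega>)) / real n - m = (\<Sum>i<n. Z i \<omega>) / real n"
      using n by (simp add: Z_def sum_subtractf field_simps)
    then show ?thesis by (simp add: power_divide power2_eq_square[of "\<Sum>i<n. Z i \<omega>"] sum_product)
  qed
  have I: "integrable M (\<lambda>\<omega>. (\<Sum>i<n. \<Sum>j<n. Z i \<omega> * Z j \<omega>) / (real n)\<^sup>2)"
    using ZZ(1) by (intro integrable_divide_zero Bochner_Integration.integrable_sum) auto
  show "integrable M (\<lambda>\<omega>. ((\<Sum>i<n. f (\<eta> i \<omega>)) / real n - (\<integral>x. f x \<partial>P))\<^sup>2)"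
    using I by (simp add: eq flip: m_def)
  have "(\<integral>\<omega>. ((\<Sum>i<n. f (\<eta> i \<omega>)) / real n - m)\<^sup>2 \<partial>M) = (\<Sum>i<n. \<Sum>j<n. expectation (\<lambda>\<omega>. Z i \<omega> * Z j \<omega>)) / (real n)\<^sup>2"
  proof -
    have "expectation (\<lambda>\<omega>. \<Sum>i<n. \<Sum>j<n. Z i \<omega> * Z j \<omega>) = (\<Sum>i<n. expectation (\<lambda>\<omega>. \<Sum>j<n. Z i \<omega> * Z j \<omega>))"
      using ZZ(1) by (intro Bochner_Integration.integral_sum Bochner_Integration.integrable_sum) auto
    also have "\<dots> = (\<Sum>i<n. \<Sum>j<n. expectation (\<lambda>\<omega>. Z i \<omega> * Z j \<omega>))"
      using ZZ(1) by (intro sum.cong refl Bochner_Integration.integral_sum) auto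
    finally show ?thesis unfolding eq by simp
  qed
  also have "\<dots> = (\<integral>x. (f x - m)\<^sup>2 \<partial>P) / real n"
    using ZZ(2) n by (simp add: power2_eq_square)
  also have "\<dots> \<le> (\<integral>x. (f x)\<^sup>2 \<partial>P) / real n"
  proof (rule divide_right_mono)
    have "(\<integral>x. (f x - m)\<^sup>2 \<partial>P) = (\<integral>x. (f x)\<^sup>2 \<partial>P) - m\<^sup>2"
      using P.variance_eq[OF f1 sq] by (simp add: m_def)
    then show "(\<integral>x. (f x - m)\<^sup>2 \<partial>P) \<le> (\<integral>x. (f x)\<^sup>2 \<partial>P)" by simp
  qed simp
  finally show "(\<integral>\<omega>. ((\<Sum>i<n. f (\<eta> i \<omega>)) / real n - (\<integral>x. f x \<partial>P))\<^sup>2 \<partial>M) \<le> (\<integral>x. (f x)\<^sup>2 \<partial>P) / real n"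
    by (simp add: m_def)
qed

text \<open>Chebyshev for complex summands: the squared modulus splits into real and imaginary
  parts, whose second moments add up to that of \<open>g\<close>.\<close>

lemma (in prob_space) iid_mean_deviation:
  fixes \<eta> :: "nat \<Rightarrow> 'a \<Rightarrow> 'b" and g :: "'b \<Rightarrow> complex"
  assumes ind: "indep_vars (\<lambda>_. S) \<eta> {..<n}"
    and dist: "\<And>i. i < n \<Longrightarrow> distr M S (\<eta> i) = P"
    and gm[measurable]: "g \<in> borel_measurable S"
    and sq: "integrable P (\<lambda>x. (cmod (g x))\<^sup>2)" and n: "0 < n" and t: "0 < t"
  shows "prob {\<omega> \<in> space M. t \<le> cmod ((\<Sum>i<n. g (\<eta> i \<omega>)) / of_nat n - (\<integral>x. g x \<partial>P))}
     \<le> (\<integral>x. (cmod (g x))\<^sup>2 \<partial>P) / (real n * t\<^sup>2)"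
proof -
  have \<eta>m: "\<eta> i \<in> measurable M S" if "i < n" for i
    using ind that by (auto simp: indep_vars_def)
  have P: "prob_space P" using prob_space_distr[OF \<eta>m[OF n]] dist[OF n] by simp
  interpret P: prob_space P by fact
  have setsP: "sets P = sets S" using dist[OF n] by (metis sets_distr)
  have gP[measurable]: "g \<in> borel_measurable P" by (subst measurable_cong_sets[OF setsP refl]) simp
  have sR: "integrable P (\<lambda>x. (Re (g x))\<^sup>2)" and sI: "integrable P (\<lambda>x. (Im (g x))\<^sup>2)"
    by (rule Bochner_Integration.integrable_bound[OF sq]; simp add: cmod_power2)+
  have "integrable P (\<lambda>x. cmod (g x))"
    by (rule P.square_integrable_imp_integrable) (use sq in auto)
  then have gi: "integrable P g" by (simp add: integrable_norm_iff)
  note R = iid_mean_second_moment[OF ind dist _ sR n]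
  note J = iid_mean_second_moment[OF ind dist _ sI n]
  let ?W = "\<lambda>\<omega>. (\<Sum>i<n. g (\<eta> i \<omega>)) / of_nat n - (\<integral>x. g x \<partial>P)"
  let ?A = "\<lambda>\<omega>. ((\<Sum>i<n. Re (g (\<eta> i \<omega>))) / real n - (\<integral>x. Re (g x) \<partial>P))\<^sup>2"
  let ?B = "\<lambda>\<omega>. ((\<Sum>i<n. Im (g (\<eta> i \<omega>))) / real n - (\<integral>x. Im (g x) \<partial>P))\<^sup>2"
  have eq: "(cmod (?W \<omega>))\<^sup>2 = ?A \<omega> + ?B \<omega>" for \<omega>
    using gi by (simp add: cmod_power2 Re_divide_of_nat Im_divide_of_nat)
  have iW: "integrable M (\<lambda>\<omega>. (cmod (?W \<omega>))\<^sup>2)"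
    unfolding eq using R(1) J(1) by simp
  have "expectation (\<lambda>\<omega>. (cmod (?W \<omega>))\<^sup>2) = expectation ?A + expectation ?B"
    unfolding eq using R(1) J(1) by simp
  also have "\<dots> \<le> (\<integral>x. (Re (g x))\<^sup>2 \<partial>P) / real n + (\<integral>x. (Im (g x))\<^sup>2 \<partial>P) / real n"
    using R(2) J(2) by (intro add_mono) auto
  also have "\<dots> = (\<integral>x. (cmod (g x))\<^sup>2 \<partial>P) / real n"
    using sR sI by (simp add: cmod_power2 add_divide_distrib)
  finally have E: "expectation (\<lambda>\<omega>. (cmod (?W \<omega>))\<^sup>2) \<le> (\<integral>x. (cmod (g x))\<^sup>2 \<partial>P) / real n" .
  have "{\<omega> \<in> space M. t \<le> cmod (?W \<omega>)} = {\<omega> \<in> space M. t\<^sup>2 \<le> (cmod (?W \<omega>))\<^sup>2}"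
    using t by (auto simp: abs_le_square_iff[symmetric])
  then have "prob {\<omega> \<in> space M. t \<le> cmod (?W \<omega>)} = prob {\<omega> \<in> space M. t\<^sup>2 \<le> (cmod (?W \<omega>))\<^sup>2}" by simp
  also have "\<dots> \<le> expectation (\<lambda>\<omega>. (cmod (?W \<omega>))\<^sup>2) / t\<^sup>2"
    by (rule integral_Markov_inequality_measure[OF iW, where A="{}"]) (use t in auto)
  also have "\<dots> \<le> (\<integral>x. (cmod (g x))\<^sup>2 \<partial>P) / real n / t\<^sup>2"
    using E by (intro divide_right_mono) auto
  finally show ?thesis by simp
qed

lemma power_le_one_plus_power:
  fixes r :: real
  assumes "0 \<le> r" "k \<le> m"
  shows "r ^ k \<le> 1 + r ^ m"
proof (cases "r \<le> 1")
  case True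
  then have "r ^ k \<le> 1" using assms by (simp add: power_le_one)
  then show ?thesis using assms by (simp add: add_increasing2)
next
  case False
  then have "r ^ k \<le> r ^ m" using assms by (intro power_increasing) auto
  then show ?thesis by simp
qed

lemma iexp_lipschitz: "cmod (iexp a - iexp b) \<le> \<bar>a - b\<bar>"
proof -
  have "iexp a - iexp b = iexp b * (iexp (a - b) - 1)"
    by (simp add: right_diff_distrib flip: exp_add)
  then have "cmod (iexp a - iexp b) = cmod (iexp (a - b) - 1)"
    by (simp only: norm_mult norm_exp_i_times mult_1)
  also have "\<dots> \<le> \<bar>a - b\<bar>" using iexp_approx1[of "a - b" 0] by simp
  finally show ?thesis .
qed

abbreviation (input) moment_kernel :: "'a::euclidean_space \<Rightarrow> nat \<Rightarrow> 'a \<Rightarrow> 'a \<Rightarrow> complex" where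
  "moment_kernel e j u x \<equiv> (\<i> * complex_of_real (e \<bullet> x)) ^ j * iexp (u \<bullet> x)"

lemma moment_kernel_norm_le:
  assumes "norm e \<le> 1"
  shows "cmod (moment_kernel e j u x) \<le> norm x ^ j"
proof -
  have "\<bar>e \<bullet> x\<bar> \<le> norm e * norm x" by (rule Cauchy_Schwarz_ineq2)
  also have "\<dots> \<le> norm x" using assms by (simp add: mult_left_le_one_le)
  finally show ?thesis by (simp add: norm_mult norm_power power_mono)
qed

text \<open>One Lipschitz constant, \<open>1 + norm x ^ 5\<close>, serves all orders up to four. It
  is integrable, which allows interpolation between grid points both for the empirical and for the
  true moments.\<close>

lemma moment_kernel_lipschitz:
  assumes e: "norm e \<le> 1" and j: "j \<le> 4"
  shows "cmod (moment_kernel e j u x - moment_kernel e j v x) \<le> norm (u - v) * (1 + norm x ^ 5)"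
proof -
  have "\<bar>e \<bullet> x\<bar> \<le> norm e * norm x" by (rule Cauchy_Schwarz_ineq2)
  also have "\<dots> \<le> norm x" using e by (simp add: mult_left_le_one_le)
  finally have ex: "\<bar>e \<bullet> x\<bar> \<le> norm x" .
  have "cmod (moment_kernel e j u x - moment_kernel e j v x) = \<bar>e \<bullet> x\<bar> ^ j * cmod (iexp (u \<bullet> x) - iexp (v \<bullet> x))"
    by (simp add: norm_mult norm_power flip: right_diff_distrib)
  also have "\<dots> \<le> norm x ^ j * (norm (u - v) * norm x)"
  proof (intro mult_mono power_mono ex)
    have "cmod (iexp (u \<bullet> x) - iexp (v \<bullet> x)) \<le> \<bar>(u - v) \<bullet> x\<bar>"
      using iexp_lipschitz[of "u \<bullet> x" "v \<bullet> x"] by (simp add: inner_diff_left)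
    also have "\<dots> \<le> norm (u - v) * norm x" by (rule Cauchy_Schwarz_ineq2)
    finally show "cmod (iexp (u \<bullet> x) - iexp (v \<bullet> x)) \<le> norm (u - v) * norm x" .
  qed auto
  also have "\<dots> = norm (u - v) * norm x ^ Suc j" by simp
  also have "\<dots> \<le> norm (u - v) * (1 + norm x ^ 5)"
    using power_le_one_plus_power[of "norm x" "Suc j" 5] j by (intro mult_left_mono) auto
  finally show ?thesis .
qed

lemma lower_moment_integrable:
  fixes P :: "'b::euclidean_space measure"
  assumes "prob_space P" and [measurable_cong]: "sets P = sets borel"
    and "integrable P (\<lambda>x. norm x ^ m)" "k \<le> m"
  shows "integrable P (\<lambda>x. norm x ^ k)"
proof -
  interpret P: prob_space P by fact
  have i: "integrable P (\<lambda>x. 1 + norm x ^ m)" using assms(3) by simp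
  show ?thesis
    using power_le_one_plus_power[OF norm_ge_zero assms(4)]
    by (intro Bochner_Integration.integrable_bound[OF i] AE_I2) (auto intro!: order_trans[OF _ abs_ge_self])
qed

section \<open>Empirical Fourier moments of the increments of a Levy process\<close>

locale levy_sample =
  fixes M :: "'w measure" and X :: "real \<Rightarrow> 'w \<Rightarrow> real \<times> real"
  assumes levy: "levy_process M X"
    and eighth_moment: "integrable (distr M borel (X 1)) (\<lambda>x. norm x ^ 8)"
begin

sublocale prob_space M using levy by (simp add: levy_process_def)

abbreviation P :: "(real \<times> real) measure" where "P \<equiv> distr M borel (X 1)"
abbreviation sample :: "'w \<Rightarrow> nat \<Rightarrow> real \<times> real" where "sample \<omega> \<equiv> (\<lambda>t. X (real t) \<omega>)"
abbreviation incr :: "'w \<Rightarrow> nat \<Rightarrow> real \<times> real" where "incr \<omega> t \<equiv> increment (sample \<omega>) t"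

lemma X_measurable [measurable]: "0 \<le> t \<Longrightarrow> X t \<in> borel_measurable M"
  using levy by (simp add: levy_process_def)

lemma incr_measurable [measurable]: "(\<lambda>\<omega>. incr \<omega> t) \<in> borel_measurable M"
  unfolding increment_def by measurable

sublocale P: prob_space P by (rule prob_space_distr) measurable

lemma moments_P: "k \<le> 8 \<Longrightarrow> integrable P (\<lambda>x. norm x ^ k)"
  by (rule lower_moment_integrable[OF P.prob_space_axioms _ eighth_moment]) simp_all

definition \<eta> :: "nat \<Rightarrow> 'w \<Rightarrow> real \<times> real" where "\<eta> i \<omega> = X (real (Suc i)) \<omega> - X (real i) \<omega>"

lemma \<eta>_measurable [measurable]: "\<eta> i \<in> borel_measurable M"
  unfolding \<eta>_def by measurable

lemma \<eta>_indep: "indep_vars (\<lambda>_. borel) \<eta> {..<n}"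
proof -
  have "\<forall>(n::nat) (t::nat \<Rightarrow> real). 0 \<le> t 0 \<and> (\<forall>i<n. t i < t (Suc i)) \<longrightarrow>
        indep_vars (\<lambda>_. borel) (\<lambda>i \<omega>. X (t (Suc i)) \<omega> - X (t i) \<omega>) {..<n}"
    using levy by (simp add: levy_process_def)
  from this[rule_format, of "\<lambda>i. real i" n] show ?thesis by (simp add: \<eta>_def[abs_def])
qed

lemma \<eta>_distr: "distr M borel (\<eta> i) = P"
proof -
  have "\<forall>s\<ge>0. \<forall>t\<ge>0. distr M borel (\<lambda>\<omega>. X (s + t) \<omega> - X s \<omega>) = distr M borel (X t)"
    using levy by (simp add: levy_process_def)
  from this[rule_format, of "real i" 1] show ?thesis by (simp add: \<eta>_def[abs_def] add.commute)
qed

text \<open>Independence and stationarity are available for \<open>\<eta>\<close>, whereas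
  \<open>increment\<close> replaces the initial value by 0. The two agree almost surely because
  \<open>X 0 = 0\<close> almost surely; note the index shift.\<close>

lemma incr_AE: "AE \<omega> in M. \<forall>i. incr \<omega> (Suc i) = \<eta> i \<omega>"
proof -
  have "AE \<omega> in M. X 0 \<omega> = 0" using levy by (simp add: levy_process_def)
  then show ?thesis
  proof eventually_elim
    case (elim \<omega>)
    show ?case
    proof
      fix i show "incr \<omega> (Suc i) = \<eta> i \<omega>"
        using elim by (cases i) (auto simp: increment_def \<eta>_def)
    qed
  qed
qed

definition ecf_moment :: "nat \<Rightarrow> 'w \<Rightarrow> real \<times> real \<Rightarrow> nat \<Rightarrow> real \<times> real \<Rightarrow> complex" where
  "ecf_moment n \<omega> e j u = (\<Sum>t=1..n. moment_kernel e j u (incr \<omega> t)) / of_nat n"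

lemma partial_deriv_ecf: "(partial_deriv e ^^ j) (ecf n (sample \<omega>)) = ecf_moment n \<omega> e j"
  by (simp add: partial_deriv_iter_ecf ecf_moment_def fun_eq_iff)

lemma partial_deriv_cf:
  assumes "j \<le> 4"
  shows "(partial_deriv e ^^ j) (fourier_measure P) = fourier_moment P e j"
proof (rule partial_deriv_iter_fourier_measure[of _ 4])
  fix k :: nat assume k: "k \<le> 4 + 1"
  have i: "integrable P (\<lambda>x. norm e ^ k * norm x ^ k)" using moments_P[of k] k by simp
  show "integrable P (\<lambda>x. \<bar>e \<bullet> x\<bar> ^ k)"
    by (rule Bochner_Integration.integrable_bound[OF i])
       (auto simp: Cauchy_Schwarz_ineq2 power_mono simp flip: power_mult_distrib)
qed (use assms in auto)

lemma moment_kernel_integrable: "norm e \<le> 1 \<Longrightarrow> j \<le> 8 \<Longrightarrow> integrable P (moment_kernel e j u)"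
proof (rule Bochner_Integration.integrable_bound[OF moments_P[of j]])
  assume e: "norm e \<le> 1"
  show "AE x in P. norm (moment_kernel e j u x) \<le> norm (norm x ^ j)"
    using moment_kernel_norm_le[OF e] by (intro AE_I2) simp
qed (assumption, measurable)

text \<open>\<open>lip_moment\<close> is the mean Lipschitz constant of the moment kernels and also
  bounds the true Fourier moments. \<open>var_moment\<close> bounds the second moments of the
  kernels for all orders up to four.\<close>

definition lip_moment :: real where "lip_moment = (\<integral>x. 1 + norm x ^ 5 \<partial>P)"
definition var_moment :: real where "var_moment = (\<integral>x. 1 + norm x ^ 8 \<partial>P)"

lemma lip_moment_ge_1: "1 \<le> lip_moment"
proof -
  have "(\<integral>x. 1 \<partial>P) \<le> lip_moment"
    unfolding lip_moment_def using moments_P[of 5] by (intro integral_mono) auto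
  then show ?thesis using P.prob_space by simp
qed

lemma ecf_moment_measurable [measurable]: "(\<lambda>\<omega>. ecf_moment n \<omega> e j u) \<in> borel_measurable M"
  unfolding ecf_moment_def by measurable

text \<open>The squared modulus of the kernel of order four is of size \<open>norm x ^ 8\<close>;
  this is where the eighth moment of \<open>P\<close> enters.\<close>

lemma ecf_moment_deviation_prob:
  assumes e: "norm e \<le> 1" and j: "j \<le> 4" and n: "0 < n" and t: "0 < t"
  shows "prob {\<omega> \<in> space M. t \<le> cmod (ecf_moment n \<omega> e j u - fourier_moment P e j u)} \<le> var_moment / (real n * t\<^sup>2)"
proof -
  have sq: "(cmod (moment_kernel e j u x))\<^sup>2 \<le> 1 + norm x ^ 8" for x
  proof -
    have "(cmod (moment_kernel e j u x))\<^sup>2 \<le> (norm x ^ j)\<^sup>2"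
      by (intro power_mono moment_kernel_norm_le e) simp
    also have "\<dots> = norm x ^ (2 * j)" by (simp add: mult.commute flip: power_mult)
    also have "\<dots> \<le> 1 + norm x ^ 8" using j by (intro power_le_one_plus_power) auto
    finally show ?thesis .
  qed
  have i8: "integrable P (\<lambda>x. 1 + norm x ^ 8)" using moments_P[of 8] by simp
  have sqi: "integrable P (\<lambda>x. (cmod (moment_kernel e j u x))\<^sup>2)"
    by (rule Bochner_Integration.integrable_bound[OF i8]) (use sq in \<open>auto intro!: AE_I2 order_trans[OF _ abs_ge_self]\<close>)
  have "prob {\<omega> \<in> space M. t \<le> cmod (ecf_moment n \<omega> e j u - fourier_moment P e j u)} =
     prob {\<omega> \<in> space M. t \<le> cmod ((\<Sum>i<n. moment_kernel e j u (\<eta> i \<omega>)) / of_nat n - (\<integral>x. moment_kernel e j u x \<partial>P))}"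
  proof (rule finite_measure_eq_AE)
    show "AE \<omega> in M. \<omega> \<in> {\<omega> \<in> space M. t \<le> cmod (ecf_moment n \<omega> e j u - fourier_moment P e j u)} \<longleftrightarrow>
       \<omega> \<in> {\<omega> \<in> space M. t \<le> cmod ((\<Sum>i<n. moment_kernel e j u (\<eta> i \<omega>)) / of_nat n - (\<integral>x. moment_kernel e j u x \<partial>P))}"
      using incr_AE
    proof eventually_elim
      case (elim \<omega>)
      have "(\<Sum>t=1..n. moment_kernel e j u (incr \<omega> t)) = (\<Sum>i<n. moment_kernel e j u (\<eta> i \<omega>))"
        using elim by (simp add: sum.atLeast1_atMost_eq)
      then show ?case by (simp add: ecf_moment_def fourier_moment_def)
    qed
  qed measurable
  also have "\<dots> \<le> (\<integral>x. (cmod (moment_kernel e j u x))\<^sup>2 \<partial>P) / (real n * t\<^sup>2)"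
    by (rule iid_mean_deviation[OF \<eta>_indep \<eta>_distr _ sqi n t]) measurable
  also have "\<dots> \<le> var_moment / (real n * t\<^sup>2)"
    unfolding var_moment_def using sq by (intro divide_right_mono integral_mono sqi i8) auto
  finally show ?thesis .
qed

lemma mean_lipschitz_prob:
  assumes n: "0 < n" and L: "0 < L"
  shows "prob {\<omega> \<in> space M. L \<le> (\<Sum>t=1..n. 1 + norm (incr \<omega> t) ^ 5) / real n} \<le> lip_moment / L"
proof -
  have i5: "integrable P (\<lambda>x. 1 + norm x ^ 5)" using moments_P[of 5] by simp
  have \<eta>i: "integrable M (\<lambda>\<omega>. 1 + norm (\<eta> i \<omega>) ^ 5)" for i
    using i5 unfolding \<eta>_distr[of i, symmetric] by (subst (asm) integrable_distr_eq) auto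
  have \<eta>v: "(\<integral>\<omega>. 1 + norm (\<eta> i \<omega>) ^ 5 \<partial>M) = lip_moment" for i
    unfolding lip_moment_def \<eta>_distr[of i, symmetric] by (subst integral_distr) auto
  let ?W = "\<lambda>\<omega>. (\<Sum>i<n. 1 + norm (\<eta> i \<omega>) ^ 5) / real n"
  have Wi: "integrable M ?W" using \<eta>i by (intro integrable_divide_zero Bochner_Integration.integrable_sum) auto
  have Wv: "expectation ?W = lip_moment"
  proof -
    have "expectation (\<lambda>\<omega>. \<Sum>i<n. 1 + norm (\<eta> i \<omega>) ^ 5) = (\<Sum>i<n. expectation (\<lambda>\<omega>. 1 + norm (\<eta> i \<omega>) ^ 5))"
      by (rule Bochner_Integration.integral_sum) (rule \<eta>i)
    then have "expectation (\<lambda>\<omega>. \<Sum>i<n. 1 + norm (\<eta> i \<omega>) ^ 5) = (\<Sum>i<n. lip_moment)"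
      by (simp only: \<eta>v)
    then show ?thesis using n by simp
  qed
  have "prob {\<omega> \<in> space M. L \<le> (\<Sum>t=1..n. 1 + norm (incr \<omega> t) ^ 5) / real n} = prob {\<omega> \<in> space M. L \<le> ?W \<omega>}"
  proof (rule finite_measure_eq_AE)
    show "AE \<omega> in M. \<omega> \<in> {\<omega> \<in> space M. L \<le> (\<Sum>t=1..n. 1 + norm (incr \<omega> t) ^ 5) / real n} \<longleftrightarrow>
       \<omega> \<in> {\<omega> \<in> space M. L \<le> ?W \<omega>}"
      using incr_AE by eventually_elim (simp add: sum.atLeast1_atMost_eq)
  qed measurable
  also have "\<dots> \<le> expectation ?W / L"
    by (rule integral_Markov_inequality_measure[OF Wi, where A="{}"]) (use L in \<open>auto intro!: divide_nonneg_nonneg sum_nonneg\<close>)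
  finally show ?thesis unfolding Wv .
qed

text \<open>Union bound over a grid of mesh \<open>\<epsilon>\<close>, two directions and five
  orders, hence the factor 10. Off the grid the Lipschitz constants take over, the empirical one
  being below \<open>L\<close> outside an event controlled by Markov. The displacement from the grid
  is at most \<open>2 * \<epsilon>\<close>.\<close>

lemma uniform_deviation:
  assumes n: "0 < n" and t: "0 < t" and \<epsilon>: "0 < \<epsilon>" and L: "0 < L" and R: "0 \<le> R"
  shows "\<exists>G\<in>sets M. prob (space M - G) \<le> lip_moment / L + 10 * (2 * (R / \<epsilon>) + 3)\<^sup>2 * (var_moment / (real n * t\<^sup>2)) \<and>
     (\<forall>\<omega>\<in>G. \<forall>e\<in>{(1, 0), (0, 1)}. \<forall>j\<le>4. \<forall>u. \<bar>fst u\<bar> \<le> R \<longrightarrow> \<bar>snd u\<bar> \<le> R \<longrightarrow>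
        cmod (ecf_moment n \<omega> e j u - fourier_moment P e j u) \<le> t + 2 * \<epsilon> * (L + lip_moment))"
proof -
  \<comment> \<open>The grid has at most \<open>2 * m + 1\<close> points per axis, and rounding up
    makes this at most \<open>2 * (R / \<epsilon>) + 3\<close>.\<close>
  define m where "m = \<lceil>R / \<epsilon>\<rceil>"
  have Re: "0 \<le> R / \<epsilon>" using R \<epsilon> by simp
  then have m0: "0 \<le> m" unfolding m_def by linarith
  define D where "D = (\<lambda>k::int. \<epsilon> * of_int k) ` {-m..m}"
  have D_fin: "finite D" by (simp add: D_def)
  have D_card: "real (card D) \<le> 2 * (R / \<epsilon>) + 3"
  proof -
    have "card D \<le> card {-m..m}" unfolding D_def by (rule card_image_le) simp
    also have "card {-m..m} = nat (2 * m + 1)" by simp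
    finally have "real (card D) \<le> real (nat (2 * m + 1))" by linarith
    also have "\<dots> = 2 * real_of_int m + 1" using m0 by simp
    also have "\<dots> \<le> 2 * (R / \<epsilon>) + 3" unfolding m_def by linarith
    finally show ?thesis .
  qed
  let ?E = "{(1, 0), (0, 1)} :: (real \<times> real) set"
  have E1: "norm e \<le> 1" if "e \<in> ?E" for e using that by (auto simp: norm_prod_def)
  define I where "I = ?E \<times> {..4::nat} \<times> D \<times> D"
  define A where "A = (\<lambda>(e, j, d1, d2). {\<omega> \<in> space M. t \<le> cmod (ecf_moment n \<omega> e j (d1, d2) - fourier_moment P e j (d1, d2))})"
  define A0 where "A0 = {\<omega> \<in> space M. L \<le> (\<Sum>t=1..n. 1 + norm (incr \<omega> t) ^ 5) / real n}"
  have I_fin: "finite I" using D_fin by (simp add: I_def)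
  have I_card: "real (card I) \<le> 10 * (2 * (R / \<epsilon>) + 3)\<^sup>2"
  proof -
    have "card I = 10 * (card D * card D)" by (simp add: I_def card_cartesian_product)
    then have "real (card I) = 10 * (real (card D) * real (card D))" by simp
    also have "\<dots> \<le> 10 * ((2 * (R / \<epsilon>) + 3) * (2 * (R / \<epsilon>) + 3))"
      using D_card Re by (intro mult_left_mono mult_mono) auto
    finally show ?thesis by (simp add: power2_eq_square)
  qed
  have A_sets: "A i \<in> events" for i unfolding A_def by (cases i) (simp, measurable)
  have A0_sets: "A0 \<in> events" unfolding A0_def by measurable
  define G where "G = space M - (A0 \<union> (\<Union>i\<in>I. A i))"
  have G_sets: "G \<in> events" unfolding G_def by (intro sets.Diff sets.top sets.Un A0_sets sets.finite_UN I_fin A_sets)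
  have v0: "0 \<le> var_moment" unfolding var_moment_def by (intro integral_nonneg_AE) auto
  have "space M - G = A0 \<union> (\<Union>i\<in>I. A i)"
    unfolding G_def using A_sets A0_sets sets.sets_into_space by (auto simp: A_def A0_def)
  then have s1: "prob (space M - G) \<le> prob A0 + prob (\<Union>i\<in>I. A i)"
    using A_sets A0_sets I_fin by (simp only:) (intro measure_Un_le A0_sets sets.finite_UN I_fin A_sets)
  have "prob (\<Union>i\<in>I. A i) \<le> (\<Sum>i\<in>I. prob (A i))"
    using A_sets I_fin by (intro finite_measure_subadditive_finite) auto
  also have "\<dots> \<le> (\<Sum>i\<in>I. var_moment / (real n * t\<^sup>2))"
  proof (rule sum_mono)
    fix i assume "i \<in> I"
    then obtain e j d1 d2 where i: "i = (e, j, d1, d2)" "e \<in> ?E" "j \<le> 4" unfolding I_def by auto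
    show "prob (A i) \<le> var_moment / (real n * t\<^sup>2)"
      using ecf_moment_deviation_prob[OF E1[OF i(2)] i(3) n t, of "(d1, d2)"] by (simp add: i(1) A_def)
  qed
  also have "\<dots> = real (card I) * (var_moment / (real n * t\<^sup>2))" by simp
  also have "\<dots> \<le> 10 * (2 * (R / \<epsilon>) + 3)\<^sup>2 * (var_moment / (real n * t\<^sup>2))"
    using I_card v0 by (intro mult_right_mono) auto
  finally have s2: "prob (\<Union>i\<in>I. A i) \<le> 10 * (2 * (R / \<epsilon>) + 3)\<^sup>2 * (var_moment / (real n * t\<^sup>2))" .
  have s3: "prob A0 \<le> lip_moment / L" unfolding A0_def by (rule mean_lipschitz_prob[OF n L])
  have pG: "prob (space M - G) \<le> lip_moment / L + 10 * (2 * (R / \<epsilon>) + 3)\<^sup>2 * (var_moment / (real n * t\<^sup>2))"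
    by (rule order_trans[OF s1 add_mono[OF s3 s2]])
  have dev: "cmod (ecf_moment n \<omega> e j u - fourier_moment P e j u) \<le> t + 2 * \<epsilon> * (L + lip_moment)"
    if w: "\<omega> \<in> G" and e: "e = (1, 0) \<or> e = (0, 1)" and j: "j \<le> 4" and u: "\<bar>fst u\<bar> \<le> R" "\<bar>snd u\<bar> \<le> R"
    for \<omega> :: 'w and e :: "real \<times> real" and j :: nat and u :: "real \<times> real"
  proof -
    \<comment> \<open>Rounding down selects a grid point within the mesh; its index stays in range
      because \<open>-m\<close> is an integer below \<open>- (R / \<epsilon>)\<close>.\<close>
    have gd: "\<epsilon> * of_int \<lfloor>r / \<epsilon>\<rfloor> \<in> D" "\<bar>r - \<epsilon> * of_int \<lfloor>r / \<epsilon>\<rfloor>\<bar> \<le> \<epsilon>" if r: "\<bar>r\<bar> \<le> R" for r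
    proof -
      have "r / \<epsilon> \<le> R / \<epsilon>" using r \<epsilon> by (intro divide_right_mono) auto
      moreover have "(- R) / \<epsilon> \<le> r / \<epsilon>" using r \<epsilon> by (intro divide_right_mono) auto
      ultimately have "r / \<epsilon> \<le> R / \<epsilon>" "- (R / \<epsilon>) \<le> r / \<epsilon>" by simp_all
      then have "\<lfloor>r / \<epsilon>\<rfloor> \<le> m" "- m \<le> \<lfloor>r / \<epsilon>\<rfloor>" unfolding m_def by linarith+
      then show "\<epsilon> * of_int \<lfloor>r / \<epsilon>\<rfloor> \<in> D" by (auto simp: D_def)
      have "of_int \<lfloor>r / \<epsilon>\<rfloor> \<le> r / \<epsilon>" "r / \<epsilon> \<le> of_int \<lfloor>r / \<epsilon>\<rfloor> + 1" by linarith+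
      then have "\<epsilon> * of_int \<lfloor>r / \<epsilon>\<rfloor> \<le> \<epsilon> * (r / \<epsilon>)" "\<epsilon> * (r / \<epsilon>) \<le> \<epsilon> * (of_int \<lfloor>r / \<epsilon>\<rfloor> + 1)"
        by (simp_all only: mult_le_cancel_left_pos[OF \<epsilon>])
      then show "\<bar>r - \<epsilon> * of_int \<lfloor>r / \<epsilon>\<rfloor>\<bar> \<le> \<epsilon>" using \<epsilon> by (simp add: algebra_simps)
    qed
    define v where "v = (\<epsilon> * of_int \<lfloor>fst u / \<epsilon>\<rfloor>, \<epsilon> * of_int \<lfloor>snd u / \<epsilon>\<rfloor>)"
    have eE: "e \<in> ?E" using e by auto
    have uv: "norm (u - v) \<le> 2 * \<epsilon>"
    proof -
      have "norm (u - v) \<le> \<bar>fst (u - v)\<bar> + \<bar>snd (u - v)\<bar>"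
        using norm_Pair_le[of "fst (u - v)" "snd (u - v)"] unfolding prod.collapse by simp
      then show ?thesis using gd(2)[OF u(1)] gd(2)[OF u(2)] by (simp add: v_def)
    qed
    have wsp: "\<omega> \<in> space M" using w by (simp add: G_def)
    have "(e, j, v) \<in> I" using eE j gd(1) u by (auto simp: I_def v_def)
    then have "\<omega> \<notin> A (e, j, v)" using w by (auto simp: G_def)
    then have a: "cmod (ecf_moment n \<omega> e j v - fourier_moment P e j v) \<le> t"
      using wsp by (simp add: A_def v_def)
    have "\<omega> \<notin> A0" using w by (simp add: G_def)
    then have l: "(\<Sum>t=1..n. 1 + norm (incr \<omega> t) ^ 5) / real n \<le> L" using wsp by (simp add: A0_def)
    have b: "cmod (ecf_moment n \<omega> e j u - ecf_moment n \<omega> e j v) \<le> 2 * \<epsilon> * L"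
    proof -
      have "ecf_moment n \<omega> e j u - ecf_moment n \<omega> e j v =
         (\<Sum>t=1..n. moment_kernel e j u (incr \<omega> t) - moment_kernel e j v (incr \<omega> t)) / of_nat n"
        unfolding ecf_moment_def sum_subtractf by (rule diff_divide_distrib[symmetric])
      then have "cmod (ecf_moment n \<omega> e j u - ecf_moment n \<omega> e j v) =
         cmod (\<Sum>t=1..n. moment_kernel e j u (incr \<omega> t) - moment_kernel e j v (incr \<omega> t)) / real n"
        by (simp only: norm_divide norm_of_nat)
      also have "\<dots> \<le> (\<Sum>t=1..n. norm (u - v) * (1 + norm (incr \<omega> t) ^ 5)) / real n"
        by (intro divide_right_mono sum_norm_le moment_kernel_lipschitz E1[OF eE] j) simp
      also have "\<dots> = norm (u - v) * ((\<Sum>t=1..n. 1 + norm (incr \<omega> t) ^ 5) / real n)"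
        by (simp only: sum_distrib_left times_divide_eq_right)
      also have "\<dots> \<le> 2 * \<epsilon> * L"
        using uv l \<epsilon> by (intro mult_mono) (auto intro!: divide_nonneg_nonneg sum_nonneg)
      finally show ?thesis .
    qed
    have c: "cmod (fourier_moment P e j v - fourier_moment P e j u) \<le> 2 * \<epsilon> * lip_moment"
    proof -
      have "fourier_moment P e j v - fourier_moment P e j u = (\<integral>x. moment_kernel e j v x - moment_kernel e j u x \<partial>P)"
        unfolding fourier_moment_def
        using moment_kernel_integrable[OF E1[OF eE], of j] j by (intro Bochner_Integration.integral_diff[symmetric]) auto
      also have "cmod \<dots> \<le> (\<integral>x. norm (v - u) * (1 + norm x ^ 5) \<partial>P)"
        using moments_P[of 5] moment_kernel_lipschitz[OF E1[OF eE] j]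
        by (intro norm_integral_le AE_I2) auto
      also have "\<dots> = norm (u - v) * lip_moment" by (simp add: lip_moment_def norm_minus_commute)
      also have "\<dots> \<le> 2 * \<epsilon> * lip_moment" using uv lip_moment_ge_1 by (intro mult_right_mono) auto
      finally show ?thesis .
    qed
    have "cmod (ecf_moment n \<omega> e j u - fourier_moment P e j u) \<le>
       cmod (ecf_moment n \<omega> e j v - fourier_moment P e j v) + cmod (ecf_moment n \<omega> e j u - ecf_moment n \<omega> e j v)
        + cmod (fourier_moment P e j v - fourier_moment P e j u)"
      by (rule order_trans[OF _ add_right_mono[OF norm_triangle_ineq]], rule order_trans[OF _ norm_triangle_ineq]) simp
    then show ?thesis using a b c by (simp add: algebra_simps)
  qed
  show ?thesis using G_sets pG dev by blast
qed

end

section \<open>Stability of the fourth cumulant\<close>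

text \<open>The classical expression of the fourth cumulant in raw moments. Inserting the quotients
  of the derivatives by the function itself gives the fourth logarithmic derivative.\<close>

definition cumulant4 :: "complex \<Rightarrow> complex \<Rightarrow> complex \<Rightarrow> complex \<Rightarrow> complex" where
  "cumulant4 q1 q2 q3 q4 = q4 - 4 * (q1 * q3) - 3 * q2\<^sup>2 + 12 * (q1\<^sup>2 * q2) - 6 * q1 ^ 4"

lemma log_deriv4_eq_cumulant4:
  fixes d :: "nat \<Rightarrow> complex"
  assumes "\<And>j. j \<le> 4 \<Longrightarrow> (partial_deriv e ^^ j) f u = d j"
  shows "log_deriv4 e f u = cumulant4 (d 1 / d 0) (d 2 / d 0) (d 3 / d 0) (d 4 / d 0)"
proof -
  have "f u = d 0" using assms[of 0] by simp
  then show ?thesis using assms[of 1] assms[of 2] assms[of 3] assms[of 4]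
    by (simp add: log_deriv4_def Let_def cumulant4_def power2_eq_square power_divide power4_eq_xxxx power3_eq_cube)
qed

lemma norm_mult_diff_le:
  fixes a b c d :: complex
  assumes "cmod a \<le> A" "cmod d \<le> D" "cmod (a - c) \<le> s" "cmod (b - d) \<le> r"
  shows "cmod (a * b - c * d) \<le> A * r + s * D"
proof -
  have "a * b - c * d = a * (b - d) + (a - c) * d" by (simp add: algebra_simps)
  then have "cmod (a * b - c * d) \<le> cmod a * cmod (b - d) + cmod (a - c) * cmod d"
    by (metis norm_mult norm_triangle_ineq)
  also have "\<dots> \<le> A * r + s * D"
    using assms by (intro add_mono mult_mono) (auto intro: order_trans[OF norm_ge_zero])
  finally show ?thesis .
qed

text \<open>Telescoping each monomial gives \<open>s * (1 + 14 * Q + 36 * Q^2 + 24 * Q^3)\<close>,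
  and \<open>Q \<ge> 1\<close> collects this into \<open>75 * Q^3 * s\<close>.\<close>

lemma cumulant4_lipschitz:
  fixes p q :: "nat \<Rightarrow> complex"
  assumes Q: "1 \<le> Q" and q: "\<And>j. j \<in> {1..4} \<Longrightarrow> cmod (q j) \<le> Q" and p: "\<And>j. j \<in> {1..4} \<Longrightarrow> cmod (p j) \<le> Q"
    and s: "\<And>j. j \<in> {1..4} \<Longrightarrow> cmod (q j - p j) \<le> s"
  shows "cmod (cumulant4 (q 1) (q 2) (q 3) (q 4) - cumulant4 (p 1) (p 2) (p 3) (p 4)) \<le> 75 * Q ^ 3 * s"
proof -
  have B: "cmod (q 1) \<le> Q" "cmod (q 2) \<le> Q" "cmod (q 3) \<le> Q" "cmod (p 1) \<le> Q" "cmod (p 2) \<le> Q" "cmod (p 3) \<le> Q"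
    and S: "cmod (q 1 - p 1) \<le> s" "cmod (q 2 - p 2) \<le> s" "cmod (q 3 - p 3) \<le> s" "cmod (q 4 - p 4) \<le> s"
    using q p s by auto
  have s0: "0 \<le> s" using order_trans[OF norm_ge_zero S(1)] .
  have Q0: "0 \<le> Q" using Q by simp
  have a13: "cmod (q 1 * q 3 - p 1 * p 3) \<le> Q * s + s * Q" by (rule norm_mult_diff_le; fact)
  have a22: "cmod (q 2 * q 2 - p 2 * p 2) \<le> Q * s + s * Q" by (rule norm_mult_diff_le; fact)
  have a11: "cmod (q 1 * q 1 - p 1 * p 1) \<le> Q * s + s * Q" by (rule norm_mult_diff_le; fact)
  have b11: "cmod (q 1 * q 1) \<le> Q * Q" "cmod (p 1 * p 1) \<le> Q * Q"
    unfolding norm_mult using B Q0 by (auto intro!: mult_mono)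
  have a112: "cmod (q 1 * q 1 * q 2 - p 1 * p 1 * p 2) \<le> Q * Q * s + (Q * s + s * Q) * Q"
    by (rule norm_mult_diff_le; fact)
  have a1111: "cmod (q 1 * q 1 * (q 1 * q 1) - p 1 * p 1 * (p 1 * p 1)) \<le> Q * Q * (Q * s + s * Q) + (Q * s + s * Q) * (Q * Q)"
    by (rule norm_mult_diff_le; fact)
  have tri: "cmod (a - b - c + d - e) \<le> cmod a + cmod b + cmod c + cmod d + cmod e" for a b c d e
    using norm_triangle_ineq4[of "a - b - c + d" e] norm_triangle_ineq[of "a - b - c" d]
      norm_triangle_ineq4[of "a - b" c] norm_triangle_ineq4[of a b] by linarith
  have eq: "cumulant4 (q 1) (q 2) (q 3) (q 4) - cumulant4 (p 1) (p 2) (p 3) (p 4) =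
      (q 4 - p 4) - 4 * (q 1 * q 3 - p 1 * p 3) - 3 * (q 2 * q 2 - p 2 * p 2)
      + 12 * (q 1 * q 1 * q 2 - p 1 * p 1 * p 2) - 6 * (q 1 * q 1 * (q 1 * q 1) - p 1 * p 1 * (p 1 * p 1))"
    by (simp add: cumulant4_def power2_eq_square power4_eq_xxxx algebra_simps)
  have "cmod (cumulant4 (q 1) (q 2) (q 3) (q 4) - cumulant4 (p 1) (p 2) (p 3) (p 4)) \<le> cmod (q 4 - p 4) + cmod (4 * (q 1 * q 3 - p 1 * p 3)) + cmod (3 * (q 2 * q 2 - p 2 * p 2))
      + cmod (12 * (q 1 * q 1 * q 2 - p 1 * p 1 * p 2)) + cmod (6 * (q 1 * q 1 * (q 1 * q 1) - p 1 * p 1 * (p 1 * p 1)))"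
    unfolding eq by (rule tri)
  also have "\<dots> \<le> s + 4 * (Q * s + s * Q) + 3 * (Q * s + s * Q) + 12 * (Q * Q * s + (Q * s + s * Q) * Q)
      + 6 * (Q * Q * (Q * s + s * Q) + (Q * s + s * Q) * (Q * Q))"
    unfolding norm_mult_numeral1 by (intro add_mono mult_left_mono S(4) a13 a22 a112 a1111) auto
  also have "\<dots> = s * 1 + 14 * (s * Q) + 36 * (s * Q\<^sup>2) + 24 * (s * Q ^ 3)"
    by (simp add: algebra_simps power2_eq_square power3_eq_cube)
  also have "\<dots> \<le> s * Q ^ 3 + 14 * (s * Q ^ 3) + 36 * (s * Q ^ 3) + 24 * (s * Q ^ 3)"
  proof -
    have "1 \<le> Q ^ 3" "Q \<le> Q ^ 3" "Q\<^sup>2 \<le> Q ^ 3"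
      using Q power_increasing[of 1 3 Q] power_increasing[of 2 3 Q] by (auto simp: one_le_power)
    then show ?thesis using s0 by (intro add_mono mult_left_mono) auto
  qed
  also have "\<dots> = 75 * Q ^ 3 * s" by simp
  finally show ?thesis .
qed

text \<open>The condition \<open>t \<le> m / 2\<close> keeps the perturbed denominator above
  \<open>m / 2\<close>. The quotients are then bounded by \<open>4 * B / m\<close> and move by at
  most \<open>4 * B * t / m^2\<close>, and 75 times \<open>4^4\<close> is 19200.\<close>

lemma cumulant4_perturbation:
  fixes d D :: "nat \<Rightarrow> complex"
  assumes m: "0 < m" "m \<le> 1" and B: "1 \<le> B" and t: "t \<le> m / 2"
    and D0: "m \<le> cmod (D 0)" and DB: "\<And>j. j \<le> 4 \<Longrightarrow> cmod (D j) \<le> B"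
    and dD: "\<And>j. j \<le> 4 \<Longrightarrow> cmod (d j - D j) \<le> t"
  shows "cmod (cumulant4 (d 1 / d 0) (d 2 / d 0) (d 3 / d 0) (d 4 / d 0)
     - cumulant4 (D 1 / D 0) (D 2 / D 0) (D 3 / D 0) (D 4 / D 0)) \<le> 19200 * B ^ 4 * t / m ^ 5"
proof -
  have t0: "0 \<le> t" using order_trans[OF norm_ge_zero dD[of 0]] by simp
  have d0: "m / 2 \<le> cmod (d 0)"
    using norm_triangle_ineq2[of "D 0" "d 0"] dD[of 0] D0 t by (simp add: norm_minus_commute)
  have nz: "d 0 \<noteq> 0" "D 0 \<noteq> 0" using d0 D0 m by auto
  have dB: "cmod (d j) \<le> 2 * B" if "j \<le> 4" for j
    using norm_triangle_ineq2[of "d j" "D j"] dD[OF that] DB[OF that] t m B by linarith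
  define Q where "Q = 4 * B / m"
  define s where "s = 4 * B * t / m\<^sup>2"
  have Q1: "1 \<le> Q" using m B by (simp add: Q_def le_divide_eq)
  have q: "cmod (d j / d 0) \<le> Q" if "j \<le> 4" for j
  proof -
    have "cmod (d j / d 0) \<le> 2 * B / (m / 2)"
      unfolding norm_divide using dB[OF that] d0 m B by (intro frac_le) auto
    then show ?thesis by (simp add: Q_def)
  qed
  have p: "cmod (D j / D 0) \<le> Q" if "j \<le> 4" for j
  proof -
    have "cmod (D j / D 0) \<le> 4 * B / m"
      unfolding norm_divide using DB[OF that] D0 m B by (intro frac_le) auto
    then show ?thesis by (simp add: Q_def)
  qed
  have sd: "cmod (d j / d 0 - D j / D 0) \<le> s" if j: "j \<le> 4" for j
  proof -
    have "d j / d 0 - D j / D 0 = (d j - D j) / d 0 + D j * (D 0 - d 0) / (d 0 * D 0)"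
      using nz by (simp add: field_simps)
    then have "cmod (d j / d 0 - D j / D 0) \<le> cmod ((d j - D j) / d 0) + cmod (D j * (D 0 - d 0) / (d 0 * D 0))"
      by (metis norm_triangle_ineq)
    also have "\<dots> \<le> t / (m / 2) + B * t / (m / 2 * m)"
      unfolding norm_divide norm_mult using dD[OF j] dD[of 0] DB[OF j] d0 D0 m B t0
      by (intro add_mono frac_le mult_mono) (auto simp: norm_minus_commute)
    also have "\<dots> = 2 * t * m / m\<^sup>2 + 2 * B * t / m\<^sup>2"
      using m by (simp add: field_simps power2_eq_square)
    also have "\<dots> \<le> 2 * B * t / m\<^sup>2 + 2 * B * t / m\<^sup>2"
    proof (intro add_mono divide_right_mono order_refl)
      have "t * m \<le> t * B" using m B t0 by (intro mult_left_mono) auto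
      then show "2 * t * m \<le> 2 * B * t" by (simp add: mult.commute)
    qed auto
    finally show ?thesis by (simp add: s_def)
  qed
  have "cmod (cumulant4 (d 1 / d 0) (d 2 / d 0) (d 3 / d 0) (d 4 / d 0)
     - cumulant4 (D 1 / D 0) (D 2 / D 0) (D 3 / D 0) (D 4 / D 0)) \<le> 75 * Q ^ 3 * s"
    using cumulant4_lipschitz[of Q "\<lambda>j. d j / d 0" "\<lambda>j. D j / D 0" s] Q1 q p sd by auto
  also have "\<dots> = 19200 * B ^ 4 * t / m ^ 5"
    using m by (simp add: Q_def s_def power_divide eval_nat_numeral)
  finally show ?thesis .
qed

lemma inner_power_le:
  fixes x :: "real \<times> real"
  shows "norm x ^ 8 \<le> 256 * (\<bar>(1, 0) \<bullet> x\<bar> ^ 8 + \<bar>(0, 1) \<bullet> x\<bar> ^ 8)"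
proof -
  let ?m = "max \<bar>fst x\<bar> \<bar>snd x\<bar>"
  have "norm x \<le> \<bar>fst x\<bar> + \<bar>snd x\<bar>" using norm_Pair_le[of "fst x" "snd x"] by simp
  then have "norm x \<le> 2 * ?m" by simp
  then have "norm x ^ 8 \<le> (2 * ?m) ^ 8" by (intro power_mono) auto
  also have "\<dots> = 256 * ?m ^ 8" by (simp add: power_mult_distrib)
  also have "?m ^ 8 \<le> \<bar>fst x\<bar> ^ 8 + \<bar>snd x\<bar> ^ 8" by (simp add: max_def)
  finally show ?thesis by (simp add: inner_prod_def)
qed

text \<open>Passage from moments of \<open>\<nu>\<close> to moments of the law: expand the exponent,
  exponentiate the expansion, and apply the difference argument in the two coordinate directions,
  which control the norm.\<close>

lemma levy_eighth_moment:
  fixes X :: "real \<Rightarrow> 'w \<Rightarrow> real \<times> real"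
  assumes levy: "levy_process_with_triplet M X \<Sigma> \<nu> \<alpha>"
    and mom: "\<And>k. 2 \<le> k \<Longrightarrow> k \<le> 8 \<Longrightarrow> integrable \<nu> (\<lambda>x. norm x ^ k)"
  shows "integrable (distr M borel (X 1)) (\<lambda>x. norm x ^ 8)"
proof -
  have lp: "levy_process M X" and cov: "covariance_operator \<Sigma>" and lm: "levy_measure \<nu>"
    and cf: "\<And>u. fourier_measure (distr M borel (X 1)) u = levy_khintchine \<Sigma> \<nu> \<alpha> u"
    using levy by (auto simp: levy_process_with_triplet_def)
  interpret M: prob_space M using lp by (simp add: levy_process_def)
  have X1: "X 1 \<in> borel_measurable M" using lp by (simp add: levy_process_def)
  have sn: "sets \<nu> = sets borel" using lm by (simp add: levy_measure_def)
  have lin: "linear \<Sigma>" using cov by (simp add: covariance_operator_def)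
  have i: "integrable (distr M borel (X 1)) (\<lambda>x. \<bar>e \<bullet> x\<bar> ^ 8)" for e
  proof -
    obtain p where "expands8 (\<lambda>s. levy_exponent \<Sigma> \<nu> \<alpha> (s *\<^sub>R e)) p" "poly p 0 = 0"
      using levy_exponent_expands8[OF sn mom lin] by blast
    then obtain q where "expands8 (\<lambda>s. exp (levy_exponent \<Sigma> \<nu> \<alpha> (s *\<^sub>R e))) q"
      using expands8_exp by blast
    then have "expands8 (\<lambda>s. fourier_measure (distr M borel (X 1)) (s *\<^sub>R e)) q"
      by (simp add: cf levy_khintchine_eq)
    then show ?thesis by (intro eighth_moment_integrable M.prob_space_distr X1) auto
  qed
  have I: "integrable (distr M borel (X 1)) (\<lambda>x. 256 * (\<bar>(1, 0) \<bullet> x\<bar> ^ 8 + \<bar>(0, 1) \<bullet> x\<bar> ^ 8))"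
    by (intro integrable_mult_right Bochner_Integration.integrable_add i)
  show ?thesis
  proof (rule Bochner_Integration.integrable_bound[OF I])
    show "AE x in distr M borel (X 1). norm (norm x ^ 8) \<le> norm (256 * (\<bar>(1, 0) \<bullet> x\<bar> ^ 8 + \<bar>(0, 1) \<bullet> x\<bar> ^ 8))"
    proof (rule AE_I2)
      fix x :: "real \<times> real"
      have nn: "0 \<le> norm x ^ 8" by simp
      show "norm (norm x ^ 8) \<le> norm (256 * (\<bar>(1, 0) \<bullet> x\<bar> ^ 8 + \<bar>(0, 1) \<bullet> x\<bar> ^ 8))"
        unfolding real_norm_def abs_of_nonneg[OF nn] by (rule order_trans[OF inner_power_le abs_ge_self])
    qed
  qed simp
qed

section \<open>The estimator of the tail integral\<close>

locale levy_copula_setting =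
  fixes K :: "real \<times> real \<Rightarrow> real"
    and M :: "'w measure"
    and X :: "real \<Rightarrow> 'w \<Rightarrow> real \<times> real"
    and \<Sigma> :: "real \<times> real \<Rightarrow> real \<times> real"
    and \<nu> :: "(real \<times> real) measure"
    and \<alpha> :: "real \<times> real"
  assumes K_nonneg: "\<And>x. 0 \<le> K x"
    and K_L1: "integrable lborel K"
    and K_integral: "(\<integral>x. K x \<partial>lborel) = 1"
    and K_supp: "closure {u. fourier (\<lambda>x. complex_of_real (K x)) u \<noteq> 0} \<subseteq> {-1..1} \<times> {-1..1}"
    and K_Lipschitz: "\<exists>L. L-lipschitz_on UNIV (fourier (\<lambda>x. complex_of_real (K x)))"
    and triplet: "levy_process_with_triplet M X \<Sigma> \<nu> \<alpha>"
    and moments: "\<exists>\<gamma>>0. (\<integral>\<^sup>+x. ennreal (norm x powr (8 + \<gamma>)) \<partial>\<nu>) < \<infinity>"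
    and fourier_decay:
      "\<exists>c>0. \<forall>u. cmod (fourier_measure (density \<nu> (\<lambda>x. ennreal (quartic_weight x))) u)
                  \<le> c * inverse (1 + \<bar>fst u\<bar>) * inverse (1 + \<bar>snd u\<bar>)"
begin

lemma sets_nu [simp, measurable_cong]: "sets \<nu> = sets borel"
  using triplet by (simp add: levy_process_with_triplet_def levy_measure_def)

lemma space_nu [simp]: "space \<nu> = UNIV"
  using sets_eq_imp_space_eq[OF sets_nu] by simp

lemma nu_moments:
  assumes "2 \<le> k" "k \<le> 8"
  shows "integrable \<nu> (\<lambda>x. norm x ^ k)"
proof -
  obtain \<gamma> where g: "\<gamma> > 0" "(\<integral>\<^sup>+x. ennreal (norm x powr (8 + \<gamma>)) \<partial>\<nu>) < \<infinity>" using moments by blast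
  have k: "real k \<le> 8 + \<gamma>" using assms g by linarith
  show ?thesis
    by (rule levy_measure_moments[OF _ g(2) assms(1) k]) (use triplet in \<open>simp add: levy_process_with_triplet_def\<close>)
qed

lemma cov: "covariance_operator \<Sigma>"
  using triplet by (simp add: levy_process_with_triplet_def)

sublocale levy_sample M X
proof
  show "levy_process M X" using triplet by (simp add: levy_process_with_triplet_def)
  show "integrable (distr M borel (X 1)) (\<lambda>x. norm x ^ 8)"
    by (rule levy_eighth_moment[OF triplet nu_moments])
qed

definition \<phi> :: "real \<times> real \<Rightarrow> complex" where "\<phi> = levy_khintchine \<Sigma> \<nu> \<alpha>"

lemma phi_eq: "\<phi> = fourier_measure P"
  using triplet by (simp add: \<phi>_def levy_process_with_triplet_def fun_eq_iff)

definition \<mu> :: "(real \<times> real) measure" where "\<mu> = density \<nu> (\<lambda>x. ennreal (quartic_weight x))"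

text \<open>Chosen once and for all, so that \<open>decaying_measure\<close> can be interpreted with
  a fixed parameter.\<close>

definition c\<mu> :: real where
  "c\<mu> = (SOME c. \<forall>u. cmod (fourier_measure \<mu> u) \<le> c * inverse (1 + \<bar>fst u\<bar>) * inverse (1 + \<bar>snd u\<bar>))"

lemma quartic_weight_nu_integrable: "integrable \<nu> quartic_weight"
proof (rule Bochner_Integration.integrable_bound)
  show "integrable \<nu> (\<lambda>x. 2 * norm x ^ 4)" using nu_moments[of 4] by simp
  show "AE x in \<nu>. norm (quartic_weight x) \<le> norm (2 * norm x ^ 4)"
  proof (rule AE_I2)
    fix x :: "real \<times> real"
    have "\<bar>fst x\<bar> \<le> norm x" "\<bar>snd x\<bar> \<le> norm x"
      using norm_fst_le[of "fst x" "snd x"] norm_snd_le[of "snd x" "fst x"] by simp_all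
    from power_mono[OF this(1), of 4] power_mono[OF this(2), of 4]
    have "\<bar>fst x\<bar> ^ 4 \<le> norm x ^ 4" "\<bar>snd x\<bar> ^ 4 \<le> norm x ^ 4" by simp_all
    then show "norm (quartic_weight x) \<le> norm (2 * norm x ^ 4)"
      by (simp add: quartic_weight_def)
  qed
qed simp

sublocale mu: decaying_measure \<mu> c\<mu>
proof (rule decaying_measure.intro)
  have "\<exists>c. \<forall>u. cmod (fourier_measure \<mu> u) \<le> c * inverse (1 + \<bar>fst u\<bar>) * inverse (1 + \<bar>snd u\<bar>)"
    using fourier_decay unfolding \<mu>_def by blast
  from someI_ex[OF this]
  show "cmod (fourier_measure \<mu> u) \<le> c\<mu> * inverse (1 + \<bar>fst u\<bar>) * inverse (1 + \<bar>snd u\<bar>)" for u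
    unfolding c\<mu>_def[symmetric] by blast
  show "sets \<mu> = sets borel" by (simp add: \<mu>_def)
  show "finite_measure \<mu>"
  proof (rule finite_measureI)
    have "emeasure \<mu> (space \<mu>) = (\<integral>\<^sup>+x. ennreal (quartic_weight x) \<partial>\<nu>)"
      by (simp add: \<mu>_def emeasure_density)
    also have "\<dots> = ennreal (integral\<^sup>L \<nu> quartic_weight)"
      by (rule nn_integral_eq_integral[OF quartic_weight_nu_integrable]) (simp add: quartic_weight_nonneg)
    finally show "emeasure \<mu> (space \<mu>) \<noteq> \<infinity>" by simp
  qed
qed

lemma integral_mu:
  fixes f :: "real \<times> real \<Rightarrow> 'b::{banach, second_countable_topology}"
  assumes [measurable]: "f \<in> borel_measurable borel"
  shows "integral\<^sup>L \<mu> f = (\<integral>x. quartic_weight x *\<^sub>R f x \<partial>\<nu>)"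
  unfolding \<mu>_def by (subst integral_density) (auto simp: quartic_weight_nonneg)

lemma orthant_weight_mu:
  assumes "0 \<le> a" "0 \<le> b" "0 < max a b"
  shows "(\<integral>x. orthant_weight a b x \<partial>\<mu>) = measure \<nu> (orthant a b)"
proof -
  have "(\<integral>x. orthant_weight a b x \<partial>\<mu>) = (\<integral>x. quartic_weight x *\<^sub>R orthant_weight a b x \<partial>\<nu>)"
    by (rule integral_mu) simp
  also have "\<dots> = (\<integral>x. indicator (orthant a b) x \<partial>\<nu>)"
  proof (rule Bochner_Integration.integral_cong[OF refl])
    fix x
    show "quartic_weight x *\<^sub>R orthant_weight a b x = indicator (orthant a b) x"
    proof (cases "x \<in> orthant a b")
      case True
      have "0 < quartic_weight x"
        using quartic_weight_ge[OF True assms(1,2,3) order_refl] assms(3) by (meson less_le_trans zero_less_power)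
      then show ?thesis using True by (simp add: orthant_weight_def)
    qed (simp add: orthant_weight_def)
  qed
  finally show ?thesis by simp
qed

text \<open>Reading the kernel as a probability law makes the tail estimates for characteristic
  functions applicable to it.\<close>

definition \<kappa> :: "(real \<times> real) measure" where "\<kappa> = density lborel (\<lambda>x. ennreal (K x))"

lemma K_measurable [measurable]: "K \<in> borel_measurable borel"
  using K_L1 by auto

lemma sets_kappa [simp, measurable_cong]: "sets \<kappa> = sets borel" by (simp add: \<kappa>_def)

lemma fourier_kappa: "fourier_measure \<kappa> u = fourier (\<lambda>x. complex_of_real (K x)) u"
  unfolding fourier_measure_def fourier_def \<kappa>_def
  by (subst integral_density) (auto simp: K_nonneg scaleR_conv_of_real mult.commute)

lemma prob_space_kappa: "prob_space \<kappa>"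
proof
  have "emeasure \<kappa> (space \<kappa>) = (\<integral>\<^sup>+x. ennreal (K x) \<partial>lborel)"
    by (simp add: \<kappa>_def emeasure_density)
  also have "\<dots> = 1" using nn_integral_eq_integral[OF K_L1] K_nonneg K_integral by simp
  finally show "emeasure \<kappa> (space \<kappa>) = 1" .
qed

sublocale kappa: prob_space \<kappa> by (rule prob_space_kappa)

lemma fourier_kappa_norm_le: "cmod (fourier_measure \<kappa> u) \<le> 1"
  using fourier_measure_norm_le[OF kappa.finite_measure_axioms, of u] kappa.prob_space by simp

definition L\<kappa> :: real where "L\<kappa> = (SOME L. L-lipschitz_on UNIV (fourier (\<lambda>x. complex_of_real (K x))))"

lemma fourier_kappa_lipschitz: "cmod (1 - fourier_measure \<kappa> u) \<le> L\<kappa> * norm u"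
proof -
  have L: "L\<kappa>-lipschitz_on UNIV (fourier (\<lambda>x. complex_of_real (K x)))"
    unfolding L\<kappa>_def using K_Lipschitz by (rule someI_ex)
  have "fourier_measure \<kappa> 0 = 1"
    using kappa.prob_space by (simp add: fourier_measure_def)
  then show ?thesis
    using lipschitz_onD[OF L, of 0 u] by (simp add: dist_norm fourier_kappa)
qed

lemma fourier_kappa_support:
  assumes h: "0 < h" and u: "u \<notin> freq_square h"
  shows "fourier_measure \<kappa> (h *\<^sub>R u) = 0"
proof (rule ccontr)
  assume "fourier_measure \<kappa> (h *\<^sub>R u) \<noteq> 0"
  then have "h *\<^sub>R u \<in> {u. fourier (\<lambda>x. complex_of_real (K x)) u \<noteq> 0}" by (simp add: fourier_kappa)
  then have "h *\<^sub>R u \<in> {-1..1} \<times> {-1..1}" by (rule subsetD[OF order_trans[OF closure_subset K_supp]])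
  then have "-1 \<le> h * fst u" "h * fst u \<le> 1" "-1 \<le> h * snd u" "h * snd u \<le> 1"
    by (cases u; auto)+
  then have "u \<in> freq_square h" using h by (cases u) (auto simp: freq_square_def field_simps)
  with u show False by simp
qed

lemma fourier_scaled: "0 < h \<Longrightarrow> fourier (\<lambda>z. complex_of_real (scaled_kernel K h z)) u = fourier_measure \<kappa> (h *\<^sub>R u)"
  by (simp add: fourier_scaled_kernel fourier_kappa)

lemma freq_square_measurable [measurable]: "freq_square h \<in> sets borel"
  unfolding freq_square_def by (intro borel_closed closed_Times) auto

lemma freq_square_compact: "compact (freq_square h)"
  unfolding freq_square_def by (intro compact_Times) auto

lemma freq_square_integral:
  assumes "0 < h"
  shows "integrable lborel (\<lambda>u. indicator (freq_square h) u :: real)"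
    and "(\<integral>u. indicator (freq_square h) u \<partial>lborel) = 4 / h\<^sup>2"
proof -
  have i: "integrable lborel (\<lambda>s. indicator {- (1 / h)..1 / h} s :: real)"
    by (intro integrable_real_indicator) (auto simp: emeasure_lborel_Icc_eq)
  have v: "integral\<^sup>L lborel (\<lambda>s. indicator {- (1 / h)..1 / h} s :: real) = 2 / h" using assms by simp
  have e: "(indicator (freq_square h) u :: real) = indicator {- (1 / h)..1 / h} (fst u) * indicator {- (1 / h)..1 / h} (snd u)" for u
    by (cases u) (auto simp: freq_square_def indicator_def)
  show "integrable lborel (\<lambda>u. indicator (freq_square h) u :: real)"
    unfolding e by (rule lborel_pair_integral_mult(1)[OF i i])
  show "(\<integral>u. indicator (freq_square h) u \<partial>lborel) = 4 / h\<^sup>2"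
    unfolding e lborel_pair_integral_mult(2)[OF i i] v by (simp add: power2_eq_square)
qed

text \<open>Population counterpart of \<open>est_symbol\<close>. It needs no cutoff, since the
  transform of the scaled kernel already vanishes off the frequency square.\<close>

definition true_symbol :: "real \<Rightarrow> real \<times> real \<Rightarrow> complex" where
  "true_symbol h u = fourier_measure \<mu> u * fourier_measure \<kappa> (h *\<^sub>R u)"

definition est_symbol :: "real \<Rightarrow> nat \<Rightarrow> 'w \<Rightarrow> real \<times> real \<Rightarrow> complex" where
  "est_symbol h n \<omega> u = indicator (freq_square h) u *
     ((log_deriv4 (1, 0) (ecf n (sample \<omega>)) u + log_deriv4 (0, 1) (ecf n (sample \<omega>)) u) *
      fourier_measure \<kappa> (h *\<^sub>R u))"

abbreviation good_cf :: "real \<Rightarrow> nat \<Rightarrow> 'w \<Rightarrow> bool" where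
  "good_cf h n \<omega> \<equiv> \<forall>u\<in>freq_square h. cmod (ecf n (sample \<omega>) u) > cmod (\<phi> u) / 2"

abbreviation Nhat :: "real \<Rightarrow> nat \<Rightarrow> 'w \<Rightarrow> real \<Rightarrow> real \<Rightarrow> complex" where
  "Nhat h n \<omega> a b \<equiv> N_hat K \<phi> h n (sample \<omega>) a b"

lemma Nhat_eq:
  assumes "0 < h"
  shows "Nhat h n \<omega> a b = (if good_cf h n \<omega> then orthant_integral (inv_fourier (est_symbol h n \<omega>)) a b else 0)"
  unfolding N_hat_def orthant_integral_def orthant_weight_def est_symbol_def[abs_def]
  by (simp only: fourier_scaled[OF assms])

lemma log_deriv4_ecf:
  "log_deriv4 e (ecf n (sample \<omega>)) u = cumulant4 (ecf_moment n \<omega> e 1 u / ecf_moment n \<omega> e 0 u)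
     (ecf_moment n \<omega> e 2 u / ecf_moment n \<omega> e 0 u) (ecf_moment n \<omega> e 3 u / ecf_moment n \<omega> e 0 u)
     (ecf_moment n \<omega> e 4 u / ecf_moment n \<omega> e 0 u)"
  using log_deriv4_eq_cumulant4[of e "ecf n (sample \<omega>)" u "\<lambda>j. ecf_moment n \<omega> e j u"]
  by (simp add: partial_deriv_ecf)

lemma log_deriv4_phi:
  "log_deriv4 e \<phi> u = cumulant4 (fourier_moment P e 1 u / fourier_moment P e 0 u)
     (fourier_moment P e 2 u / fourier_moment P e 0 u) (fourier_moment P e 3 u / fourier_moment P e 0 u)
     (fourier_moment P e 4 u / fourier_moment P e 0 u)"
  using log_deriv4_eq_cumulant4[of e \<phi> u "\<lambda>j. fourier_moment P e j u"]
  by (simp add: partial_deriv_cf phi_eq)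

text \<open>The identity imitated by the estimator: the fourth powers of the two coordinates add up
  to the quartic weight, so the two fourth cumulant functions add up to the transform of
  \<open>\<mu>\<close>.\<close>

lemma log_deriv4_sum_phi: "log_deriv4 (1, 0) \<phi> u + log_deriv4 (0, 1) \<phi> u = fourier_measure \<mu> u"
proof -
  have i: "integrable \<nu> (\<lambda>x. complex_of_real ((e \<bullet> x) ^ 4) * iexp (u \<bullet> x))" for e
    by (rule Bochner_Integration.integrable_bound[OF integrable_inner_power[OF sets_nu nu_moments[of 4], of e]])
       (auto simp: norm_mult norm_power power_abs)
  have "log_deriv4 (1, 0) \<phi> u + log_deriv4 (0, 1) \<phi> u =
     (\<integral>x. complex_of_real (((1, 0) \<bullet> x) ^ 4) * iexp (u \<bullet> x) \<partial>\<nu>) + (\<integral>x. complex_of_real (((0, 1) \<bullet> x) ^ 4) * iexp (u \<bullet> x) \<partial>\<nu>)"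
    unfolding \<phi>_def using nu_moments cov by (simp only: log_deriv4_levy_khintchine[OF sets_nu _ cov])
  also have "\<dots> = (\<integral>x. complex_of_real (((1, 0) \<bullet> x) ^ 4) * iexp (u \<bullet> x) + complex_of_real (((0, 1) \<bullet> x) ^ 4) * iexp (u \<bullet> x) \<partial>\<nu>)"
    by (rule Bochner_Integration.integral_add[symmetric, OF i i])
  also have "\<dots> = (\<integral>x. quartic_weight x *\<^sub>R iexp (u \<bullet> x) \<partial>\<nu>)"
    by (intro Bochner_Integration.integral_cong refl)
       (simp add: quartic_weight_def inner_prod_def scaleR_conv_of_real distrib_right)
  also have "\<dots> = fourier_measure \<mu> u" unfolding fourier_measure_def by (rule integral_mu[symmetric]) simp
  finally show ?thesis .
qed

lemma fourier_kappa_scaled_measurable [measurable]: "(\<lambda>u. fourier_measure \<kappa> (h *\<^sub>R u)) \<in> borel_measurable borel"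
  using fourier_measure_measurable[OF kappa.finite_measure_axioms sets_kappa] by measurable

lemma fourier_mu_measurable [measurable]: "fourier_measure \<mu> \<in> borel_measurable borel"
  by (rule fourier_measure_measurable[OF mu.finite_measure_axioms mu.mu_sets])

lemma true_symbol_integrable:
  assumes h: "0 < h"
  shows "integrable lborel (true_symbol h)"
proof (rule Bochner_Integration.integrable_bound)
  show "integrable lborel (\<lambda>u. indicator (freq_square h) u * measure \<mu> UNIV)"
    using freq_square_integral(1)[OF h] by (rule integrable_mult_left)
  show "true_symbol h \<in> borel_measurable lborel" unfolding true_symbol_def[abs_def] by measurable
  show "AE u in lborel. norm (true_symbol h u) \<le> norm (indicator (freq_square h) u * measure \<mu> UNIV)"
  proof (rule AE_I2)
    fix u
    have "cmod (fourier_measure \<mu> u) * cmod (fourier_measure \<kappa> (h *\<^sub>R u)) \<le> measure \<mu> UNIV * 1"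
      using fourier_measure_norm_le[OF mu.finite_measure_axioms, of u] fourier_kappa_norm_le
      by (intro mult_mono) auto
    then show "norm (true_symbol h u) \<le> norm (indicator (freq_square h) u * measure \<mu> UNIV)"
      using fourier_kappa_support[OF h, of u] by (cases "u \<in> freq_square h") (auto simp: true_symbol_def norm_mult)
  qed
qed

lemma ecf_moment_joint_measurable [measurable]:
  assumes [measurable]: "f \<in> measurable N M" "g \<in> borel_measurable N"
  shows "(\<lambda>p. ecf_moment n (f p) e j (g p)) \<in> borel_measurable N"
proof -
  have [measurable]: "(\<lambda>p. incr (f p) t) \<in> borel_measurable N" for t
    by (rule measurable_compose[OF assms(1) incr_measurable])
  show ?thesis unfolding ecf_moment_def by measurable
qed

lemma est_symbol_joint_measurable [measurable]:
  assumes [measurable]: "f \<in> measurable N M" "g \<in> borel_measurable N"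
  shows "(\<lambda>p. est_symbol h n (f p) (g p)) \<in> borel_measurable N"
  unfolding est_symbol_def log_deriv4_ecf cumulant4_def by measurable

lemma est_symbol_measurable [measurable]: "\<omega> \<in> space M \<Longrightarrow> est_symbol h n \<omega> \<in> borel_measurable borel"
  using est_symbol_joint_measurable[of "\<lambda>_. \<omega>" borel "\<lambda>u. u"] by simp

lemma fourier_moment_P_norm_le:
  assumes "norm e \<le> 1" "j \<le> 4"
  shows "cmod (fourier_moment P e j u) \<le> lip_moment"
  unfolding fourier_moment_def lip_moment_def
proof (rule norm_integral_le)
  show "integrable P (\<lambda>x. 1 + norm x ^ 5)" using moments_P[of 5] by simp
  show "AE x in P. cmod (moment_kernel e j u x) \<le> 1 + norm x ^ 5"
  proof (rule AE_I2)
    fix x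
    have "cmod (moment_kernel e j u x) \<le> norm x ^ j" by (rule moment_kernel_norm_le[OF assms(1)])
    also have "\<dots> \<le> 1 + norm x ^ 5" using assms by (intro power_le_one_plus_power) auto
    finally show "cmod (moment_kernel e j u x) \<le> 1 + norm x ^ 5" .
  qed
qed

text \<open>A deterministic statement about one sample point. The constant 307200 combines
  \<open>8 * pi^2 / \<delta>^4\<close> from the weight, the area \<open>4 / h^2\<close> of the
  frequency square, the inversion factor \<open>1 / (2 * pi)^2\<close>, two directions, and 19200
  from the cumulant.\<close>

lemma estimator_error:
  assumes w: "\<omega> \<in> space M" and h: "0 < h" "h \<le> 1" and d: "0 < \<delta>" "\<delta> \<le> 1"
    and m: "0 < m" "m \<le> 1" "\<And>u. u \<in> freq_square h \<Longrightarrow> m \<le> cmod (\<phi> u)" and t: "t < m / 2"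
    and dev: "\<And>e j u. e \<in> {(1, 0), (0, 1)} \<Longrightarrow> j \<le> 4 \<Longrightarrow> u \<in> freq_square h \<Longrightarrow>
        cmod (ecf_moment n \<omega> e j u - fourier_moment P e j u) \<le> t"
    and ab: "0 \<le> a" "0 \<le> b" "\<delta> \<le> max a b"
  shows "cmod (Nhat h n \<omega> a b - complex_of_real (measure \<nu> (orthant a b))) \<le>
     307200 * lip_moment ^ 4 * (t / (m ^ 5 * h\<^sup>2 * \<delta> ^ 4))
     + (8 * measure \<mu> UNIV + 4 * c\<mu>) * (3 + 6 * L\<kappa>) * (h * (log_factor h)\<^sup>2 / \<delta> ^ 5)"
proof -
  have E1: "norm e \<le> 1" if "e \<in> {(1, 0), (0, 1 :: real)}" for e :: "real \<times> real"
    using that by (auto simp: norm_prod_def)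
  have ecf0: "ecf_moment n \<omega> e 0 u = ecf n (sample \<omega>) u" for e u
    using fun_cong[OF partial_deriv_ecf[where e=e and j=0 and n=n and \<omega>=\<omega>], of u] by simp
  have phi0: "fourier_moment P e 0 u = \<phi> u" for e u
    using fun_cong[OF partial_deriv_cf[where e=e and j=0, simplified], of u] by (simp add: phi_eq)
  \<comment> \<open>A deviation below \<open>m / 2\<close> is less than half of the true modulus, so
    the estimator is not set to zero.\<close>
  have good: "good_cf h n \<omega>"
  proof
    fix u assume u: "u \<in> freq_square h"
    have "cmod (ecf n (sample \<omega>) u - \<phi> u) \<le> t"
      using dev[of "(1, 0)" 0 u] u by (simp add: ecf0 phi0)
    then show "cmod (\<phi> u) / 2 < cmod (ecf n (sample \<omega>) u)"
      using norm_triangle_ineq2[of "\<phi> u" "ecf n (sample \<omega>) u"] m(3)[OF u] t by (simp add: norm_minus_commute)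
  qed
  define \<Delta> where "\<Delta> = 19200 * lip_moment ^ 4 * t / m ^ 5"
  have t0: "0 \<le> t"
  proof -
    have "(0, 0) \<in> freq_square h" using h by (simp add: freq_square_def)
    from order_trans[OF norm_ge_zero dev[OF _ _ this, of "(1, 0)" 0]] show ?thesis by simp
  qed
  have \<Delta>0: "0 \<le> \<Delta>" using t0 m lip_moment_ge_1 by (simp add: \<Delta>_def)
  have ld: "cmod (log_deriv4 e (ecf n (sample \<omega>)) u - log_deriv4 e \<phi> u) \<le> \<Delta>"
    if e: "e \<in> {(1, 0), (0, 1)}" and u: "u \<in> freq_square h" for e u
    unfolding log_deriv4_ecf log_deriv4_phi \<Delta>_def
    by (rule cumulant4_perturbation[of m lip_moment t "\<lambda>j. fourier_moment P e j u" "\<lambda>j. ecf_moment n \<omega> e j u"])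
       (use m t lip_moment_ge_1 fourier_moment_P_norm_le[OF E1[OF e]] dev[OF e _ u] m(3)[OF u] phi0 in auto)
  have diff: "cmod (est_symbol h n \<omega> u - true_symbol h u) \<le> indicator (freq_square h) u * (2 * \<Delta>)" for u
  proof (cases "u \<in> freq_square h")
    case True
    have "est_symbol h n \<omega> u - true_symbol h u =
       ((log_deriv4 (1, 0) (ecf n (sample \<omega>)) u - log_deriv4 (1, 0) \<phi> u) +
        (log_deriv4 (0, 1) (ecf n (sample \<omega>)) u - log_deriv4 (0, 1) \<phi> u)) * fourier_measure \<kappa> (h *\<^sub>R u)"
      using True unfolding est_symbol_def true_symbol_def log_deriv4_sum_phi[symmetric] by (simp add: algebra_simps)
    then have "cmod (est_symbol h n \<omega> u - true_symbol h u) =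
       cmod ((log_deriv4 (1, 0) (ecf n (sample \<omega>)) u - log_deriv4 (1, 0) \<phi> u) +
        (log_deriv4 (0, 1) (ecf n (sample \<omega>)) u - log_deriv4 (0, 1) \<phi> u)) * cmod (fourier_measure \<kappa> (h *\<^sub>R u))"
      by (simp only: norm_mult)
    also have "\<dots> \<le> (\<Delta> + \<Delta>) * 1"
      using ld[OF _ True, of "(1, 0)"] ld[OF _ True, of "(0, 1)"] \<Delta>0
      by (intro mult_mono fourier_kappa_norm_le order_trans[OF norm_triangle_ineq] add_mono) auto
    finally show ?thesis using True by simp
  next
    case False
    then show ?thesis using fourier_kappa_support[OF h(1) False] by (simp add: est_symbol_def true_symbol_def)
  qed
  have wi: "integrable lborel (\<lambda>u. indicator (freq_square h) u * (2 * \<Delta>))"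
    using freq_square_integral(1)[OF h(1)] by (rule integrable_mult_left)
  have di: "integrable lborel (\<lambda>u. est_symbol h n \<omega> u - true_symbol h u)"
  proof (rule Bochner_Integration.integrable_bound[OF wi])
    show "(\<lambda>u. est_symbol h n \<omega> u - true_symbol h u) \<in> borel_measurable lborel"
      using est_symbol_measurable[OF w] true_symbol_integrable[OF h(1)] by auto
    show "AE u in lborel. cmod (est_symbol h n \<omega> u - true_symbol h u) \<le> norm (indicator (freq_square h) u * (2 * \<Delta>))"
      using diff \<Delta>0 by auto
  qed
  have ti: "integrable lborel (true_symbol h)" by (rule true_symbol_integrable[OF h(1)])
  \<comment> \<open>The empirical symbol is integrable as the sum of the true symbol and a
    difference already bounded on the square.\<close>
  have ei: "integrable lborel (est_symbol h n \<omega>)" using Bochner_Integration.integrable_add[OF di ti] by simp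
  have mult_i: "integrable lborel (\<lambda>u. iexp (- (u \<bullet> y)) * f u)" if "integrable lborel f" for f :: "real \<times> real \<Rightarrow> complex" and y
    by (rule Bochner_Integration.integrable_bound[OF integrable_norm[OF that]]) (use that in \<open>auto simp: norm_mult\<close>)
  have inv_diff: "inv_fourier (est_symbol h n \<omega>) y - inv_fourier (true_symbol h) y = inv_fourier (\<lambda>u. est_symbol h n \<omega> u - true_symbol h u) y" for y
    unfolding inv_fourier_def right_diff_distrib[symmetric]
    using Bochner_Integration.integral_diff[OF mult_i[OF ei] mult_i[OF ti], of y y] by (simp add: right_diff_distrib)
  define \<beta> where "\<beta> = 4 / h\<^sup>2 * (2 * \<Delta>) / (2 * pi)\<^sup>2"
  have inv_le: "cmod (inv_fourier (est_symbol h n \<omega>) y - inv_fourier (true_symbol h) y) \<le> \<beta>" for y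
    unfolding inv_diff using inv_fourier_norm_le[OF wi diff, of y] freq_square_integral(2)[OF h(1)] by (simp add: \<beta>_def)
  have gi: "integrable lborel (orthant_weight a b)" by (rule orthant_weight_integrable(1)[OF ab(1,2) d ab(3)])
  have oi: "integrable lborel (\<lambda>y. complex_of_real (orthant_weight a b y) * inv_fourier f y)" if f: "integrable lborel f" for f
  proof (rule Bochner_Integration.integrable_bound)
    define C where "C = (\<integral>u. cmod (f u) \<partial>lborel) / (2 * pi)\<^sup>2"
    show "integrable lborel (\<lambda>y. orthant_weight a b y * C)" using gi by simp
    have [measurable]: "f \<in> borel_measurable borel" using f by auto
    show "(\<lambda>y. complex_of_real (orthant_weight a b y) * inv_fourier f y) \<in> borel_measurable lborel" by measurable
    have "cmod (inv_fourier f y) \<le> C" for y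
      unfolding C_def by (rule inv_fourier_norm_le) (use f in auto)
    then show "AE y in lborel. norm (complex_of_real (orthant_weight a b y) * inv_fourier f y) \<le> norm (orthant_weight a b y * C)"
      by (intro AE_I2) (auto simp: norm_mult abs_mult orthant_weight_nonneg intro!: mult_left_mono order_trans[OF _ abs_ge_self])
  qed
  have "orthant_integral (inv_fourier (est_symbol h n \<omega>)) a b - orthant_integral (inv_fourier (true_symbol h)) a b
      = orthant_integral (\<lambda>y. inv_fourier (est_symbol h n \<omega>) y - inv_fourier (true_symbol h) y) a b"
    unfolding orthant_integral_def right_diff_distrib
    by (rule Bochner_Integration.integral_diff[symmetric, OF oi[OF ei] oi[OF ti]])
  then have s1: "cmod (orthant_integral (inv_fourier (est_symbol h n \<omega>)) a b - orthant_integral (inv_fourier (true_symbol h)) a b)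
      \<le> 8 * pi\<^sup>2 / \<delta> ^ 4 * \<beta>"
    using orthant_integral_norm_le[OF ab(1,2) d ab(3) inv_le] by simp
  have e1: "8 * pi\<^sup>2 / \<delta> ^ 4 * \<beta> = 307200 * lip_moment ^ 4 * (t / (m ^ 5 * h\<^sup>2 * \<delta> ^ 4))"
    using h d m by (simp add: \<beta>_def \<Delta>_def field_simps power2_eq_square)
  have e2: "cmod (orthant_integral (inv_fourier (true_symbol h)) a b - complex_of_real (measure \<nu> (orthant a b)))
     \<le> (8 * measure \<mu> UNIV + 4 * c\<mu>) * (3 + 6 * L\<kappa>) * (h * (log_factor h)\<^sup>2 / \<delta> ^ 5)"
  proof -
    have ts: "true_symbol h = (\<lambda>u. fourier_measure \<mu> u * fourier_measure \<kappa> (h *\<^sub>R u))"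
      by (simp add: fun_eq_iff true_symbol_def)
    have om: "(\<integral>x. orthant_weight a b x \<partial>\<mu>) = measure \<nu> (orthant a b)"
      using orthant_weight_mu[of a b] ab d by simp
    show ?thesis
      unfolding orthant_integral_def ts om[symmetric]
      by (rule mu.smoothing_bias_le[OF prob_space_kappa sets_kappa fourier_kappa_lipschitz ab(1,2) d ab(3) h])
         (use ti in \<open>simp only: ts\<close>)
  qed
  have e3: "Nhat h n \<omega> a b = orthant_integral (inv_fourier (est_symbol h n \<omega>)) a b"
    using good by (simp add: Nhat_eq[OF h(1)])
  have "cmod (Nhat h n \<omega> a b - complex_of_real (measure \<nu> (orthant a b))) \<le>
      cmod (orthant_integral (inv_fourier (est_symbol h n \<omega>)) a b - orthant_integral (inv_fourier (true_symbol h)) a b)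
      + cmod (orthant_integral (inv_fourier (true_symbol h)) a b - complex_of_real (measure \<nu> (orthant a b)))"
    unfolding e3 using norm_triangle_ineq[of "orthant_integral (inv_fourier (est_symbol h n \<omega>)) a b - orthant_integral (inv_fourier (true_symbol h)) a b"
      "orthant_integral (inv_fourier (true_symbol h)) a b - complex_of_real (measure \<nu> (orthant a b))"] by simp
  then show ?thesis using add_mono[OF s1 e2] unfolding e1 by (rule order_trans)
qed

lemma phi_lower_bound: "\<exists>c\<ge>0. \<forall>u. exp (- c * (norm u)\<^sup>2) \<le> cmod (\<phi> u)"
  unfolding \<phi>_def using nu_moments[of 2] cov
  by (intro levy_khintchine_lower_bound) (auto simp: covariance_operator_def)

lemma freq_square_norm_le:
  assumes "0 < h" "u \<in> freq_square h"
  shows "(norm u)\<^sup>2 \<le> 2 / h\<^sup>2"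
proof -
  have "\<bar>fst u\<bar> \<le> 1 / h" "\<bar>snd u\<bar> \<le> 1 / h" using assms by (cases u; auto simp: freq_square_def abs_le_iff)+
  then have "\<bar>fst u\<bar>\<^sup>2 \<le> (1 / h)\<^sup>2" "\<bar>snd u\<bar>\<^sup>2 \<le> (1 / h)\<^sup>2" by (intro power_mono; simp)+
  then show ?thesis by (simp add: norm_prod_def power_divide)
qed

section \<open>Pathwise regularity and measurability of the tail estimator\<close>

lemma ecf_moment_norm_le:
  assumes "norm e \<le> 1" "j \<le> 4"
  shows "cmod (ecf_moment n \<omega> e j u) \<le> (\<Sum>t=1..n. 1 + norm (incr \<omega> t) ^ 5) / real n"
  unfolding ecf_moment_def norm_divide norm_of_nat
proof (intro divide_right_mono sum_norm_le)
  fix t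
  have "cmod (moment_kernel e j u (incr \<omega> t)) \<le> norm (incr \<omega> t) ^ j" by (rule moment_kernel_norm_le[OF assms(1)])
  also have "\<dots> \<le> 1 + norm (incr \<omega> t) ^ 5" using assms by (intro power_le_one_plus_power) auto
  finally show "cmod (moment_kernel e j u (incr \<omega> t)) \<le> 1 + norm (incr \<omega> t) ^ 5" .
qed simp

lemma ecf_moment_0: "ecf_moment n \<omega> e 0 u = ecf n (sample \<omega>) u"
  using fun_cong[OF partial_deriv_ecf[where e=e and j=0 and n=n and \<omega>=\<omega>], of u] by simp

text \<open>A crude bound depending on the sample point, for use in continuity and finiteness
  arguments. On the good event the modulus stays above half of a positive bound on the square;
  comparing with the cumulant of zero arguments reuses the Lipschitz estimate.\<close>

lemma est_symbol_bounded:
  assumes h: "0 < h" and good: "good_cf h n \<omega>"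
  shows "\<exists>B. \<forall>u. cmod (est_symbol h n \<omega> u) \<le> B"
proof -
  obtain c where c: "c \<ge> 0" "\<And>u. exp (- c * (norm u)\<^sup>2) \<le> cmod (\<phi> u)" using phi_lower_bound by blast
  define m where "m = exp (- c * (2 / h\<^sup>2))"
  define S where "S = (\<Sum>t=1..n. 1 + norm (incr \<omega> t) ^ 5) / real n"
  define Q where "Q = 1 + 2 * S / m"
  have m0: "0 < m" by (simp add: m_def)
  have S0: "0 \<le> S" unfolding S_def by (intro divide_nonneg_nonneg sum_nonneg) auto
  have Q1: "1 \<le> Q" using S0 m0 by (simp add: Q_def)
  have cm: "cmod (log_deriv4 e (ecf n (sample \<omega>)) u) \<le> 75 * Q ^ 3 * Q"
    if u: "u \<in> freq_square h" and e: "norm e \<le> 1" for e u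
  proof -
    have "m \<le> exp (- c * (norm u)\<^sup>2)"
      using mult_left_mono[OF freq_square_norm_le[OF h u] c(1)] by (simp add: m_def)
    then have "m / 2 \<le> cmod (ecf n (sample \<omega>) u)" using c(2)[of u] good u by fastforce
    then have d0: "m / 2 \<le> cmod (ecf_moment n \<omega> e 0 u)" by (simp add: ecf_moment_0)
    have q: "cmod (ecf_moment n \<omega> e j u / ecf_moment n \<omega> e 0 u) \<le> Q" if "j \<in> {1..4}" for j
    proof -
      have "cmod (ecf_moment n \<omega> e j u / ecf_moment n \<omega> e 0 u) \<le> S / (m / 2)"
        unfolding norm_divide using ecf_moment_norm_le[OF e, of j n \<omega> u] d0 m0 S0 that
        by (intro frac_le) (auto simp: S_def)
      then show ?thesis by (simp add: Q_def mult.commute)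
    qed
    have "cmod (cumulant4 (ecf_moment n \<omega> e 1 u / ecf_moment n \<omega> e 0 u)
     (ecf_moment n \<omega> e 2 u / ecf_moment n \<omega> e 0 u) (ecf_moment n \<omega> e 3 u / ecf_moment n \<omega> e 0 u)
     (ecf_moment n \<omega> e 4 u / ecf_moment n \<omega> e 0 u) - cumulant4 0 0 0 0) \<le> 75 * Q ^ 3 * Q"
      using cumulant4_lipschitz[of Q "\<lambda>j. ecf_moment n \<omega> e j u / ecf_moment n \<omega> e 0 u" "\<lambda>_. 0" Q] q Q1 by simp
    then show ?thesis by (simp add: log_deriv4_ecf cumulant4_def)
  qed
  have "cmod (est_symbol h n \<omega> u) \<le> 2 * (75 * Q ^ 3 * Q)" for u
  proof (cases "u \<in> freq_square h")
    case True
    have "cmod (est_symbol h n \<omega> u) = cmod (log_deriv4 (1, 0) (ecf n (sample \<omega>)) u + log_deriv4 (0, 1) (ecf n (sample \<omega>)) u)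
       * cmod (fourier_measure \<kappa> (h *\<^sub>R u))"
      using True by (simp add: est_symbol_def norm_mult)
    also have "\<dots> \<le> (75 * Q ^ 3 * Q + 75 * Q ^ 3 * Q) * 1"
      using Q1 by (intro mult_mono fourier_kappa_norm_le order_trans[OF norm_triangle_ineq] add_mono cm True)
        (auto simp: norm_prod_def)
    finally show ?thesis by (simp add: mult_ac)
  next
    case False
    then show ?thesis using Q1 by (simp add: est_symbol_def)
  qed
  then show ?thesis by blast
qed

lemma inv_est_symbol_bounded:
  assumes h: "0 < h" and good: "good_cf h n \<omega>"
  shows "\<exists>B. \<forall>y. cmod (inv_fourier (est_symbol h n \<omega>) y) \<le> B"
proof -
  obtain B where B: "\<And>u. cmod (est_symbol h n \<omega> u) \<le> B" using est_symbol_bounded[OF assms] by blast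
  have "cmod (est_symbol h n \<omega> u) \<le> indicator (freq_square h) u * B" for u
    using B[of u] by (cases "u \<in> freq_square h") (auto simp: est_symbol_def)
  from inv_fourier_norm_le[OF integrable_mult_left[OF freq_square_integral(1)[OF h]] this]
  show ?thesis by blast
qed

text \<open>The event that switches the estimator off does not involve the corner, so on each side
  of the case distinction continuity is that of \<open>orthant_integral\<close> or of a
  constant.\<close>

lemma Nhat_tendsto:
  assumes w: "\<omega> \<in> space M" and h: "0 < h"
    and ab: "as \<longlonglongrightarrow> a" "bs \<longlonglongrightarrow> b"
    and nn: "\<And>m. 0 \<le> as m" "\<And>m. 0 \<le> bs m" and d: "0 < \<delta>" "\<And>m. \<delta> \<le> max (as m) (bs m)"
  shows "(\<lambda>m. Nhat h n \<omega> (as m) (bs m)) \<longlonglongrightarrow> Nhat h n \<omega> a b"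
proof (cases "good_cf h n \<omega>")
  case True
  obtain B where B: "\<And>y. cmod (inv_fourier (est_symbol h n \<omega>) y) \<le> B" using inv_est_symbol_bounded[OF h True] by blast
  show ?thesis
    unfolding Nhat_eq[OF h] if_P[OF True]
    by (rule orthant_integral_tendsto[OF ab nn d _ B]) (use w in measurable)
next
  case False
  show ?thesis unfolding Nhat_eq[OF h] if_not_P[OF False] by simp
qed

lemma Nhat_bounded:
  assumes h: "0 < h" and d: "0 < \<delta>"
  shows "\<exists>C. \<forall>a b. 0 \<le> a \<longrightarrow> 0 \<le> b \<longrightarrow> \<delta> \<le> max a b \<longrightarrow> cmod (Nhat h n \<omega> a b) \<le> C"
proof (cases "good_cf h n \<omega>")
  case True
  obtain B where B: "\<And>y. cmod (inv_fourier (est_symbol h n \<omega>) y) \<le> B" using inv_est_symbol_bounded[OF h True] by blast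
  have "cmod (Nhat h n \<omega> a b) \<le> 8 * pi\<^sup>2 / min \<delta> 1 ^ 4 * B" if "0 \<le> a" "0 \<le> b" "\<delta> \<le> max a b" for a b
    unfolding Nhat_eq[OF h] if_P[OF True]
    by (rule orthant_integral_norm_le[OF that(1,2) _ _ _ B]) (use d that in auto)
  then show ?thesis by blast
next
  case False
  show ?thesis unfolding Nhat_eq[OF h] if_not_P[OF False] by auto
qed

lemma ecf_continuous: "continuous_on S (ecf n x)"
  unfolding ecf_def[abs_def] by (cases "n = 0") (auto intro!: continuous_intros)

lemma phi_continuous: "continuous_on S \<phi>"
proof -
  have "continuous (at u) \<phi>" for u
    unfolding continuous_at_sequentially
  proof (intro allI impI)
    fix s :: "nat \<Rightarrow> real \<times> real" assume s: "s \<longlonglongrightarrow> u"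
    show "(\<phi> \<circ> s) \<longlonglongrightarrow> \<phi> u"
      unfolding o_def phi_eq fourier_measure_def
    proof (rule integral_dominated_convergence[where w="\<lambda>_. 1"])
      show "AE x in P. (\<lambda>i. iexp (s i \<bullet> x)) \<longlonglongrightarrow> iexp (u \<bullet> x)"
        by (intro AE_I2 tendsto_intros s)
    qed auto
  qed
  then show ?thesis by (auto simp: continuous_on_eq_continuous_within intro: continuous_at_imp_continuous_at_within)
qed

lemma ecf_measurable [measurable]: "(\<lambda>\<omega>. ecf n (sample \<omega>) u) \<in> borel_measurable M"
  using ecf_moment_measurable[of n 0 0 u] by (simp add: ecf_moment_0)

lemma good_cf_measurable [measurable]: "Measurable.pred M (good_cf h n)"
proof -
  have "{\<omega> \<in> space M. \<forall>u\<in>freq_square h. cmod (ecf n (sample \<omega>) u) - cmod (\<phi> u) / 2 > 0} \<in> sets M"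
    by (rule measurable_Ball_compact_gr[OF freq_square_compact])
       (auto intro!: continuous_intros ecf_continuous phi_continuous)
  then show ?thesis by (simp add: pred_def)
qed

lemma Nhat_joint_measurable [measurable]:
  assumes h: "0 < h" and [measurable]: "f \<in> measurable N M" "a \<in> borel_measurable N" "b \<in> borel_measurable N"
  shows "(\<lambda>p. Nhat h n (f p) (a p) (b p)) \<in> borel_measurable N"
proof -
  have [measurable]: "Measurable.pred N (\<lambda>p. good_cf h n (f p))"
    by (rule measurable_compose[OF assms(2) good_cf_measurable])
  show ?thesis
    unfolding Nhat_eq[OF h] orthant_integral_def inv_fourier_def by measurable
qed

end

section \<open>The copula estimator\<close>

locale levy_copula_margins = levy_copula_setting +
  assumes V1_bij: "bij_betw (tail_integral1 \<nu>) {0<..} {0<..}"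
    and V2_bij: "bij_betw (tail_integral2 \<nu>) {0<..} {0<..}"
begin

text \<open>The norm is at least \<open>max a b\<close> on the orthant, so the finite second moment
  bounds its mass. Finiteness has to accompany every use of the real-valued \<open>measure\<close>,
  as \<open>\<nu>\<close> may be infinite.\<close>

lemma orthant_fmeasurable:
  assumes "0 \<le> a" "0 \<le> b" "0 < max a b"
  shows "orthant a b \<in> fmeasurable \<nu>"
proof -
  let ?d = "max a b"
  have i: "integrable \<nu> (\<lambda>x. norm x ^ 2 / ?d\<^sup>2)" using nu_moments[of 2] by simp
  have "integrable \<nu> (indicator (orthant a b) :: _ \<Rightarrow> real)"
  proof (rule Bochner_Integration.integrable_bound[OF i])
    show "AE x in \<nu>. norm (indicator (orthant a b) x :: real) \<le> norm (norm x ^ 2 / ?d\<^sup>2)"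
    proof (rule AE_I2)
      fix x :: "real \<times> real"
      have "?d \<le> norm x" if "x \<in> orthant a b"
      proof -
        have "\<bar>fst x\<bar> \<le> norm x" "\<bar>snd x\<bar> \<le> norm x"
          using norm_fst_le[of "fst x" "snd x"] norm_snd_le[of "snd x" "fst x"] by simp_all
        then show ?thesis using that by (cases x) auto
      qed
      then have "?d\<^sup>2 \<le> (norm x)\<^sup>2" if "x \<in> orthant a b" using that assms by (intro power_mono) auto
      then show "norm (indicator (orthant a b) x :: real) \<le> norm (norm x ^ 2 / ?d\<^sup>2)"
        using assms by (auto simp: indicator_def)
    qed
  qed simp
  then have "emeasure \<nu> (orthant a b) < \<infinity>" by (simp add: integrable_indicator_iff)
  then show ?thesis by (intro fmeasurableI) auto
qed

lemma V1_antimono: "0 < x \<Longrightarrow> x \<le> y \<Longrightarrow> tail_integral1 \<nu> y \<le> tail_integral1 \<nu> x"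
  unfolding tail_integral1_def by (intro measure_mono_fmeasurable orthant_fmeasurable) auto

lemma V2_antimono: "0 < x \<Longrightarrow> x \<le> y \<Longrightarrow> tail_integral2 \<nu> y \<le> tail_integral2 \<nu> x"
  unfolding tail_integral2_def by (intro measure_mono_fmeasurable orthant_fmeasurable) auto

text \<open>The difference is the mass of a half-strip, which is contained in the half-strip over
  the same base starting at height 0.\<close>

lemma tail_integral_fst_diff:
  assumes "0 < x" "x \<le> x'" "0 < y"
  shows "\<bar>tail_integral \<nu> x y - tail_integral \<nu> x' y\<bar> \<le> tail_integral1 \<nu> x - tail_integral1 \<nu> x'"
proof -
  have f: "orthant x y \<in> fmeasurable \<nu>" "orthant x' y \<in> fmeasurable \<nu>" "orthant x 0 \<in> fmeasurable \<nu>" "orthant x' 0 \<in> fmeasurable \<nu>"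
    using assms by (auto intro!: orthant_fmeasurable)
  have "tail_integral \<nu> x y - tail_integral \<nu> x' y = measure \<nu> (orthant x y - orthant x' y)"
    unfolding tail_integral_def using assms f
    by (subst measurable_measure_Diff) auto
  moreover have "tail_integral1 \<nu> x - tail_integral1 \<nu> x' = measure \<nu> (orthant x 0 - orthant x' 0)"
    unfolding tail_integral1_def using assms f
    by (subst measurable_measure_Diff) auto
  moreover have "measure \<nu> (orthant x y - orthant x' y) \<le> measure \<nu> (orthant x 0 - orthant x' 0)"
    using assms f by (intro measure_mono_fmeasurable fmeasurable.Diff) auto
  ultimately show ?thesis by simp
qed

lemma tail_integral_snd_diff:
  assumes "0 < y" "y \<le> y'" "0 < x"
  shows "\<bar>tail_integral \<nu> x y - tail_integral \<nu> x y'\<bar> \<le> tail_integral2 \<nu> y - tail_integral2 \<nu> y'"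
proof -
  have f: "orthant x y \<in> fmeasurable \<nu>" "orthant x y' \<in> fmeasurable \<nu>" "orthant 0 y \<in> fmeasurable \<nu>" "orthant 0 y' \<in> fmeasurable \<nu>"
    using assms by (auto intro!: orthant_fmeasurable)
  have "tail_integral \<nu> x y - tail_integral \<nu> x y' = measure \<nu> (orthant x y - orthant x y')"
    unfolding tail_integral_def using assms f
    by (subst measurable_measure_Diff) auto
  moreover have "tail_integral2 \<nu> y - tail_integral2 \<nu> y' = measure \<nu> (orthant 0 y - orthant 0 y')"
    unfolding tail_integral2_def using assms f
    by (subst measurable_measure_Diff) auto
  moreover have "measure \<nu> (orthant x y - orthant x y') \<le> measure \<nu> (orthant 0 y - orthant 0 y')"
    using assms f by (intro measure_mono_fmeasurable fmeasurable.Diff) auto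
  ultimately show ?thesis by simp
qed

lemma tail_integral_lipschitz:
  assumes "0 < x" "0 < y" "0 < x'" "0 < y'"
  shows "\<bar>tail_integral \<nu> x y - tail_integral \<nu> x' y'\<bar> \<le>
     \<bar>tail_integral1 \<nu> x - tail_integral1 \<nu> x'\<bar> + \<bar>tail_integral2 \<nu> y - tail_integral2 \<nu> y'\<bar>"
proof -
  have 1: "\<bar>tail_integral \<nu> x y - tail_integral \<nu> x' y\<bar> \<le> \<bar>tail_integral1 \<nu> x - tail_integral1 \<nu> x'\<bar>"
    using tail_integral_fst_diff[of x x' y] tail_integral_fst_diff[of x' x y] assms by linarith
  have 2: "\<bar>tail_integral \<nu> x' y - tail_integral \<nu> x' y'\<bar> \<le> \<bar>tail_integral2 \<nu> y - tail_integral2 \<nu> y'\<bar>"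
    using tail_integral_snd_diff[of y y' x'] tail_integral_snd_diff[of y' y x'] assms by linarith
  from 1 2 show ?thesis by linarith
qed

abbreviation V1inv :: "real \<Rightarrow> real" where "V1inv \<equiv> inv_into {0<..} (tail_integral1 \<nu>)"
abbreviation V2inv :: "real \<Rightarrow> real" where "V2inv \<equiv> inv_into {0<..} (tail_integral2 \<nu>)"

lemma V1inv: "0 < u \<Longrightarrow> 0 < V1inv u" "0 < u \<Longrightarrow> tail_integral1 \<nu> (V1inv u) = u"
  using V1_bij inv_into_into[of u "tail_integral1 \<nu>" "{0<..}"] f_inv_into_f[of u "tail_integral1 \<nu>" "{0<..}"]
  by (auto simp: bij_betw_def)

lemma V2inv: "0 < u \<Longrightarrow> 0 < V2inv u" "0 < u \<Longrightarrow> tail_integral2 \<nu> (V2inv u) = u"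
  using V2_bij inv_into_into[of u "tail_integral2 \<nu>" "{0<..}"] f_inv_into_f[of u "tail_integral2 \<nu>" "{0<..}"]
  by (auto simp: bij_betw_def)

lemma levy_copula_lipschitz:
  assumes "0 < u" "0 < v" "0 < u'" "0 < v'"
  shows "\<bar>levy_copula \<nu> u v - levy_copula \<nu> u' v'\<bar> \<le> \<bar>u - u'\<bar> + \<bar>v - v'\<bar>"
  using tail_integral_lipschitz[of "V1inv u" "V2inv v" "V1inv u'" "V2inv v'"] V1inv V2inv assms
  by (simp add: levy_copula_def)

lemma levy_copula_bounds:
  assumes "0 < u" "0 < v"
  shows "0 \<le> levy_copula \<nu> u v" "levy_copula \<nu> u v \<le> u"
proof -
  show "0 \<le> levy_copula \<nu> u v" by (simp add: levy_copula_def tail_integral_def)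
  have "tail_integral \<nu> x y \<le> tail_integral1 \<nu> x" if "0 < x" "0 < y" for x y
    unfolding tail_integral_def tail_integral1_def using that
    by (intro measure_mono_fmeasurable orthant_fmeasurable) auto
  from this[OF V1inv(1)[OF assms(1)] V2inv(1)[OF assms(2)]]
  have "tail_integral \<nu> (V1inv u) (V2inv v) \<le> tail_integral1 \<nu> (V1inv u)" .
  then show "levy_copula \<nu> u v \<le> u" by (simp add: levy_copula_def V1inv(2)[OF assms(1)])
qed

section \<open>The plug-in copula estimator: regularity and measurability of its error\<close>

definition g1 :: "real \<Rightarrow> nat \<Rightarrow> 'a \<Rightarrow> real \<Rightarrow> real" where "g1 h n \<omega> s = max (Re (Nhat h n \<omega> s 0)) 0"
definition g2 :: "real \<Rightarrow> nat \<Rightarrow> 'a \<Rightarrow> real \<Rightarrow> real" where "g2 h n \<omega> s = max (Re (Nhat h n \<omega> 0 s)) 0"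

definition Chat :: "real \<Rightarrow> real \<Rightarrow> nat \<Rightarrow> 'a \<Rightarrow> real \<Rightarrow> real \<Rightarrow> complex" where
  "Chat h \<delta> n \<omega> u v = Nhat h n \<omega> (inversion (g1 h n \<omega>) \<delta> u) (inversion (g2 h n \<omega>) \<delta> v)"

lemma copula_estimator_eq: "copula_estimator K \<phi> n (sample \<omega>) u v = Chat (bandwidth n) (cutoff n) n \<omega> u v"
  by (simp add: copula_estimator_def Let_def Chat_def g1_def[abs_def] g2_def[abs_def])

lemma Nhat_vanish:
  assumes w: "\<omega> \<in> space M" and h: "0 < h"
  shows "((\<lambda>s. Nhat h n \<omega> s 0) \<longlongrightarrow> 0) at_top" "((\<lambda>s. Nhat h n \<omega> 0 s) \<longlongrightarrow> 0) at_top"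
proof -
  have "((\<lambda>s. Nhat h n \<omega> s 0) \<longlongrightarrow> 0) at_top \<and> ((\<lambda>s. Nhat h n \<omega> 0 s) \<longlongrightarrow> 0) at_top"
  proof (cases "good_cf h n \<omega>")
    case True
    obtain B where B: "\<And>y. cmod (inv_fourier (est_symbol h n \<omega>) y) \<le> B" using inv_est_symbol_bounded[OF h True] by blast
    have m: "inv_fourier (est_symbol h n \<omega>) \<in> borel_measurable borel" using w by measurable
    show ?thesis
      unfolding Nhat_eq[OF h] if_P[OF True]
      using orthant_integral_vanish[OF m B] by blast
  next
    case False
    show ?thesis unfolding Nhat_eq[OF h] if_not_P[OF False] by simp
  qed
  then show "((\<lambda>s. Nhat h n \<omega> s 0) \<longlongrightarrow> 0) at_top" "((\<lambda>s. Nhat h n \<omega> 0 s) \<longlongrightarrow> 0) at_top" by auto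
qed

lemma vanishing_g:
  assumes w: "\<omega> \<in> space M" and h: "0 < h"
  shows "vanishing (g1 h n \<omega>)" "vanishing (g2 h n \<omega>)"
proof -
  have "((\<lambda>s. max (Re (Nhat h n \<omega> s 0)) 0) \<longlongrightarrow> max (Re 0) 0) at_top"
       "((\<lambda>s. max (Re (Nhat h n \<omega> 0 s)) 0) \<longlongrightarrow> max (Re 0) 0) at_top"
    by (intro tendsto_intros Nhat_vanish[OF w h])+
  then show "vanishing (g1 h n \<omega>)" "vanishing (g2 h n \<omega>)"
    by (auto simp: vanishing_def g1_def[abs_def] g2_def[abs_def])
qed

lemma continuous_g:
  assumes w: "\<omega> \<in> space M" and h: "0 < h" and d: "0 < \<delta>"
  shows "continuous_on {\<delta>..} (g1 h n \<omega>)" "continuous_on {\<delta>..} (g2 h n \<omega>)"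
proof -
  have "continuous_on {\<delta>..} (g1 h n \<omega>) \<and> continuous_on {\<delta>..} (g2 h n \<omega>)"
    unfolding continuous_on_sequentially o_def
  proof (intro conjI allI ballI impI; elim conjE)
    fix s :: "nat \<Rightarrow> real" and a assume a: "a \<in> {\<delta>..}" "\<forall>n. s n \<in> {\<delta>..}" "s \<longlonglongrightarrow> a"
    have s: "\<And>m. 0 \<le> s m" "\<And>m. \<delta> \<le> max (s m) 0" "\<And>m. \<delta> \<le> max 0 (s m)" using a d by (auto intro: order_trans[of 0 \<delta>] simp: le_max_iff_disj)
    show "(\<lambda>m. g1 h n \<omega> (s m)) \<longlonglongrightarrow> g1 h n \<omega> a"
      unfolding g1_def using s d
      by (intro tendsto_intros Nhat_tendsto[OF w h a(3), where \<delta>=\<delta>]) auto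
    show "(\<lambda>m. g2 h n \<omega> (s m)) \<longlonglongrightarrow> g2 h n \<omega> a"
      unfolding g2_def using s d
      by (intro tendsto_intros Nhat_tendsto[OF w h _ a(3), where \<delta>=\<delta>]) auto
  qed
  then show "continuous_on {\<delta>..} (g1 h n \<omega>)" "continuous_on {\<delta>..} (g2 h n \<omega>)" by auto
qed

lemma inversion_g_measurable [measurable]:
  assumes h: "0 < h" and d: "0 < \<delta>" and u: "0 < u"
  shows "(\<lambda>\<omega>. inversion (g1 h n \<omega>) \<delta> u) \<in> borel_measurable M" "(\<lambda>\<omega>. inversion (g2 h n \<omega>) \<delta> u) \<in> borel_measurable M"
proof -
  have [measurable]: "(\<lambda>\<omega>. Nhat h n \<omega> x y) \<in> borel_measurable M" for x y
    using Nhat_joint_measurable[OF h, of "\<lambda>\<omega>. \<omega>" M "\<lambda>_. x" "\<lambda>_. y"] by simp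
  have "(\<lambda>\<omega>. g1 h n \<omega> x) \<in> borel_measurable M" "(\<lambda>\<omega>. g2 h n \<omega> x) \<in> borel_measurable M" for x
    unfolding g1_def g2_def by measurable
  then show "(\<lambda>\<omega>. inversion (g1 h n \<omega>) \<delta> u) \<in> borel_measurable M" "(\<lambda>\<omega>. inversion (g2 h n \<omega>) \<delta> u) \<in> borel_measurable M"
    by (auto intro!: measurable_inversion vanishing_g continuous_g h d u)
qed

lemma Chat_measurable [measurable]:
  assumes "0 < h" "0 < \<delta>" "0 < u" "0 < v"
  shows "(\<lambda>\<omega>. Chat h \<delta> n \<omega> u v) \<in> borel_measurable M"
  unfolding Chat_def
  by (rule Nhat_joint_measurable[OF assms(1) measurable_ident_sets[OF refl] inversion_g_measurable(1)[OF assms(1,2,3)] inversion_g_measurable(2)[OF assms(1,2,4)], unfolded id_def])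

lemma inversion_g_ge:
  assumes w: "\<omega> \<in> space M" and h: "0 < h" and u: "0 < u"
  shows "\<delta> \<le> inversion (g1 h n \<omega>) \<delta> u" "\<delta> \<le> inversion (g2 h n \<omega>) \<delta> u"
  using vanishing.inversion_ge[OF vanishing_g(1)[OF w h] u] vanishing.inversion_ge[OF vanishing_g(2)[OF w h] u] by auto

text \<open>Both inverses converge from the right and stay above the cutoff, the region where the
  tail estimator is continuous in its corner.\<close>

lemma Chat_right_continuous:
  assumes w: "\<omega> \<in> space M" and h: "0 < h" and d: "0 < \<delta>" and u: "0 < u" and v: "0 < v"
    and s: "\<And>m. u \<le> s m" "s \<longlonglongrightarrow> u" and r: "\<And>m. v \<le> r m" "r \<longlonglongrightarrow> v"
  shows "(\<lambda>m. Chat h \<delta> n \<omega> (s m) (r m)) \<longlonglongrightarrow> Chat h \<delta> n \<omega> u v"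
  unfolding Chat_def
proof (rule Nhat_tendsto[OF w h, where \<delta>=\<delta>])
  show "(\<lambda>m. inversion (g1 h n \<omega>) \<delta> (s m)) \<longlonglongrightarrow> inversion (g1 h n \<omega>) \<delta> u"
    by (rule vanishing.inversion_right_continuous[OF vanishing_g(1)[OF w h] u s])
  show "(\<lambda>m. inversion (g2 h n \<omega>) \<delta> (r m)) \<longlonglongrightarrow> inversion (g2 h n \<omega>) \<delta> v"
    by (rule vanishing.inversion_right_continuous[OF vanishing_g(2)[OF w h] v r])
  have sp: "0 < s m" "0 < r m" for m using u v s(1)[of m] r(1)[of m] by auto
  show "0 \<le> inversion (g1 h n \<omega>) \<delta> (s m)" "0 \<le> inversion (g2 h n \<omega>) \<delta> (r m)"
      "\<delta> \<le> max (inversion (g1 h n \<omega>) \<delta> (s m)) (inversion (g2 h n \<omega>) \<delta> (r m))" for m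
    using inversion_g_ge(1)[OF w h sp(1)[of m], of \<delta> n] inversion_g_ge(2)[OF w h sp(2)[of m], of \<delta> n] d by auto
qed (rule d)

definition copula_error :: "real \<Rightarrow> real \<Rightarrow> nat \<Rightarrow> 'a \<Rightarrow> real \<Rightarrow> real \<Rightarrow> real" where
  "copula_error h \<delta> n \<omega> u v = cmod (complex_of_real (levy_copula \<nu> u v) - Chat h \<delta> n \<omega> u v)"

text \<open>
  The estimated inverses are right-continuous only, so a countable set that determines the supremum
  has to contain the right end point.
\<close>

lemma right_approximation:
  fixes a b u :: real
  assumes "u \<in> {a..b}"
  shows "\<exists>s. (\<forall>m::nat. s m \<in> (\<rat> \<inter> {a..b}) \<union> {b} \<and> u \<le> s m) \<and> s \<longlonglongrightarrow> u"
proof (cases "u = b")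
  case True
  then show ?thesis by (intro exI[of _ "\<lambda>_. b"]) auto
next
  case False
  then have "u < b" using assms by simp
  have "\<exists>q\<in>\<rat>. u < q \<and> q < min b (u + 1 / real (Suc m))" for m
    using \<open>u < b\<close> by (intro Rats_dense_in_real) simp
  then obtain s where s: "\<And>m. s m \<in> \<rat> \<and> u < s m \<and> s m < min b (u + 1 / real (Suc m))" by metis
  have "s \<longlonglongrightarrow> u"
  proof (rule tendsto_sandwich)
    show "\<forall>\<^sub>F m in sequentially. u \<le> s m" "\<forall>\<^sub>F m in sequentially. s m \<le> u + 1 / real (Suc m)"
      using s by (auto intro!: always_eventually less_imp_le)
    have "(\<lambda>m. 1 / real (Suc m)) \<longlonglongrightarrow> 0"
      using LIMSEQ_inverse_real_of_nat by (simp add: inverse_eq_divide)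
    from tendsto_add[OF tendsto_const[of u] this]
    show "(\<lambda>m. u + 1 / real (Suc m)) \<longlonglongrightarrow> u" by simp
  qed simp
  moreover have "\<forall>m. s m \<in> (\<rat> \<inter> {a..b}) \<union> {b} \<and> u \<le> s m" using s assms by (auto intro: less_imp_le order_trans)
  ultimately show ?thesis by blast
qed

text \<open>Each value of the error is a limit of values at points of the countable set, approached
  from the right in both variables at once; the copula itself is continuous by its Lipschitz
  bound.\<close>

lemma copula_error_SUP_countable:
  assumes w: "\<omega> \<in> space M" and h: "0 < h" and d: "0 < \<delta>" and ab: "0 < a" "a < b"
  shows "(SUP (u, v)\<in>{a..b} \<times> {a..b}. ereal (copula_error h \<delta> n \<omega> u v)) =
     (SUP (u, v)\<in>((\<rat> \<inter> {a..b}) \<union> {b}) \<times> ((\<rat> \<inter> {a..b}) \<union> {b}). ereal (copula_error h \<delta> n \<omega> u v))"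
    (is "_ = ?R")
proof (rule antisym)
  show "?R \<le> (SUP (u, v)\<in>{a..b} \<times> {a..b}. ereal (copula_error h \<delta> n \<omega> u v))"
    using ab by (intro SUP_subset_mono) auto
  show "(SUP (u, v)\<in>{a..b} \<times> {a..b}. ereal (copula_error h \<delta> n \<omega> u v)) \<le> ?R"
  proof (rule SUP_least, clarify)
    fix u v assume uv: "u \<in> {a..b}" "v \<in> {a..b}"
    obtain s where s: "\<And>m. s m \<in> (\<rat> \<inter> {a..b}) \<union> {b}" "\<And>m. u \<le> s m" "s \<longlonglongrightarrow> u"
      using right_approximation[OF uv(1)] by blast
    obtain r where r: "\<And>m. r m \<in> (\<rat> \<inter> {a..b}) \<union> {b}" "\<And>m. v \<le> r m" "r \<longlonglongrightarrow> v"
      using right_approximation[OF uv(2)] by blast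
    have p: "0 < u" "0 < v" using uv ab by auto
    have C: "(\<lambda>m. levy_copula \<nu> (s m) (r m)) \<longlonglongrightarrow> levy_copula \<nu> u v"
    proof (rule LIM_zero_cancel, rule tendsto_rabs_zero_cancel, rule tendsto_sandwich[of "\<lambda>_. 0"])
      show "\<forall>\<^sub>F m in sequentially. \<bar>levy_copula \<nu> (s m) (r m) - levy_copula \<nu> u v\<bar> \<le> \<bar>s m - u\<bar> + \<bar>r m - v\<bar>"
        using p s(2) r(2) by (intro always_eventually allI levy_copula_lipschitz) (auto intro: less_le_trans)
      have "(\<lambda>m. \<bar>s m - u\<bar> + \<bar>r m - v\<bar>) \<longlonglongrightarrow> \<bar>u - u\<bar> + \<bar>v - v\<bar>"
        by (intro tendsto_intros s r)
      then show "(\<lambda>m. \<bar>s m - u\<bar> + \<bar>r m - v\<bar>) \<longlonglongrightarrow> 0" by simp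
    qed auto
    have "(\<lambda>m. ereal (copula_error h \<delta> n \<omega> (s m) (r m))) \<longlonglongrightarrow> ereal (copula_error h \<delta> n \<omega> u v)"
      unfolding copula_error_def
      by (intro tendsto_intros C Chat_right_continuous[OF w h d p s(2,3) r(2,3)])
    then show "ereal (copula_error h \<delta> n \<omega> u v) \<le> ?R"
    proof (rule LIMSEQ_le_const2, intro exI[of _ 0] allI impI)
      fix m :: nat
      show "ereal (copula_error h \<delta> n \<omega> (s m) (r m)) \<le> ?R"
        using s(1)[of m] r(1)[of m] by (intro SUP_upper2[of "(s m, r m)"]) auto
    qed
  qed
qed

lemma copula_error_SUP_measurable:
  assumes h: "0 < h" and d: "0 < \<delta>" and ab: "0 < a" "a < b"
  shows "(\<lambda>\<omega>. SUP (u, v)\<in>{a..b} \<times> {a..b}. ereal (copula_error h \<delta> n \<omega> u v)) \<in> borel_measurable M"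
proof -
  let ?D = "(\<rat> \<inter> {a..b}) \<union> {b}"
  have "(\<lambda>\<omega>. SUP (u, v)\<in>?D \<times> ?D. ereal (copula_error h \<delta> n \<omega> u v)) \<in> borel_measurable M"
  proof (rule borel_measurable_SUP)
    show "countable (?D \<times> ?D)"
      by (intro countable_SIGMA countable_Un countable_Int1 countable_rat) auto
    fix i assume i: "i \<in> ?D \<times> ?D"
    then have p: "0 < fst i" "0 < snd i" using ab by auto
    show "(\<lambda>\<omega>. case i of (u, v) \<Rightarrow> ereal (copula_error h \<delta> n \<omega> u v)) \<in> borel_measurable M"
      using Chat_measurable[OF h d p] unfolding copula_error_def case_prod_beta by measurable
  qed
  then show ?thesis
    by (subst measurable_cong[OF copula_error_SUP_countable[OF _ h d ab]]) auto
qed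

lemma copula_error_SUP_finite:
  assumes w: "\<omega> \<in> space M" and h: "0 < h" and d: "0 < \<delta>" and ab: "0 < a" "a < b"
  shows "\<exists>C. (SUP (u, v)\<in>{a..b} \<times> {a..b}. ereal (copula_error h \<delta> n \<omega> u v)) \<le> ereal C"
proof -
  obtain C where C: "\<And>x y. 0 \<le> x \<Longrightarrow> 0 \<le> y \<Longrightarrow> \<delta> \<le> max x y \<Longrightarrow> cmod (Nhat h n \<omega> x y) \<le> C"
    using Nhat_bounded[OF h d] by blast
  have "copula_error h \<delta> n \<omega> u v \<le> b + C" if uv: "u \<in> {a..b}" "v \<in> {a..b}" for u v
  proof -
    have p: "0 < u" "0 < v" using uv ab by auto
    have "copula_error h \<delta> n \<omega> u v \<le> cmod (complex_of_real (levy_copula \<nu> u v)) + cmod (Chat h \<delta> n \<omega> u v)"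
      unfolding copula_error_def by (rule norm_triangle_ineq4)
    also have "\<dots> \<le> b + C"
    proof (rule add_mono)
      show "cmod (complex_of_real (levy_copula \<nu> u v)) \<le> b" using levy_copula_bounds[OF p] uv by simp
      show "cmod (Chat h \<delta> n \<omega> u v) \<le> C"
        unfolding Chat_def using inversion_g_ge(1)[OF w h p(1), of \<delta> n] inversion_g_ge(2)[OF w h p(2), of \<delta> n] d
        by (intro C) auto
    qed
    finally show ?thesis .
  qed
  then show ?thesis by (intro exI[of _ "b + C"] SUP_least) auto
qed

text \<open>Each inverse costs \<open>\<epsilon>\<close> through the Lipschitz bound, and evaluating
  the tail estimator at the random corner costs another. The last step uses that \<open>err\<close>
  is uniform over all corners beyond the cutoff.\<close>

lemma copula_error_le:
  assumes w: "\<omega> \<in> space M" and d: "0 < \<delta>"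
    and err: "\<And>x y. 0 \<le> x \<Longrightarrow> 0 \<le> y \<Longrightarrow> \<delta> \<le> max x y \<Longrightarrow>
        cmod (Nhat h n \<omega> x y - complex_of_real (measure \<nu> (orthant x y))) \<le> \<epsilon>"
    and uv: "\<epsilon> < u" "\<epsilon> < v" "u + \<epsilon> < tail_integral1 \<nu> \<delta>" "v + \<epsilon> < tail_integral2 \<nu> \<delta>"
  shows "copula_error h \<delta> n \<omega> u v \<le> 3 * \<epsilon>"
proof -
  have e0: "0 \<le> \<epsilon>" using order_trans[OF norm_ge_zero err[of \<delta> 0]] d by simp
  have re: "\<bar>max (Re z) 0 - r\<bar> \<le> \<epsilon>" if "cmod (z - complex_of_real r) \<le> \<epsilon>" "0 \<le> r" for z r
    using that abs_Re_le_cmod[of "z - complex_of_real r"] by (auto simp: max_def)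
  have c1: "\<bar>g1 h n \<omega> x - tail_integral1 \<nu> x\<bar> \<le> \<epsilon>" and c2: "\<bar>g2 h n \<omega> x - tail_integral2 \<nu> x\<bar> \<le> \<epsilon>" if "\<delta> \<le> x" for x
    unfolding g1_def g2_def tail_integral1_def tail_integral2_def
    using that d by (auto intro!: re err)
  have nn: "0 \<le> g1 h n \<omega> x" "0 \<le> g2 h n \<omega> x" for x by (simp_all add: g1_def g2_def)
  have I1: "\<delta> \<le> inversion (g1 h n \<omega>) \<delta> u" "\<bar>tail_integral1 \<nu> (inversion (g1 h n \<omega>) \<delta> u) - u\<bar> \<le> \<epsilon>"
    using inversion_close[OF V1_antimono V1_bij nn(1) c1 d uv(1,3)] by auto
  have I2: "\<delta> \<le> inversion (g2 h n \<omega>) \<delta> v" "\<bar>tail_integral2 \<nu> (inversion (g2 h n \<omega>) \<delta> v) - v\<bar> \<le> \<epsilon>"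
    using inversion_close[OF V2_antimono V2_bij nn(2) c2 d uv(2,4)] by auto
  let ?x = "inversion (g1 h n \<omega>) \<delta> u" and ?y = "inversion (g2 h n \<omega>) \<delta> v"
  have p: "0 < u" "0 < v" "0 < ?x" "0 < ?y" using e0 uv I1 I2 d by auto
  have "\<bar>levy_copula \<nu> u v - tail_integral \<nu> ?x ?y\<bar> \<le> \<epsilon> + \<epsilon>"
    unfolding levy_copula_def
    using tail_integral_lipschitz[of "V1inv u" "V2inv v" ?x ?y] V1inv[OF p(1)] V2inv[OF p(2)] p I1(2) I2(2)
    by (simp add: abs_minus_commute)
  then have A: "cmod (complex_of_real (levy_copula \<nu> u v) - complex_of_real (tail_integral \<nu> ?x ?y)) \<le> \<epsilon> + \<epsilon>"
    by (simp only: of_real_diff[symmetric] norm_of_real)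
  have B: "cmod (complex_of_real (tail_integral \<nu> ?x ?y) - Nhat h n \<omega> ?x ?y) \<le> \<epsilon>"
    using err[of ?x ?y] p I1(1) by (simp add: tail_integral_def norm_minus_commute)
  have "copula_error h \<delta> n \<omega> u v \<le> (\<epsilon> + \<epsilon>) + \<epsilon>"
    unfolding copula_error_def Chat_def using norm_triangle_ineq[of "complex_of_real (levy_copula \<nu> u v) - complex_of_real (tail_integral \<nu> ?x ?y)"
      "complex_of_real (tail_integral \<nu> ?x ?y) - Nhat h n \<omega> ?x ?y"] A B by simp
  then show ?thesis by simp
qed

end

section \<open>Rates\<close>

text \<open>The bound of \<open>uniform_deviation\<close> with deviation and mesh both
  \<open>n powr (- 1 / 8)\<close> and Lipschitz level \<open>n powr (1 / 16)\<close>; its order is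
  \<open>n powr (- 1 / 16)\<close>.\<close>

definition deviation_rate :: "real \<Rightarrow> nat \<Rightarrow> real" where
  "deviation_rate l n = real n powr (- 1 / 8) + 2 * real n powr (- 1 / 8) * (real n powr (1 / 16) + l)"

text \<open>The frequency square has squared radius \<open>2 / h^2\<close>. With this bandwidth the
  exponent is \<open>2 * c * ln n / (ln (ln n))^2\<close>, up to sign, hence
  \<open>o(ln n)\<close>.\<close>

definition cf_lower_bound :: "real \<Rightarrow> nat \<Rightarrow> real" where
  "cf_lower_bound c n = exp (- c * (2 / (bandwidth n)\<^sup>2))"

definition copula_rate :: "nat \<Rightarrow> real" where
  "copula_rate n = ln (ln (real n)) ^ 9 / sqrt (ln (real n))"

lemma deviation_rate_small:
  assumes "0 < c" "0 < l"
  shows "(\<lambda>n. deviation_rate l n / cf_lower_bound c n) \<longlonglongrightarrow> 0"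
  unfolding deviation_rate_def cf_lower_bound_def bandwidth_def using assms by real_asymp

text \<open>The fifth inverse power of the lower bound is \<open>exp (10 * c / h^2)\<close>, which
  grows more slowly than any power of \<open>n\<close>; the remaining factors are powers of
  logarithms.\<close>

lemma stochastic_error_small:
  assumes "0 < c" "0 < l"
  shows "(\<lambda>n. deviation_rate l n / (cf_lower_bound c n ^ 5 * (bandwidth n)\<^sup>2 * cutoff n ^ 4) / copula_rate n) \<longlonglongrightarrow> 0"
  unfolding deviation_rate_def cf_lower_bound_def bandwidth_def cutoff_def copula_rate_def using assms by real_asymp

text \<open>Counting powers of \<open>ln (ln n)\<close> in the bias: one from \<open>h\<close>, two
  from the squared logarithmic factor, five from the cutoff. Eight against nine leaves a quotient of
  order \<open>1 / ln (ln n)\<close>.\<close>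

lemma bias_small:
  "(\<lambda>n. bandwidth n * (log_factor (bandwidth n))\<^sup>2 / cutoff n ^ 5 / copula_rate n) \<longlonglongrightarrow> 0"
  unfolding log_factor_def bandwidth_def cutoff_def copula_rate_def by real_asymp

text \<open>The grid has about \<open>n powr (1 / 4) / h^2\<close> points, each failing with
  probability of order \<open>n powr (- 3 / 4)\<close>; Markov contributes
  \<open>n powr (- 1 / 16)\<close>.\<close>

lemma exceptional_probability_small:
  assumes "0 < l" "0 < v"
  shows "(\<lambda>n. l / real n powr (1 / 16) + 10 * (2 * (1 / bandwidth n / real n powr (- 1 / 8)) + 3)\<^sup>2 *
     (v / (real n * (real n powr (- 1 / 8))\<^sup>2))) \<longlonglongrightarrow> 0"
  unfolding bandwidth_def using assms by real_asymp

lemma copula_rate_tendsto: "copula_rate \<longlonglongrightarrow> 0"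
  unfolding copula_rate_def by real_asymp

lemma bandwidth_tendsto: "bandwidth \<longlonglongrightarrow> 0"
  unfolding bandwidth_def by real_asymp

lemma cutoff_tendsto: "cutoff \<longlonglongrightarrow> 0"
  unfolding cutoff_def by real_asymp

lemma ln_3_gt_1: "1 < ln (3::real)"
  using exp_le ln_less_cancel_iff[of "exp 1" "3::real"] e_less_272 by simp

lemma ln_gt_1: "3 \<le> n \<Longrightarrow> 1 < ln (real n)"
proof -
  assume "3 \<le> n"
  then have "ln 3 \<le> ln (real n)" by (subst ln_le_cancel_iff) auto
  then show ?thesis using ln_3_gt_1 by linarith
qed

text \<open>As 3 exceeds \<open>exp 1\<close>, it is the first index with \<open>ln (ln n)\<close>
  positive, which is why the stochastic order starts at \<open>n = 3\<close>.\<close>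

lemma positive_rates:
  assumes "3 \<le> n"
  shows "0 < bandwidth n" "0 < cutoff n" "0 < copula_rate n"
  using ln_gt_1[OF assms] by (auto simp: bandwidth_def cutoff_def copula_rate_def)

context levy_copula_margins
begin

text \<open>Randomness is confined to the events \<open>G n\<close>: on them the error has the
  deterministic bound \<open>E n\<close>, uniformly over all corners beyond the cutoff.\<close>

lemma uniform_estimator_error:
  obtains G E where "\<And>n. G n \<in> sets M" "(\<lambda>n. prob (space M - G n)) \<longlonglongrightarrow> 0" "(\<lambda>n. E n / copula_rate n) \<longlonglongrightarrow> 0"
    "\<forall>\<^sub>F n in sequentially. \<forall>\<omega>\<in>G n. \<forall>x y. 0 \<le> x \<longrightarrow> 0 \<le> y \<longrightarrow> cutoff n \<le> max x y \<longrightarrow>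
       cmod (Nhat (bandwidth n) n \<omega> x y - complex_of_real (measure \<nu> (orthant x y))) \<le> E n"
proof -
  obtain c0 where c0: "c0 \<ge> 0" "\<And>u. exp (- c0 * (norm u)\<^sup>2) \<le> cmod (\<phi> u)" using phi_lower_bound by blast
  \<comment> \<open>Raised by one to be strictly positive, as the asymptotic lemmas require;
    \<open>var_moment + 1\<close> serves the same purpose below.\<close>
  define c where "c = c0 + 1"
  have c: "0 < c" using c0(1) by (simp add: c_def)
  have l: "0 < lip_moment" using lip_moment_ge_1 by simp
  have v0: "0 < var_moment + 1"
  proof -
    have "0 \<le> var_moment" unfolding var_moment_def by (intro integral_nonneg_AE) auto
    then show ?thesis by simp
  qed
  define p where "p = (\<lambda>n. lip_moment / real n powr (1 / 16) + 10 * (2 * (1 / bandwidth n / real n powr (- 1 / 8)) + 3)\<^sup>2 *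
     ((var_moment + 1) / (real n * (real n powr (- 1 / 8))\<^sup>2)))"
  define T where "T = deviation_rate lip_moment"
  define m where "m = cf_lower_bound c"
  define E where "E = (\<lambda>n. 307200 * lip_moment ^ 4 * (T n / (m n ^ 5 * (bandwidth n)\<^sup>2 * cutoff n ^ 4))
     + (8 * measure \<mu> UNIV + 4 * c\<mu>) * (3 + 6 * L\<kappa>) * (bandwidth n * (log_factor (bandwidth n))\<^sup>2 / cutoff n ^ 5))"
  have "\<exists>G\<in>sets M. prob (space M - G) \<le> p n \<and>
     (\<forall>\<omega>\<in>G. \<forall>e\<in>{(1, 0), (0, 1)}. \<forall>j\<le>4. \<forall>u. \<bar>fst u\<bar> \<le> 1 / bandwidth n \<longrightarrow> \<bar>snd u\<bar> \<le> 1 / bandwidth n \<longrightarrow>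
        cmod (ecf_moment n \<omega> e j u - fourier_moment P e j u) \<le> T n)" if n: "3 \<le> n" for n
  proof -
    have q: "0 < n" "0 < real n powr (- 1 / 8)" "0 < real n powr (1 / 16)" "0 \<le> 1 / bandwidth n"
      using n positive_rates(1)[OF n] by auto
    obtain G where G: "G \<in> sets M"
      "prob (space M - G) \<le> lip_moment / real n powr (1 / 16) + 10 * (2 * (1 / bandwidth n / real n powr (- 1 / 8)) + 3)\<^sup>2 *
         (var_moment / (real n * (real n powr (- 1 / 8))\<^sup>2))"
      "\<forall>\<omega>\<in>G. \<forall>e\<in>{(1, 0), (0, 1)}. \<forall>j\<le>4. \<forall>u. \<bar>fst u\<bar> \<le> 1 / bandwidth n \<longrightarrow> \<bar>snd u\<bar> \<le> 1 / bandwidth n \<longrightarrow>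
        cmod (ecf_moment n \<omega> e j u - fourier_moment P e j u) \<le>
          real n powr (- 1 / 8) + 2 * real n powr (- 1 / 8) * (real n powr (1 / 16) + lip_moment)"
      using uniform_deviation[OF q(1,2,2,3,4)] by blast
    have "10 * (2 * (1 / bandwidth n / real n powr (- 1 / 8)) + 3)\<^sup>2 * (var_moment / (real n * (real n powr (- 1 / 8))\<^sup>2)) \<le>
       10 * (2 * (1 / bandwidth n / real n powr (- 1 / 8)) + 3)\<^sup>2 * ((var_moment + 1) / (real n * (real n powr (- 1 / 8))\<^sup>2))"
      by (intro mult_left_mono divide_right_mono) auto
    then have "prob (space M - G) \<le> p n" using G(2) unfolding p_def by linarith
    then show ?thesis using G(1,3) unfolding T_def deviation_rate_def by blast
  qed
  \<comment> \<open>For \<open>n < 3\<close> any event will do, so the choice of \<open>G\<close>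
    can be made for all \<open>n\<close> at once.\<close>
  then have "\<forall>n. \<exists>G. G \<in> sets M \<and> (3 \<le> n \<longrightarrow> prob (space M - G) \<le> p n \<and>
     (\<forall>\<omega>\<in>G. \<forall>e\<in>{(1, 0), (0, 1)}. \<forall>j\<le>4. \<forall>u. \<bar>fst u\<bar> \<le> 1 / bandwidth n \<longrightarrow> \<bar>snd u\<bar> \<le> 1 / bandwidth n \<longrightarrow>
        cmod (ecf_moment n \<omega> e j u - fourier_moment P e j u) \<le> T n))"
    by (metis sets.top)
  then obtain G where G: "\<And>n. G n \<in> sets M" "\<And>n. 3 \<le> n \<Longrightarrow> prob (space M - G n) \<le> p n"
     and dev: "\<And>n \<omega> e j u. 3 \<le> n \<Longrightarrow> \<omega> \<in> G n \<Longrightarrow> e \<in> {(1, 0), (0, 1)} \<Longrightarrow> j \<le> 4 \<Longrightarrow> \<bar>fst u\<bar> \<le> 1 / bandwidth n \<Longrightarrow>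
        \<bar>snd u\<bar> \<le> 1 / bandwidth n \<Longrightarrow> cmod (ecf_moment n \<omega> e j u - fourier_moment P e j u) \<le> T n"
    by metis
  have G_lim: "(\<lambda>n. prob (space M - G n)) \<longlonglongrightarrow> 0"
  proof (rule tendsto_sandwich[of "\<lambda>_. 0"])
    show "\<forall>\<^sub>F n in sequentially. prob (space M - G n) \<le> p n"
      using eventually_ge_at_top[of 3] by eventually_elim (rule G(2))
    show "p \<longlonglongrightarrow> 0" unfolding p_def by (rule exceptional_probability_small[OF l v0])
  qed auto
  have E_lim: "(\<lambda>n. E n / copula_rate n) \<longlonglongrightarrow> 0"
  proof -
    have "(\<lambda>n. 307200 * lip_moment ^ 4 * (T n / (m n ^ 5 * (bandwidth n)\<^sup>2 * cutoff n ^ 4) / copula_rate n)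
     + (8 * measure \<mu> UNIV + 4 * c\<mu>) * (3 + 6 * L\<kappa>) * (bandwidth n * (log_factor (bandwidth n))\<^sup>2 / cutoff n ^ 5 / copula_rate n))
      \<longlonglongrightarrow> 307200 * lip_moment ^ 4 * 0 + (8 * measure \<mu> UNIV + 4 * c\<mu>) * (3 + 6 * L\<kappa>) * 0"
      unfolding T_def m_def by (intro tendsto_intros stochastic_error_small[OF c l] bias_small)
    then show ?thesis unfolding E_def by (simp add: add_divide_distrib)
  qed
  have "\<forall>\<^sub>F n in sequentially. T n / m n < 1 / 2"
    using order_tendstoD(2)[OF deviation_rate_small[OF c l], of "1 / 2"] by (simp add: T_def m_def)
  moreover have "\<forall>\<^sub>F n in sequentially. bandwidth n < 1" by (rule order_tendstoD(2)[OF bandwidth_tendsto]) simp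
  moreover have "\<forall>\<^sub>F n in sequentially. cutoff n < 1" by (rule order_tendstoD(2)[OF cutoff_tendsto]) simp
  moreover have "\<forall>\<^sub>F n in sequentially. (3::nat) \<le> n" by (rule eventually_ge_at_top)
  ultimately have "\<forall>\<^sub>F n in sequentially. \<forall>\<omega>\<in>G n. \<forall>x y. 0 \<le> x \<longrightarrow> 0 \<le> y \<longrightarrow> cutoff n \<le> max x y \<longrightarrow>
       cmod (Nhat (bandwidth n) n \<omega> x y - complex_of_real (measure \<nu> (orthant x y))) \<le> E n"
  proof eventually_elim
    case (elim n)
    have h: "0 < bandwidth n" "0 < cutoff n" using positive_rates elim by auto
    have m1: "0 < m n" "m n \<le> 1" using c by (auto simp: m_def cf_lower_bound_def)
    have m2: "m n \<le> cmod (\<phi> u)" if u: "u \<in> freq_square (bandwidth n)" for u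
    proof -
      have "c0 * (norm u)\<^sup>2 \<le> c * (2 / (bandwidth n)\<^sup>2)"
        using freq_square_norm_le[OF h(1) u] c0(1) by (intro mult_mono) (auto simp: c_def)
      then have "m n \<le> exp (- c0 * (norm u)\<^sup>2)" by (simp add: m_def cf_lower_bound_def)
      then show ?thesis using c0(2)[of u] by linarith
    qed
    have t: "T n < m n / 2" using elim(1) m1(1) by (simp add: field_simps)
    show ?case
    proof (intro ballI allI impI)
      fix \<omega> x y assume a: "\<omega> \<in> G n" "0 \<le> x" "0 \<le> y" "cutoff n \<le> max x y"
      have w: "\<omega> \<in> space M" using a(1) G(1)[of n] sets.sets_into_space by blast
      show "cmod (Nhat (bandwidth n) n \<omega> x y - complex_of_real (measure \<nu> (orthant x y))) \<le> E n"
        unfolding E_def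
      proof (rule estimator_error[OF w h(1) _ h(2) _ m1 m2 t _ a(2,3,4)])
        fix e :: "real \<times> real" and j :: nat and u :: "real \<times> real"
        assume eju: "e \<in> {(1, 0), (0, 1)}" "j \<le> 4" "u \<in> freq_square (bandwidth n)"
        have "\<bar>fst u\<bar> \<le> 1 / bandwidth n" "\<bar>snd u\<bar> \<le> 1 / bandwidth n"
          using eju(3) by (cases u; auto simp: freq_square_def abs_le_iff)+
        then show "cmod (ecf_moment n \<omega> e j u - fourier_moment P e j u) \<le> T n"
          using dev[OF elim(4) a(1) eju(1,2)] by blast
      qed (use elim in auto)
    qed
  qed
  from that[OF G(1) G_lim E_lim this] show ?thesis .
qed

text \<open>Surjectivity makes \<open>V\<close> reach every level, and monotonicity keeps it above
  that level once the cutoff has dropped below the preimage. This makes the inversion unaffected by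
  the cutoff for arguments in a fixed compact range.\<close>

lemma tail_at_cutoff_large:
  assumes "bij_betw V {0<..} {0<..}" and anti: "\<And>x y. 0 < x \<Longrightarrow> x \<le> y \<Longrightarrow> V y \<le> (V x :: real)" and "0 < z"
  shows "\<forall>\<^sub>F n in sequentially. z \<le> V (cutoff n)"
proof -
  obtain x0 where x0: "0 < x0" "V x0 = z"
    using assms(1,3) by (auto simp: bij_betw_def) (metis greaterThan_iff imageE)
  have "\<forall>\<^sub>F n in sequentially. cutoff n < x0" by (rule order_tendstoD(2)[OF cutoff_tendsto x0(1)])
  moreover have "\<forall>\<^sub>F n in sequentially. (3::nat) \<le> n" by (rule eventually_ge_at_top)
  ultimately show ?thesis
  proof eventually_elim
    case (elim n)
    show ?case using anti[of "cutoff n" x0] positive_rates(2)[of n] elim x0 by simp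
  qed
qed

text \<open>For large \<open>n\<close> the error is at most three times the rate on
  \<open>G n\<close>, so the threshold 4 is reached only off \<open>G n\<close>. The constant must
  serve every \<open>n \<ge> 3\<close>, and the finitely many remaining indices are absorbed by
  enlarging it.\<close>

lemma copula_error_rate:
  assumes ab: "0 < a" "a < b"
  shows "big_O_prob 3 M (\<lambda>n \<omega>. SUP (u, v)\<in>{a..b} \<times> {a..b}. ereal (copula_error (bandwidth n) (cutoff n) n \<omega> u v)) copula_rate"
    (is "big_O_prob 3 M ?Y copula_rate")
  unfolding big_O_prob_def
proof (intro allI impI)
  fix \<delta> :: real assume \<delta>: "0 < \<delta>"
  obtain G E where G: "\<And>n. G n \<in> sets M" "(\<lambda>n. prob (space M - G n)) \<longlonglongrightarrow> 0" and E: "(\<lambda>n. E n / copula_rate n) \<longlonglongrightarrow> 0"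
    and err: "\<forall>\<^sub>F n in sequentially. \<forall>\<omega>\<in>G n. \<forall>x y. 0 \<le> x \<longrightarrow> 0 \<le> y \<longrightarrow> cutoff n \<le> max x y \<longrightarrow>
       cmod (Nhat (bandwidth n) n \<omega> x y - complex_of_real (measure \<nu> (orthant x y))) \<le> E n"
    by (rule uniform_estimator_error) (rule that, assumption+)
  define B where "B = (\<lambda>n C. {\<omega> \<in> space M. \<bar>?Y n \<omega> / ereal (copula_rate n)\<bar> \<ge> ereal C})"
  have Ym[measurable]: "?Y n \<in> borel_measurable M" if "3 \<le> n" for n
    using copula_error_SUP_measurable[OF positive_rates(1,2)[OF that] ab] .
  have B_sets: "B n C \<in> sets M" if "3 \<le> n" for n C
    unfolding B_def using Ym[OF that] by measurable
  have Y0: "0 \<le> ?Y n \<omega>" for n \<omega>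
    using ab by (intro SUP_upper2[of "(a, a)"]) (auto simp: copula_error_def)
  have Ydiv: "\<bar>?Y n \<omega> / ereal (copula_rate n)\<bar> \<le> ereal (C / copula_rate n)" if n: "3 \<le> n" and le: "?Y n \<omega> \<le> ereal C" for n \<omega> C
  proof -
    have r: "0 < copula_rate n" by (rule positive_rates(3)[OF n])
    have "0 \<le> ?Y n \<omega> / ereal (copula_rate n)" using Y0 r by (simp add: divide_ereal_def)
    then have "\<bar>?Y n \<omega> / ereal (copula_rate n)\<bar> = ?Y n \<omega> / ereal (copula_rate n)" by simp
    also have "\<dots> \<le> ereal C / ereal (copula_rate n)" using le r by (intro ereal_divide_right_mono) auto
    also have "\<dots> = ereal (C / copula_rate n)" using r by simp
    finally show ?thesis .
  qed
  have "\<forall>\<^sub>F n in sequentially. E n / copula_rate n < 1" by (rule order_tendstoD(2)[OF E]) simp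
  \<comment> \<open>The rate plays the part of \<open>\<epsilon>\<close> in
    \<open>copula_error_le\<close>. Being below \<open>a\<close> it is below every \<open>u\<close>
    and \<open>v\<close> considered, and being below 1 it keeps \<open>u + \<epsilon>\<close> and
    \<open>v + \<epsilon>\<close> below \<open>b + 2\<close>.\<close>
  moreover have "\<forall>\<^sub>F n in sequentially. copula_rate n < min a 1" by (rule order_tendstoD(2)[OF copula_rate_tendsto]) (use ab in simp)
  moreover have "\<forall>\<^sub>F n in sequentially. prob (space M - G n) < \<delta>" by (rule order_tendstoD(2)[OF G(2) \<delta>])
  moreover have "\<forall>\<^sub>F n in sequentially. b + 2 \<le> tail_integral1 \<nu> (cutoff n)"
    using ab by (intro tail_at_cutoff_large V1_bij V1_antimono) auto
  moreover have "\<forall>\<^sub>F n in sequentially. b + 2 \<le> tail_integral2 \<nu> (cutoff n)"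
    using ab by (intro tail_at_cutoff_large V2_bij V2_antimono) auto
  moreover have "\<forall>\<^sub>F n in sequentially. (3::nat) \<le> n" by (rule eventually_ge_at_top)
  ultimately have "\<forall>\<^sub>F n in sequentially. prob (B n 4) \<le> \<delta>"
    using err
  proof eventually_elim
    case (elim n)
    have r: "0 < copula_rate n" by (rule positive_rates(3)[OF elim(6)])
    have e: "E n < copula_rate n" using elim(1) r by (simp add: field_simps)
    have "B n 4 \<subseteq> space M - G n"
    proof
      fix \<omega> assume w: "\<omega> \<in> B n 4"
      then have ws: "\<omega> \<in> space M" by (simp add: B_def)
      show "\<omega> \<in> space M - G n"
      proof (rule ccontr)
        assume "\<omega> \<notin> space M - G n"
        then have wG: "\<omega> \<in> G n" using ws by simp
        have "?Y n \<omega> \<le> ereal (3 * copula_rate n)"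
        proof (rule SUP_least, clarify)
          fix u v assume uv: "u \<in> {a..b}" "v \<in> {a..b}"
          have "copula_error (bandwidth n) (cutoff n) n \<omega> u v \<le> 3 * copula_rate n"
          proof (rule copula_error_le[OF ws positive_rates(2)[OF elim(6)]])
            fix x y :: real assume "0 \<le> x" "0 \<le> y" "cutoff n \<le> max x y"
            then have "cmod (Nhat (bandwidth n) n \<omega> x y - complex_of_real (measure \<nu> (orthant x y))) \<le> E n"
              using elim(7) wG by blast
            then show "cmod (Nhat (bandwidth n) n \<omega> x y - complex_of_real (measure \<nu> (orthant x y))) \<le> copula_rate n"
              using e by simp
          qed (use uv elim in auto)
          then show "ereal (copula_error (bandwidth n) (cutoff n) n \<omega> u v) \<le> ereal (3 * copula_rate n)" by simp
        qed
        from Ydiv[OF elim(6) this] have "\<bar>?Y n \<omega> / ereal (copula_rate n)\<bar> \<le> ereal 3" using r by simp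
        moreover have "ereal 4 \<le> \<bar>?Y n \<omega> / ereal (copula_rate n)\<bar>" using w by (simp add: B_def)
        ultimately have "ereal 4 \<le> ereal 3" by (rule order_trans[rotated])
        then show False by simp
      qed
    qed
    then have "prob (B n 4) \<le> prob (space M - G n)" using G(1)[of n] by (intro finite_measure_mono) auto
    then show ?case using elim(3) by simp
  qed
  then obtain N where N: "\<And>n. N \<le> n \<Longrightarrow> prob (B n 4) \<le> \<delta>" by (auto simp: eventually_sequentially)
  \<comment> \<open>For the finitely many remaining \<open>n\<close> the supremum is finite everywhere, hence tight.\<close>
  have "\<exists>C. prob (B n (real C)) \<le> \<delta>" if n: "3 \<le> n" for n
  proof -
    have "(\<lambda>C::nat. prob (B n (real C))) \<longlonglongrightarrow> prob (\<Inter>C::nat. B n (real C))"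
    proof (rule finite_Lim_measure_decseq)
      show "range (\<lambda>C::nat. B n (real C)) \<subseteq> events" using B_sets[OF n] by auto
      show "decseq (\<lambda>C::nat. B n (real C))"
        by (auto simp: decseq_def B_def intro: order_trans[of "ereal (real _)" "ereal (real _)"])
    qed
    also have "(\<Inter>C::nat. B n (real C)) = {}"
    proof (rule equals0I)
      fix \<omega> assume w: "\<omega> \<in> (\<Inter>C::nat. B n (real C))"
      then have ws: "\<omega> \<in> space M" by (auto simp: B_def)
      obtain C where "?Y n \<omega> \<le> ereal C"
        using copula_error_SUP_finite[OF ws positive_rates(1,2)[OF n] ab] by blast
      from Ydiv[OF n this] have up: "\<bar>?Y n \<omega> / ereal (copula_rate n)\<bar> \<le> ereal (C / copula_rate n)" .
      obtain k :: nat where k: "C / copula_rate n < real k" using reals_Archimedean2 by blast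
      have "ereal (real k) \<le> \<bar>?Y n \<omega> / ereal (copula_rate n)\<bar>" using w by (auto simp: B_def)
      then have "ereal (real k) \<le> ereal (C / copula_rate n)" using up by (rule order_trans)
      then show False using k by simp
    qed
    finally have "(\<lambda>C::nat. prob (B n (real C))) \<longlonglongrightarrow> 0" by simp
    from order_tendstoD(2)[OF this \<delta>] have "\<forall>\<^sub>F C in sequentially. prob (B n (real C)) < \<delta>" .
    then show ?thesis by (auto simp: eventually_sequentially intro: less_imp_le)
  qed
  then obtain C where C: "\<And>n. 3 \<le> n \<Longrightarrow> prob (B n (real (C n))) \<le> \<delta>" by metis
  \<comment> \<open>The events shrink as the threshold grows, so one maximum over the indices up to
    \<open>N\<close>, together with 4, works for all \<open>n\<close>.\<close>
  define D where "D = real (Max (insert 4 (C ` {..N})))"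
  have D4: "4 \<le> D" by (simp add: D_def)
  have "prob (B n D) \<le> \<delta>" if n: "3 \<le> n" for n
  proof -
    obtain c where c: "c \<le> D" "prob (B n c) \<le> \<delta>"
    proof (cases "N \<le> n")
      case True
      then show ?thesis using N D4 that by blast
    next
      case False
      then have "C n \<le> Max (insert 4 (C ` {..N}))" by (intro Max_ge) auto
      then have "real (C n) \<le> D" by (simp only: D_def of_nat_le_iff)
      then show ?thesis using C[OF n] that by blast
    qed
    have "B n D \<subseteq> B n c" using c(1) by (auto simp: B_def intro: order_trans[of "ereal c" "ereal D"])
    then have "prob (B n D) \<le> prob (B n c)" by (intro finite_measure_mono B_sets[OF n])
    then show ?thesis using c(2) by simp
  qed
  then show "\<exists>C>0. \<forall>n\<ge>3. {\<omega> \<in> space M. \<bar>?Y n \<omega> / ereal (copula_rate n)\<bar> \<ge> ereal C} \<in> sets M \<and>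
        prob {\<omega> \<in> space M. \<bar>?Y n \<omega> / ereal (copula_rate n)\<bar> \<ge> ereal C} \<le> \<delta>"
    using D4 B_sets unfolding B_def by (intro exI[of _ D]) auto
qed

end

theorem theorem3p14:
  fixes K :: "real \<times> real \<Rightarrow> real"
    and M :: "'w measure"
    and X :: "real \<Rightarrow> 'w \<Rightarrow> real \<times> real"
    and \<Sigma> :: "real \<times> real \<Rightarrow> real \<times> real"
    and \<nu> :: "(real \<times> real) measure"
    and \<alpha> :: "real \<times> real"
    and a b :: real
  assumes K_nonneg: "\<And>x. 0 \<le> K x"
    and K_L1: "integrable lborel K"
    and K_L2: "integrable lborel (\<lambda>x. (K x)\<^sup>2)"
    and K_integral: "(\<integral>x. K x \<partial>lborel) = 1"
    and K_supp: "closure {u. fourier (\<lambda>x. complex_of_real (K x)) u \<noteq> 0} \<subseteq> {-1..1} \<times> {-1..1}"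
    and K_Lipschitz: "\<exists>L. L-lipschitz_on UNIV (fourier (\<lambda>x. complex_of_real (K x)))"
    and levy: "levy_process_with_triplet M X \<Sigma> \<nu> \<alpha>"
    and quadrant: "emeasure \<nu> (UNIV - {0..} \<times> {0..}) = 0"
    and moments: "\<exists>\<gamma>>0. (\<integral>\<^sup>+x. ennreal (norm x powr (8 + \<gamma>)) \<partial>\<nu>) < \<infinity>"
    and fourier_decay:
      "\<exists>c>0. \<forall>u. cmod (fourier_measure (density \<nu> (\<lambda>x. ennreal (quartic_weight x))) u)
                  \<le> c * inverse (1 + \<bar>fst u\<bar>) * inverse (1 + \<bar>snd u\<bar>)"
    and margins:
      "\<forall>V\<in>{tail_integral1 \<nu>, tail_integral2 \<nu>}.
         bij_betw V {0<..} {0<..} \<and>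
         (\<forall>x>0. V differentiable at x) \<and>
         continuous_on {0<..} (deriv V) \<and>
         (\<forall>x>0. deriv V x < 0) \<and>
         (INF x\<in>{0<..1}. \<bar>deriv V x\<bar>) > 0 \<and>
         bdd_above ((\<lambda>x. min 1 (x ^ 3) * \<bar>deriv V x\<bar>) ` {0<..})"
    and ab: "0 < a" "a < b"
  shows "big_O_prob 3 M
           (\<lambda>n \<omega>. SUP (u, v)\<in>{a..b} \<times> {a..b}.
              ereal (cmod (complex_of_real (levy_copula \<nu> u v)
                - copula_estimator K (levy_khintchine \<Sigma> \<nu> \<alpha>) n (\<lambda>t. X (real t) \<omega>) u v)))
           (\<lambda>n. ln (ln (real n)) ^ 9 / sqrt (ln (real n)))"
proof -
  interpret levy_copula_margins K M X \<Sigma> \<nu> \<alpha>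
    by unfold_locales
       (use K_nonneg K_L1 K_integral K_supp K_Lipschitz levy moments fourier_decay margins in auto)
  show ?thesis
    using copula_error_rate[OF ab]
    by (simp only: copula_error_def copula_estimator_eq[symmetric] \<phi>_def copula_rate_def[abs_def])
qed

end
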